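(* Let $\mathbb G$ be a Carnot group and let $E\subseteq\mathbb G$ be a measurable set that has constant normal with respect to a horizontal half-space $W$. Let $S_W$ be the semigroup generated by $W$, which is a semigroup, a cone, and has nonempty interior. Then the Carnot-Lebesgue representative $\tilde E$ of $E$ has the $\overline{S_W}$-cone property (where $\overline{S_W}$ is the closure of $S_W$), is regularly open, is contractible, and its complement is contractible.
   Context: A Carnot group $\mathbb G$ is a simply connected Lie group whose Lie algebra is stratified, $V_1\oplus\cdots\oplus V_s$; $\delta_t$ ($t>0$) is the group automorphism whose differential is multiplication by $t$ on $V_1$. Elements of the Lie algebra are regarded as left-invariant vector fields. $\mathrm{vol}$ is a fixed Haar measure and $\rho$ a fixed Carnot distance (a left-invariant sub-Riemannian distance whose horizontal bundle is induced by $V_1$ with a norm coming from a scalar product). A horizontal half-space is a closed half-space $W=\{Y\in V_1:\langle Y,X\rangle\ge0\}$ of $V_1$, for a scalar product on $V_1$ and some $X\in V_1\setminus\{0\}$. $E$ has constant normal with respect to $W$ if for every $Y\in W$ one has $Y\mathbb 1_E\ge0$ in the sense of distributions, i.e. $-\int_E Yu\,d\mathrm{vol}\ge0$ for all $u\in C_c^\infty(\mathbb G)$ with $u\ge0$. The semigroup generated by $W$ is $S_W=\bigcup_{k\ge1}\{\exp(w_1)\cdots\exp(w_k):w_1,\dots,w_k\in W\}$. A cone is a nonempty $C\subseteq\mathbb G$ with $\delta_t(C)=C$ for all $t>0$; a set $F\subseteq\mathbb G$ has the $C$-cone property if $F\cdot C\subseteq F$. The Carnot-Lebesgue representative of $E$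 is $$\tilde E=\Big\{x\in\mathbb G:\lim_{r\to0^+}\frac{\mathrm{vol}(B_\rho(x,r)\cap E)}{\mathrm{vol}(B_\rho(x,r))}=1\Big\}.$$ A set is regularly open if it equals the interior of its closure. *)

theory Defs
  imports
    "HOL-Analysis.Analysis"
    "HOL-Algebra.Coset"
    "HOL-Library.Function_Algebras"
begin

section \<open>Pointwise real vector space structure on functions\<close>

instantiation "fun" :: (type, real_vector) real_vector
begin

definition scaleR_fun_def: "c *\<^sub>R f = (\<lambda>x. c *\<^sub>R f x)"

instance
  by standard (simp_all add: scaleR_fun_def fun_eq_iff scaleR_add_right scaleR_add_left)

end


section \<open>Smooth manifolds\<close>

text \<open>Differentiability classes, meaningful on open sets \<open>S\<close>.\<close>

primrec Ck_on ::
  "nat \<Rightarrow> 'a::euclidean_space set \<Rightarrow> ('a \<Rightarrow> 'b::real_normed_vector) \<Rightarrow> bool" where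
  "Ck_on 0 S f \<longleftrightarrow> continuous_on S f"
| "Ck_on (Suc k) S f \<longleftrightarrow>
     f differentiable_on S \<and> (\<forall>v. Ck_on k S (\<lambda>x. frechet_derivative f (at x) v))"

definition smooth_on :: "'a::euclidean_space set \<Rightarrow> ('a \<Rightarrow> 'b::real_normed_vector) \<Rightarrow> bool" where
  "smooth_on S f \<longleftrightarrow> (\<forall>k. Ck_on k S f)"

text \<open>A chart is a pair of its open domain and its coordinate map. The underlying topological
  space is the whole (Hausdorff, second countable) type.\<close>

type_synonym ('g, 'e) atlas = "('g set \<times> ('g \<Rightarrow> 'e)) set"

definition smooth_atlas ::
  "('g::{second_countable_topology, t2_space}, 'e::euclidean_space) atlas \<Rightarrow> bool" where
  "smooth_atlas A \<longleftrightarrow>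
     (\<Union>(U, \<phi>)\<in>A. U) = UNIV \<and>
     (\<forall>(U, \<phi>)\<in>A. open U \<and> open (\<phi> ` U) \<and> homeomorphism U (\<phi> ` U) \<phi> (inv_into U \<phi>)) \<and>
     (\<forall>(U, \<phi>)\<in>A. \<forall>(V, \<psi>)\<in>A. smooth_on (\<phi> ` (U \<inter> V)) (\<psi> \<circ> inv_into U \<phi>))"

definition smooth_map ::
  "('m::topological_space, 'a::euclidean_space) atlas \<Rightarrow>
   ('n::topological_space, 'b::euclidean_space) atlas \<Rightarrow> ('m \<Rightarrow> 'n) \<Rightarrow> bool" where
  "smooth_map A B F \<longleftrightarrow>
     continuous_on UNIV F \<and>
     (\<forall>(U, \<phi>)\<in>A. \<forall>(V, \<psi>)\<in>B. smooth_on (\<phi> ` (U \<inter> F -` V)) (\<psi> \<circ> F \<circ> inv_into U \<phi>))"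

definition prod_atlas ::
  "('m, 'a) atlas \<Rightarrow> ('n, 'b) atlas \<Rightarrow> ('m \<times> 'n, 'a \<times> 'b) atlas" where
  "prod_atlas A B = {(U \<times> V, map_prod \<phi> \<psi>) | U \<phi> V \<psi>. (U, \<phi>) \<in> A \<and> (V, \<psi>) \<in> B}"

abbreviation smooth_fun ::
  "('g::topological_space, 'e::euclidean_space) atlas \<Rightarrow> ('g \<Rightarrow> real) \<Rightarrow> bool" where
  "smooth_fun A f \<equiv> smooth_map A {(UNIV, \<lambda>t::real. t)} f"

text \<open>Smooth vector fields are the derivations of the algebra of smooth functions. A derivation
  is extended by \<open>0\<close> to the non-smooth functions, so that equal fields are equal objects; the
  zero extension is preserved by linear combinations and Lie brackets.\<close>

type_synonym 'g vfield = "('g \<Rightarrow> real) \<Rightarrow> 'g \<Rightarrow> real"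

definition vector_fields ::
  "('g::topological_space, 'e::euclidean_space) atlas \<Rightarrow> 'g vfield set" where
  "vector_fields A = {X.
     (\<forall>f. \<not> smooth_fun A f \<longrightarrow> X f = 0) \<and>
     (\<forall>f. smooth_fun A f \<longrightarrow> smooth_fun A (X f)) \<and>
     (\<forall>f g. \<forall>a b. smooth_fun A f \<longrightarrow> smooth_fun A g \<longrightarrow>
        X (\<lambda>x. a * f x + b * g x) = (\<lambda>x. a * X f x + b * X g x)) \<and>
     (\<forall>f g. smooth_fun A f \<longrightarrow> smooth_fun A g \<longrightarrow>
        X (\<lambda>x. f x * g x) = (\<lambda>x. f x * X g x + g x * X f x))}"

definition lie_bracket :: "'g vfield \<Rightarrow> 'g vfield \<Rightarrow> 'g vfield" where
  "lie_bracket X Y = (\<lambda>f. X (Y f) - Y (X f))"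


section \<open>Lie groups, their Lie algebra and exponential map\<close>

definition lie_group ::
  "'g::{second_countable_topology, t2_space} monoid \<Rightarrow> ('g, 'e::euclidean_space) atlas \<Rightarrow> bool" where
  "lie_group G A \<longleftrightarrow>
     group G \<and> carrier G = UNIV \<and> smooth_atlas A \<and>
     smooth_map (prod_atlas A A) A (\<lambda>(x, y). x \<otimes>\<^bsub>G\<^esub> y) \<and>
     smooth_map A A (\<lambda>x. inv\<^bsub>G\<^esub> x)"

definition lie_algebra ::
  "'g::topological_space monoid \<Rightarrow> ('g, 'e::euclidean_space) atlas \<Rightarrow> 'g vfield set" where
  "lie_algebra G A = {X \<in> vector_fields A. \<forall>g f. smooth_fun A f \<longrightarrow>
     X (\<lambda>x. f (g \<otimes>\<^bsub>G\<^esub> x)) = (\<lambda>x. X f (g \<otimes>\<^bsub>G\<^esub> x))}"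

definition integral_curve ::
  "('g::topological_space, 'e::euclidean_space) atlas \<Rightarrow> 'g vfield \<Rightarrow> (real \<Rightarrow> 'g) \<Rightarrow> bool" where
  "integral_curve A X \<gamma> \<longleftrightarrow>
     (\<forall>f. smooth_fun A f \<longrightarrow>
        (\<forall>t. ((\<lambda>s. f (\<gamma> s)) has_real_derivative X f (\<gamma> t)) (at t)))"

definition lie_exp ::
  "'g::topological_space monoid \<Rightarrow> ('g, 'e::euclidean_space) atlas \<Rightarrow> 'g vfield \<Rightarrow> 'g" where
  "lie_exp G A X = (THE g. \<exists>\<gamma>. integral_curve A X \<gamma> \<and> \<gamma> 0 = \<one>\<^bsub>G\<^esub> \<and> \<gamma> 1 = g)"


section \<open>Carnot groups\<close>

definition stratification ::
  "'g::topological_space monoid \<Rightarrow> ('g, 'e::euclidean_space) atlas \<Rightarrow>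
   nat \<Rightarrow> (nat \<Rightarrow> 'g vfield set) \<Rightarrow> bool" where
  "stratification G A s V \<longleftrightarrow>
     1 \<le> s \<and>
     (\<forall>i\<in>{1..s}. subspace (V i) \<and> V i \<subseteq> lie_algebra G A) \<and>
     (\<forall>X\<in>lie_algebra G A. \<exists>!v.
        (\<forall>i\<in>{1..s}. v i \<in> V i) \<and> (\<forall>i. i \<notin> {1..s} \<longrightarrow> v i = 0) \<and> X = (\<Sum>i=1..s. v i)) \<and>
     (\<forall>j\<in>{1..<s}. span {lie_bracket X Y | X Y. X \<in> V 1 \<and> Y \<in> V j} = V (Suc j)) \<and>
     span {lie_bracket X Y | X Y. X \<in> V 1 \<and> Y \<in> V s} = {0} \<and>
     V s \<noteq> {0}"

definition carnot_group ::
  "'g::{second_countable_topology, t2_space} monoid \<Rightarrow> ('g, 'e::euclidean_space) atlas \<Rightarrow>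
   nat \<Rightarrow> (nat \<Rightarrow> 'g vfield set) \<Rightarrow> bool" where
  "carnot_group G A s V \<longleftrightarrow>
     lie_group G A \<and> simply_connected (UNIV :: 'g set) \<and> stratification G A s V"

text \<open>The condition on the differential says that the push-forward of \<open>Y\<close> under \<open>\<delta> t\<close> is
  \<open>t *\<^sub>R Y\<close>. The family \<open>\<delta>\<close> is uniquely determined on \<open>t > 0\<close>, because \<open>V1\<close> generates the Lie
  algebra and the group is connected.\<close>

definition dilations ::
  "'g::topological_space monoid \<Rightarrow> ('g, 'e::euclidean_space) atlas \<Rightarrow> 'g vfield set \<Rightarrow>
   (real \<Rightarrow> 'g \<Rightarrow> 'g) \<Rightarrow> bool" where
  "dilations G A V1 \<delta> \<longleftrightarrow>
     (\<forall>t>0. \<delta> t \<in> iso G G \<and> smooth_map A A (\<delta> t) \<and> smooth_map A A (inv_into UNIV (\<delta> t)) \<and>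
       (\<forall>Y\<in>V1. \<forall>f. smooth_fun A f \<longrightarrow>
          Y (\<lambda>x. f (\<delta> t x)) = (\<lambda>x. t * Y f (\<delta> t x))))"

text \<open>Regularity is automatic on a second countable locally compact Hausdorff space.\<close>

definition haar_measure :: "'g::topological_space monoid \<Rightarrow> 'g measure \<Rightarrow> bool" where
  "haar_measure G vol \<longleftrightarrow>
     sets vol = sets borel \<and>
     (\<forall>g. \<forall>B\<in>sets borel. emeasure vol ((\<lambda>x. g \<otimes>\<^bsub>G\<^esub> x) ` B) = emeasure vol B) \<and>
     (\<forall>K. compact K \<longrightarrow> emeasure vol K < \<infinity>) \<and>
     emeasure vol UNIV \<noteq> 0"

definition scalar_product_on :: "'v::real_vector set \<Rightarrow> ('v \<Rightarrow> 'v \<Rightarrow> real) \<Rightarrow> bool" where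
  "scalar_product_on V h \<longleftrightarrow>
     (\<forall>X\<in>V. \<forall>Y\<in>V. h X Y = h Y X) \<and>
     (\<forall>X\<in>V. \<forall>Y\<in>V. \<forall>Z\<in>V. \<forall>a b. h (a *\<^sub>R X + b *\<^sub>R Y) Z = a * h X Z + b * h Y Z) \<and>
     (\<forall>X\<in>V. X \<noteq> 0 \<longrightarrow> h X X > 0)"

text \<open>Absolutely continuous horizontal curves \<open>\<gamma> : [0,1] \<rightarrow> G\<close> with velocity \<open>u s\<close> at almost every
  time \<open>s\<close>: every \<open>f \<circ> \<gamma>\<close> is the indefinite Lebesgue integral of \<open>s \<mapsto> (u s f)(\<gamma> s)\<close>.\<close>

definition horizontal_curve ::
  "('g::topological_space, 'e::euclidean_space) atlas \<Rightarrow> 'g vfield set \<Rightarrow>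
   (real \<Rightarrow> 'g) \<Rightarrow> (real \<Rightarrow> 'g vfield) \<Rightarrow> bool" where
  "horizontal_curve A V1 \<gamma> u \<longleftrightarrow>
     (\<forall>s\<in>{0..1}. u s \<in> V1) \<and>
     (\<forall>f. smooth_fun A f \<longrightarrow>
        (\<lambda>s. u s f (\<gamma> s)) absolutely_integrable_on {0..1} \<and>
        (\<forall>t\<in>{0..1}. f (\<gamma> t) = f (\<gamma> 0) + integral {0..t} (\<lambda>s. u s f (\<gamma> s))))"

definition carnot_distance ::
  "('g::topological_space, 'e::euclidean_space) atlas \<Rightarrow> 'g vfield set \<Rightarrow>
   ('g vfield \<Rightarrow> 'g vfield \<Rightarrow> real) \<Rightarrow> 'g \<Rightarrow> 'g \<Rightarrow> real" where
  "carnot_distance A V1 h x y =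
     Inf {integral {0..1} (\<lambda>s. sqrt (h (u s) (u s))) | \<gamma> u.
       horizontal_curve A V1 \<gamma> u \<and> \<gamma> 0 = x \<and> \<gamma> 1 = y \<and>
       (\<lambda>s. sqrt (h (u s) (u s))) absolutely_integrable_on {0..1}}"


section \<open>Sets with constant horizontal normal\<close>

definition horizontal_half_space :: "'v::real_vector set \<Rightarrow> 'v set \<Rightarrow> bool" where
  "horizontal_half_space V1 W \<longleftrightarrow>
     (\<exists>h X. scalar_product_on V1 h \<and> X \<in> V1 - {0} \<and> W = {Y \<in> V1. h Y X \<ge> 0})"

definition constant_normal ::
  "('g::topological_space, 'e::euclidean_space) atlas \<Rightarrow> 'g measure \<Rightarrow>
   'g vfield set \<Rightarrow> 'g set \<Rightarrow> bool" where
  "constant_normal A M W E \<longleftrightarrow>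
     (\<forall>Y\<in>W. \<forall>u. smooth_fun A u \<longrightarrow> compact (closure {x. u x \<noteq> 0}) \<longrightarrow> (\<forall>x. 0 \<le> u x) \<longrightarrow>
        - (LINT x:E|M. Y u x) \<ge> 0)"

definition generated_semigroup ::
  "'g::topological_space monoid \<Rightarrow> ('g, 'e::euclidean_space) atlas \<Rightarrow> 'g vfield set \<Rightarrow> 'g set" where
  "generated_semigroup G A W =
     {foldr (\<otimes>\<^bsub>G\<^esub>) (map (lie_exp G A) ws) \<one>\<^bsub>G\<^esub> | ws. ws \<noteq> [] \<and> set ws \<subseteq> W}"

definition is_subsemigroup :: "'g monoid \<Rightarrow> 'g set \<Rightarrow> bool" where
  "is_subsemigroup G S \<longleftrightarrow> (\<forall>x\<in>S. \<forall>y\<in>S. x \<otimes>\<^bsub>G\<^esub> y \<in> S)"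

definition is_cone :: "(real \<Rightarrow> 'g \<Rightarrow> 'g) \<Rightarrow> 'g set \<Rightarrow> bool" where
  "is_cone \<delta> C \<longleftrightarrow> C \<noteq> {} \<and> (\<forall>t>0. \<delta> t ` C = C)"

definition has_cone_property :: "'g monoid \<Rightarrow> 'g set \<Rightarrow> 'g set \<Rightarrow> bool" where
  "has_cone_property G C F \<longleftrightarrow> F <#>\<^bsub>G\<^esub> C \<subseteq> F"

definition lebesgue_representative ::
  "('g \<Rightarrow> 'g \<Rightarrow> real) \<Rightarrow> 'g measure \<Rightarrow> 'g set \<Rightarrow> 'g set" where
  "lebesgue_representative \<rho> M E =
     {x. ((\<lambda>r. measure M ({y. \<rho> x y < r} \<inter> E) / measure M {y. \<rho> x y < r}) \<longlongrightarrow> 1) (at_right 0)}"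

definition regularly_open :: "'a::topological_space set \<Rightarrow> bool" where
  "regularly_open S \<longleftrightarrow> S = interior (closure S)"

end

theory Submission
  imports Defs
begin

text \<open>
  \<^bold>\<open>The semigroup has interior.\<close> The span of all \<open>Ad(p) w\<close> with \<open>p \<in> S\<close>, \<open>w \<in> W\<close> is stable under brackets
  with \<open>V\<^sub>1\<close>, hence is the whole Lie algebra. So some product of flows in \<open>S\<close> depends on its times with
  surjective derivative and is open there. It also follows that a neighbourhood of the identity is
  reached by horizontal curves of bounded length, whence the Carnot distance is finite, homogeneous
  and induces the topology.

  \<^bold>\<open>The representative is open.\<close> Along the flow of \<open>Y \<in> W\<close> the indicator of \<open>E\<close> increases, so almost
  every \<open>x \<in> E\<close> satisfies \<open>xp \<in> E\<close>, for each \<open>p \<in> S\<close>. By Fubini \<open>x \<cdot> int S\<close> lies in \<open>E\<close> up to a null set for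
  almost every \<open>x \<in> E\<close>. Let \<open>O\<close> be the set of points with a neighbourhood essentially inside \<open>E\<close>; then
  \<open>supp E \<cdot> int S \<subseteq> O\<close>. If \<open>x \<notin> O\<close>, then \<open>E\<close> misses \<open>x \<cdot> (int S)\<inverse>\<close>, which by homogeneity and doubling fills a
  fixed fraction of all small balls at \<open>x\<close>; so \<open>x\<close> is not a density point, and \<open>O\<close> is the representative.
  The cone property and regular openness follow because \<open>int S\<close> accumulates at the identity.

  \<^bold>\<open>Contractibility.\<close> A set \<open>F\<close> with \<open>F \<cdot> T \<subseteq> F\<close> for a cone \<open>T\<close> with an interior point \<open>p\<close> contracts: multiply by
  large dilates of \<open>p\<close> to get into a translate of \<open>T\<close>, then dilate to the vertex. Take \<open>T = S\<close> for
  the representative and \<open>T = S\<inverse>\<close> for its complement.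
\<close>

section \<open>Calculus of the classes of differentiability\<close>

text \<open>Only horizontal fields are integrated for all times, so neither a global exponential nor
  a Campbell-Hausdorff formula enters: a left-invariant field is encoded by its coordinate vector at
  \<open>\<one>\<close> (\<open>lf\<close>), Picard iteration gives its curves for short times, and
  dilations prolong those of \<open>V 1\<close>. Points and maps are examined through global smooth
  functions, which is why bump functions come early. Each \<open>\<delta> t\<close> is given
  separately; the law \<open>\<delta> a (\<delta> b x) = \<delta> (a * b) x\<close> becomes
  available only once connectedness has shown that \<open>V 1\<close> generates the group. A
  half-space offers at least one sign of each direction. That is enough for brackets, since a curve
  lying in a subspace for times of one sign has its derivative at 0 in that subspace. The Haar
  measure is invariant under left translations, whereas the normal condition controls right
  translations by flows; Fubini converts the latter into statements about left translates of the
  interior of the semigroup. Since E is measurable only for the completion, a Borel part of it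
  carries the product-measure arguments.\<close>

lemma Ck_on_cong:
  assumes "open S" "Ck_on k S f" "\<And>x. x \<in> S \<Longrightarrow> f x = g x"
  shows "Ck_on k S g"
  using assms
proof (induction k arbitrary: f g)
  case 0
  then show ?case by (simp cong: continuous_on_cong)
next
  case (Suc k)
  have d: "f differentiable at x" if "x \<in> S" for x
    using Suc.prems(1,2) that by (auto simp: differentiable_on_eq_differentiable_at)
  have eq: "frechet_derivative f (at x) = frechet_derivative g (at x)" if "x \<in> S" for x
    using frechet_derivative_transform_within_open[OF d[OF that] Suc.prems(1) that Suc.prems(3)] .
  have "g differentiable at x" if "x \<in> S" for x
    using d[OF that] Suc.prems(1,3) that unfolding differentiable_def
    by (meson has_derivative_transform_within_open)
  then have "g differentiable_on S"
    using Suc.prems(1) by (simp add: differentiable_on_eq_differentiable_at)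
  moreover have "Ck_on k S (\<lambda>x. frechet_derivative g (at x) v)" for v
    using Suc.IH[OF Suc.prems(1), of "\<lambda>x. frechet_derivative f (at x) v"] Suc.prems(2) eq by simp
  ultimately show ?case by simp
qed

text \<open>Derivatives are met as explicit families f', whereas \<open>Ck_on\<close> speaks of
  \<open>frechet_derivative\<close>; on an open set uniqueness of the derivative identifies the two.
  The algebraic closure rules below use this form in their inductions.\<close>

lemma Ck_on_Suc_iff:
  assumes "open S"
  shows "Ck_on (Suc k) S f \<longleftrightarrow>
    (\<exists>f'. (\<forall>x\<in>S. (f has_derivative f' x) (at x)) \<and> (\<forall>v. Ck_on k S (\<lambda>x. f' x v)))"
proof
  assume L: "Ck_on (Suc k) S f"
  then have "\<forall>x\<in>S. (f has_derivative frechet_derivative f (at x)) (at x)"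
    using assms by (simp add: differentiable_on_eq_differentiable_at frechet_derivative_works)
  with L show "\<exists>f'. (\<forall>x\<in>S. (f has_derivative f' x) (at x)) \<and> (\<forall>v. Ck_on k S (\<lambda>x. f' x v))"
    by (intro exI[of _ "\<lambda>x. frechet_derivative f (at x)"]) auto
next
  assume "\<exists>f'. (\<forall>x\<in>S. (f has_derivative f' x) (at x)) \<and> (\<forall>v. Ck_on k S (\<lambda>x. f' x v))"
  then obtain f' where f': "\<And>x. x \<in> S \<Longrightarrow> (f has_derivative f' x) (at x)"
    and ck: "\<And>v. Ck_on k S (\<lambda>x. f' x v)" by blast
  have "f differentiable_on S"
    using f' assms by (auto simp: differentiable_on_eq_differentiable_at differentiable_def)
  moreover have "Ck_on k S (\<lambda>x. frechet_derivative f (at x) v)" for v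
    by (rule Ck_on_cong[OF assms ck[of v]]) (simp add: frechet_derivative_at[OF f', symmetric])
  ultimately show "Ck_on (Suc k) S f" by simp
qed

lemma Ck_on_SucI:
  assumes "open S" "\<And>x. x \<in> S \<Longrightarrow> (f has_derivative f' x) (at x)"
    "\<And>v. Ck_on k S (\<lambda>x. f' x v)"
  shows "Ck_on (Suc k) S f"
  unfolding Ck_on_Suc_iff[OF assms(1)] using assms(2,3) by blast

lemma Ck_on_SucE:
  assumes "Ck_on (Suc k) S f" "open S"
  obtains f' where "\<And>x. x \<in> S \<Longrightarrow> (f has_derivative f' x) (at x)" "\<And>v. Ck_on k S (\<lambda>x. f' x v)"
  using assms by (auto simp only: Ck_on_Suc_iff)

lemma Ck_on_lower:
  assumes "Ck_on (Suc k) S f" "open S"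
  shows "Ck_on k S f"
  using assms
proof (induction k arbitrary: f)
  case 0
  then show ?case by (simp add: differentiable_imp_continuous_on)
next
  case (Suc k)
  from Suc.prems obtain f' where "\<And>x. x \<in> S \<Longrightarrow> (f has_derivative f' x) (at x)"
    "\<And>v. Ck_on (Suc k) S (\<lambda>x. f' x v)" by (rule Ck_on_SucE) auto
  with Suc show ?case by (intro Ck_on_SucI) auto
qed

lemma Ck_on_continuous: "Ck_on k S f \<Longrightarrow> open S \<Longrightarrow> continuous_on S f"
  by (cases k) (auto simp: differentiable_imp_continuous_on)

lemma Ck_on_subset:
  assumes "Ck_on k S f" "T \<subseteq> S" "open S" "open T"
  shows "Ck_on k T f"
  using assms
proof (induction k arbitrary: f)
  case 0
  then show ?case by (auto intro: continuous_on_subset)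
next
  case (Suc k)
  from Suc.prems(1,3) obtain f' where f': "\<And>x. x \<in> S \<Longrightarrow> (f has_derivative f' x) (at x)"
    "\<And>v. Ck_on k S (\<lambda>x. f' x v)" by (rule Ck_on_SucE) auto
  show ?case
    by (rule Ck_on_SucI[OF Suc.prems(4)]) (use f' Suc in blast)+
qed

text \<open>Derivatives at a point depend on a neighbourhood only. This permits smoothness of maps
  into the group to be checked where all points involved lie in single charts.\<close>

lemma Ck_on_local:
  assumes "open S" "\<And>x. x \<in> S \<Longrightarrow> \<exists>U. open U \<and> x \<in> U \<and> U \<subseteq> S \<and> Ck_on k U f"
  shows "Ck_on k S f"
  using assms
proof (induction k arbitrary: f)
  case 0
  have "continuous (at x) f" if "x \<in> S" for x
    using 0(2)[OF that] by (auto simp: continuous_on_eq_continuous_at)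
  then show ?case using 0(1) by (simp add: continuous_on_eq_continuous_at)
next
  case (Suc k)
  have d: "f differentiable at x" if x: "x \<in> S" for x
  proof -
    obtain U where "open U" "x \<in> U" "Ck_on (Suc k) U f" using Suc.prems(2)[OF x] by blast
    then show ?thesis by (auto simp: differentiable_on_eq_differentiable_at)
  qed
  have "Ck_on k S (\<lambda>x. frechet_derivative f (at x) v)" for v
  proof (rule Suc.IH[OF Suc.prems(1)])
    fix x assume "x \<in> S"
    then obtain U where "open U" "x \<in> U" "U \<subseteq> S" "Ck_on (Suc k) U f" using Suc.prems(2) by blast
    then show "\<exists>U. open U \<and> x \<in> U \<and> U \<subseteq> S \<and> Ck_on k U (\<lambda>x. frechet_derivative f (at x) v)"
      by auto
  qed
  then show ?case using d Suc.prems(1) by (simp add: differentiable_on_eq_differentiable_at)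
qed

lemma Ck_on_const: "open S \<Longrightarrow> Ck_on k S (\<lambda>x. c)"
proof (induction k arbitrary: c)
  case (Suc k)
  then show ?case by (intro Ck_on_SucI[where f' = "\<lambda>x v. 0"]) auto
qed simp

lemma Ck_on_linear:
  assumes "open S" "bounded_linear L"
  shows "Ck_on k S L"
proof (cases k)
  case 0
  then show ?thesis using assms(2) by (simp add: linear_continuous_on)
next
  case (Suc m)
  show ?thesis unfolding Suc
    by (rule Ck_on_SucI[where f' = "\<lambda>x. L", OF assms(1) bounded_linear_imp_has_derivative[OF assms(2)] Ck_on_const[OF assms(1)]])
qed

lemma Ck_on_linear_comp:
  assumes "open S" "bounded_linear L" "Ck_on k S f"
  shows "Ck_on k S (\<lambda>x. L (f x))"
  using assms
proof (induction k arbitrary: f)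
  case 0
  then show ?case by (simp add: bounded_linear.continuous_on)
next
  case (Suc k)
  from Suc.prems(3,1) obtain f' where f': "\<And>x. x \<in> S \<Longrightarrow> (f has_derivative f' x) (at x)"
    "\<And>v. Ck_on k S (\<lambda>x. f' x v)" by (rule Ck_on_SucE) auto
  show ?case
    by (rule Ck_on_SucI[OF Suc.prems(1) bounded_linear.has_derivative[OF Suc.prems(2) f'(1)]
       Suc.IH[OF Suc.prems(1,2) f'(2)]])
qed

lemma Ck_on_add:
  assumes "open S" "Ck_on k S f" "Ck_on k S g"
  shows "Ck_on k S (\<lambda>x. f x + g x)"
  using assms
proof (induction k arbitrary: f g)
  case 0
  then show ?case by (auto intro: continuous_on_add)
next
  case (Suc k)
  from Suc.prems(2,1) obtain f' where f': "\<And>x. x \<in> S \<Longrightarrow> (f has_derivative f' x) (at x)"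
    "\<And>v. Ck_on k S (\<lambda>x. f' x v)" by (rule Ck_on_SucE) auto
  from Suc.prems(3,1) obtain g' where g': "\<And>x. x \<in> S \<Longrightarrow> (g has_derivative g' x) (at x)"
    "\<And>v. Ck_on k S (\<lambda>x. g' x v)" by (rule Ck_on_SucE) auto
  show ?case
    by (rule Ck_on_SucI[where f' = "\<lambda>x v. f' x v + g' x v"])
      (use f' g' Suc in \<open>auto intro: has_derivative_add\<close>)
qed

lemma Ck_on_scaleR:
  fixes f :: "'a::euclidean_space \<Rightarrow> real"
  assumes "open S" "Ck_on k S f" "Ck_on k S g"
  shows "Ck_on k S (\<lambda>x. f x *\<^sub>R g x)"
  using assms
proof (induction k arbitrary: f g)
  case 0
  then show ?case by (auto intro: continuous_on_scaleR)
next
  case (Suc k)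
  \<comment> \<open>The product rule also contains the undifferentiated factors, which must be
    lowered to class k to meet the induction hypothesis.\<close>
  note low = Ck_on_lower[OF Suc.prems(2,1)] Ck_on_lower[OF Suc.prems(3,1)]
  from Suc.prems(2,1) obtain f' where f': "\<And>x. x \<in> S \<Longrightarrow> (f has_derivative f' x) (at x)"
    "\<And>v. Ck_on k S (\<lambda>x. f' x v)" by (rule Ck_on_SucE) auto
  from Suc.prems(3,1) obtain g' where g': "\<And>x. x \<in> S \<Longrightarrow> (g has_derivative g' x) (at x)"
    "\<And>v. Ck_on k S (\<lambda>x. g' x v)" by (rule Ck_on_SucE) auto
  show ?case
    by (rule Ck_on_SucI[where f' = "\<lambda>x v. f x *\<^sub>R g' x v + f' x v *\<^sub>R g x"])
      (use f' g' Suc.IH Suc.prems(1) low in \<open>auto intro!: has_derivative_scaleR Ck_on_add\<close>)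
qed

lemma Ck_on_sum:
  assumes "open S" "\<And>i. i \<in> I \<Longrightarrow> Ck_on k S (f i)"
  shows "Ck_on k S (\<lambda>x. \<Sum>i\<in>I. f i x)"
  using assms(2)
  by (induction I rule: infinite_finite_induct)
    (auto simp: Ck_on_const assms(1) Ck_on_add)

lemma Ck_on_compose:
  fixes f :: "'a::euclidean_space \<Rightarrow> 'b::euclidean_space"
  assumes "open S" "open T" "f ` S \<subseteq> T" "Ck_on k S f" "Ck_on k T g"
  shows "Ck_on k S (\<lambda>x. g (f x))"
  using assms(4,5)
proof (induction k arbitrary: g)
  case 0
  then show ?case using assms(3) by (auto intro: continuous_on_compose2)
next
  case (Suc k)
  note low = Ck_on_lower[OF Suc.prems(1) assms(1)]
  from Suc.prems(1) assms(1) obtain f' where f': "\<And>x. x \<in> S \<Longrightarrow> (f has_derivative f' x) (at x)"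
    "\<And>v. Ck_on k S (\<lambda>x. f' x v)" by (rule Ck_on_SucE) auto
  from Suc.prems(2) assms(2) obtain g' where g': "\<And>x. x \<in> T \<Longrightarrow> (g has_derivative g' x) (at x)"
    "\<And>v. Ck_on k T (\<lambda>x. g' x v)" by (rule Ck_on_SucE) auto
  show ?case
  proof (rule Ck_on_SucI[OF assms(1), where f' = "\<lambda>x v. g' (f x) (f' x v)"])
    show "((\<lambda>x. g (f x)) has_derivative (\<lambda>v. g' (f x) (f' x v))) (at x)" if "x \<in> S" for x
      using has_derivative_compose[OF f'(1)[OF that] g'(1)] that assms(3) by auto
    fix v
    \<comment> \<open>The direction \<open>f' x v\<close> varies with x, while g' is controlled for
      fixed directions; expansion in \<open>Basis\<close> separates the two.\<close>
    have "Ck_on k S (\<lambda>x. \<Sum>b\<in>Basis. (f' x v \<bullet> b) *\<^sub>R g' (f x) b)"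
      by (intro Ck_on_sum Ck_on_scaleR assms(1) Ck_on_linear_comp[OF assms(1) bounded_linear_inner_left] f'(2)
          Suc.IH low g'(2))
    moreover have "(\<Sum>b\<in>Basis. (f' x v \<bullet> b) *\<^sub>R g' (f x) b) = g' (f x) (f' x v)" if "x \<in> S" for x
    proof -
      have "linear (g' (f x))"
        using g'(1) assms(3) that has_derivative_linear by blast
      then have "g' (f x) (\<Sum>b\<in>Basis. (f' x v \<bullet> b) *\<^sub>R b) = (\<Sum>b\<in>Basis. (f' x v \<bullet> b) *\<^sub>R g' (f x) b)"
        by (simp add: linear_sum linear_cmul)
      then show ?thesis by (simp add: euclidean_representation)
    qed
    ultimately show "Ck_on k S (\<lambda>x. g' (f x) (f' x v))"
      by (rule Ck_on_cong[OF assms(1)])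
  qed
qed

lemma Ck_on_inverse:
  fixes f :: "'a::euclidean_space \<Rightarrow> real"
  assumes "open S" "Ck_on k S f" "\<And>x. x \<in> S \<Longrightarrow> f x \<noteq> 0"
  shows "Ck_on k S (\<lambda>x. inverse (f x))"
  using assms(2)
proof (induction k)
  case 0
  then show ?case using assms(3) by (auto intro: continuous_on_inverse)
next
  case (Suc k)
  note low = Suc.IH[OF Ck_on_lower[OF Suc.prems assms(1)]]
  from Suc.prems(1) assms(1) obtain f' where f': "\<And>x. x \<in> S \<Longrightarrow> (f has_derivative f' x) (at x)"
    "\<And>v. Ck_on k S (\<lambda>x. f' x v)" by (rule Ck_on_SucE) auto
  have "Ck_on k S (\<lambda>x. inverse (f x) *\<^sub>R (- (f' x v)) *\<^sub>R inverse (f x))" for v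
    by (intro Ck_on_scaleR assms(1) low Ck_on_linear_comp[OF assms(1) bounded_linear_minus[OF bounded_linear_ident]] f'(2))
  then have ck: "Ck_on k S (\<lambda>x. - (inverse (f x) * f' x v * inverse (f x)))" for v
    by (simp add: algebra_simps)
  show ?case
    by (rule Ck_on_SucI[where f' = "\<lambda>x v. - (inverse (f x) * f' x v * inverse (f x))", OF assms(1) _ ck])
      (rule Deriv.has_derivative_inverse[OF assms(3) f'(1)])
qed

lemma smooth_onD: "smooth_on S f \<Longrightarrow> Ck_on k S f"
  by (simp add: smooth_on_def)

lemma smooth_on_cong: "open S \<Longrightarrow> smooth_on S f \<Longrightarrow> (\<And>x. x \<in> S \<Longrightarrow> f x = g x) \<Longrightarrow> smooth_on S g"
  using Ck_on_cong unfolding smooth_on_def by blast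

lemma smooth_on_subset: "smooth_on S f \<Longrightarrow> T \<subseteq> S \<Longrightarrow> open S \<Longrightarrow> open T \<Longrightarrow> smooth_on T f"
  using Ck_on_subset unfolding smooth_on_def by blast

lemma smooth_on_local:
  assumes "open S" "\<And>x. x \<in> S \<Longrightarrow> \<exists>U. open U \<and> x \<in> U \<and> U \<subseteq> S \<and> smooth_on U f"
  shows "smooth_on S f"
  unfolding smooth_on_def
proof
  fix k
  show "Ck_on k S f"
  proof (rule Ck_on_local[OF assms(1)])
    fix x assume "x \<in> S"
    from assms(2)[OF this] show "\<exists>U. open U \<and> x \<in> U \<and> U \<subseteq> S \<and> Ck_on k U f"
      by (auto simp: smooth_on_def)
  qed
qed

lemma smooth_on_const: "open S \<Longrightarrow> smooth_on S (\<lambda>x. c)"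
  by (simp add: smooth_on_def Ck_on_const)

lemma smooth_on_linear: "open S \<Longrightarrow> bounded_linear L \<Longrightarrow> smooth_on S L"
  by (simp add: smooth_on_def Ck_on_linear)

lemma smooth_on_ident: "open S \<Longrightarrow> smooth_on S (\<lambda>x. x)"
  by (simp add: smooth_on_linear bounded_linear_ident)

lemma smooth_on_linear_comp:
  "open S \<Longrightarrow> bounded_linear L \<Longrightarrow> smooth_on S f \<Longrightarrow> smooth_on S (\<lambda>x. L (f x))"
  by (simp add: smooth_on_def Ck_on_linear_comp)

lemma smooth_on_add: "open S \<Longrightarrow> smooth_on S f \<Longrightarrow> smooth_on S g \<Longrightarrow> smooth_on S (\<lambda>x. f x + g x)"
  by (simp add: smooth_on_def Ck_on_add)

lemma smooth_on_scaleR: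
  "open S \<Longrightarrow> smooth_on S f \<Longrightarrow> smooth_on S g \<Longrightarrow> smooth_on S (\<lambda>x. f x *\<^sub>R g x)"
  by (simp add: smooth_on_def Ck_on_scaleR)

lemma smooth_on_mult:
  fixes f g :: "'a::euclidean_space \<Rightarrow> real"
  shows "open S \<Longrightarrow> smooth_on S f \<Longrightarrow> smooth_on S g \<Longrightarrow> smooth_on S (\<lambda>x. f x * g x)"
  using smooth_on_scaleR[of S f g] by simp

lemma smooth_on_minus: "open S \<Longrightarrow> smooth_on S f \<Longrightarrow> smooth_on S (\<lambda>x. - f x)"
  using smooth_on_linear_comp[OF _ bounded_linear_minus[OF bounded_linear_ident]] by blast

lemma smooth_on_diff: "open S \<Longrightarrow> smooth_on S f \<Longrightarrow> smooth_on S g \<Longrightarrow> smooth_on S (\<lambda>x. f x - g x)"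
  using smooth_on_add[of S f "\<lambda>x. - g x"] by (simp add: smooth_on_minus)

lemma smooth_on_sum:
  "open S \<Longrightarrow> (\<And>i. i \<in> I \<Longrightarrow> smooth_on S (f i)) \<Longrightarrow> smooth_on S (\<lambda>x. \<Sum>i\<in>I. f i x)"
  by (simp add: smooth_on_def Ck_on_sum)

lemma smooth_on_inverse:
  fixes f :: "'a::euclidean_space \<Rightarrow> real"
  shows "open S \<Longrightarrow> smooth_on S f \<Longrightarrow> (\<And>x. x \<in> S \<Longrightarrow> f x \<noteq> 0) \<Longrightarrow> smooth_on S (\<lambda>x. inverse (f x))"
  by (simp add: smooth_on_def Ck_on_inverse)

lemma smooth_on_compose:
  fixes f :: "'a::euclidean_space \<Rightarrow> 'b::euclidean_space"
  shows "open S \<Longrightarrow> open T \<Longrightarrow> f ` S \<subseteq> T \<Longrightarrow> smooth_on S f \<Longrightarrow> smooth_on T g \<Longrightarrow> smooth_on S (\<lambda>x. g (f x))"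
  unfolding smooth_on_def by (blast intro: Ck_on_compose)

lemma smooth_on_Pair:
  assumes "open S" "smooth_on S f" "smooth_on S g"
  shows "smooth_on S (\<lambda>x. (f x, g x))"
proof -
  have "smooth_on S (\<lambda>x. (f x, 0) + (0, g x))"
    by (intro smooth_on_add assms smooth_on_linear_comp[OF assms(1), of "\<lambda>a. (a, 0)"]
       smooth_on_linear_comp[OF assms(1), of "\<lambda>a. (0, a)"]) (auto intro!: bounded_linear_Pair bounded_linear_ident bounded_linear_zero)
  then show ?thesis by simp
qed

lemma smooth_on_componentwise:
  fixes f :: "'a::euclidean_space \<Rightarrow> 'b::euclidean_space"
  assumes "open S" "\<And>b. b \<in> Basis \<Longrightarrow> smooth_on S (\<lambda>x. f x \<bullet> b)"
  shows "smooth_on S f"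
proof -
  have "smooth_on S (\<lambda>x. \<Sum>b\<in>Basis. (f x \<bullet> b) *\<^sub>R b)"
    by (intro smooth_on_sum smooth_on_scaleR smooth_on_const assms)
  then show ?thesis by (simp add: euclidean_representation)
qed

lemma smooth_on_continuous: "smooth_on S f \<Longrightarrow> open S \<Longrightarrow> continuous_on S f"
  using Ck_on_continuous smooth_onD by blast

lemma smooth_on_has_derivative:
  assumes "smooth_on S f" "open S" "x \<in> S"
  shows "(f has_derivative frechet_derivative f (at x)) (at x)"
proof -
  have "Ck_on (Suc 0) S f" using assms(1) by (rule smooth_onD)
  then show ?thesis using assms(2,3)
    by (simp add: differentiable_on_eq_differentiable_at frechet_derivative_works)
qed

lemma smooth_on_frechet:
  assumes "smooth_on S f" "open S"
  shows "smooth_on S (\<lambda>x. frechet_derivative f (at x) v)"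
  unfolding smooth_on_def
proof
  fix k
  have "Ck_on (Suc k) S f" using assms(1) by (rule smooth_onD)
  then show "Ck_on k S (\<lambda>x. frechet_derivative f (at x) v)" by simp
qed

section \<open>Bump functions\<close>

definition flat :: "nat \<Rightarrow> real \<Rightarrow> real" where
  "flat m t = (if t > 0 then exp (- (1/t)) / t ^ m else 0)"

lemma flat_tendsto_0: "(flat m \<longlongrightarrow> 0) (at 0)"
proof (rule filterlim_split_at)
  show "(flat m \<longlongrightarrow> 0) (at_left 0)"
    by (rule tendsto_eventually) (auto simp: flat_def eventually_at_left_field intro: exI[of _ "-1"])
  have "((\<lambda>t. inverse t ^ m / exp (inverse t)) \<longlongrightarrow> 0) (at_right (0::real))"
    by (rule filterlim_compose[OF tendsto_power_div_exp_0 filterlim_inverse_at_top_right])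
  moreover have "eventually (\<lambda>t. inverse t ^ m / exp (inverse t) = flat m t) (at_right 0)"
    unfolding eventually_at_right_field
    by (intro exI[of _ 1]) (auto simp: flat_def exp_minus field_simps)
  ultimately show "(flat m \<longlongrightarrow> 0) (at_right 0)"
    by (rule Lim_transform_eventually)
qed

lemma flat_has_derivative:
  "(flat m has_real_derivative (flat (m + 2) t - m * flat (m + 1) t)) (at t)"
proof -
  consider "t > 0" | "t < 0" | "t = 0" by linarith
  then show ?thesis
  proof cases
    case 1
    have "((\<lambda>t. exp (- (1/t)) / t ^ m) has_real_derivative (flat (m + 2) t - m * flat (m + 1) t)) (at t)"
      using 1 apply (auto intro!: derivative_eq_intros simp: flat_def)
      apply (cases m)
      apply (auto simp: field_simps power2_eq_square)
      done
    then show ?thesis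
      by (rule has_field_derivative_transform_within_open[of _ _ _ "{0<..}"]) (use 1 in \<open>auto simp: flat_def\<close>)
  next
    case 2
    have "((\<lambda>t. 0) has_real_derivative (flat (m + 2) t - m * flat (m + 1) t)) (at t)"
      using 2 by (auto simp: flat_def)
    then show ?thesis
      by (rule has_field_derivative_transform_within_open[of _ _ _ "{..<0}"]) (use 2 in \<open>auto simp: flat_def\<close>)
  next
    case 3
    \<comment> \<open>At 0 the difference quotient of \<open>flat m\<close> is
      \<open>flat (m+1)\<close>, whose limit is already known.\<close>
    have "((\<lambda>h. (flat m (0 + h) - flat m 0) / h) \<longlongrightarrow> 0) (at 0)"
      by (rule Lim_transform_eventually[OF flat_tendsto_0[of "m+1"]])
        (auto simp: flat_def eventually_at_filter)
    then show ?thesis using 3 by (simp add: DERIV_def flat_def)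
  qed
qed

lemma smooth_flat: "smooth_on UNIV (flat m)"
  unfolding smooth_on_def
proof
  fix k show "Ck_on k UNIV (flat m)"
  proof (induction k arbitrary: m)
    case 0
    show ?case using DERIV_isCont[OF flat_has_derivative] by (auto simp: continuous_on_eq_continuous_at)
  next
    case (Suc k)
    show ?case
    proof (rule Ck_on_SucI[OF open_UNIV, where f' = "\<lambda>t v. v * (flat (m + 2) t - m * flat (m + 1) t)"])
      show "(flat m has_derivative (\<lambda>v. v * (flat (m + 2) t - m * flat (m + 1) t))) (at t)" for t
        using flat_has_derivative[of m t] by (simp add: has_field_derivative_def mult_commute_abs)
      fix v :: real
      have "Ck_on k UNIV (\<lambda>t. v *\<^sub>R (flat (m + 2) t + (- real m) *\<^sub>R flat (m + 1) t))"
        by (intro Ck_on_scaleR Ck_on_add Ck_on_const Suc open_UNIV)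
      then show "Ck_on k UNIV (\<lambda>t. v * (flat (m + 2) t - m * flat (m + 1) t))" by simp
    qed
  qed
qed

text \<open>The usual transition from 0 to 1; the denominator is positive because t and 1 - t are
  never both nonpositive.\<close>

definition smooth_step :: "real \<Rightarrow> real" where
  "smooth_step t = flat 0 t * inverse (flat 0 t + flat 0 (1 - t))"

lemma smooth_step:
  shows "smooth_on UNIV smooth_step" "0 \<le> smooth_step t" "smooth_step t \<le> 1"
    and "t \<le> 0 \<Longrightarrow> smooth_step t = 0" "t \<ge> 1 \<Longrightarrow> smooth_step t = 1"
proof -
  have pos: "flat 0 t + flat 0 (1 - t) > 0" for t
    by (cases "t > 0") (simp_all add: flat_def add_pos_nonneg)
  have "smooth_on UNIV (\<lambda>t. flat 0 (1 - t))"
    by (rule smooth_on_compose[OF open_UNIV open_UNIV _ _ smooth_flat])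
      (auto intro!: smooth_on_diff smooth_on_const smooth_on_ident)
  then show "smooth_on UNIV smooth_step"
    unfolding smooth_step_def[abs_def]
    by (intro smooth_on_mult smooth_on_inverse smooth_on_add smooth_flat open_UNIV)
      (use pos in \<open>auto simp: less_imp_neq[symmetric]\<close>)
  have "0 \<le> flat 0 t" "0 \<le> flat 0 (1 - t)" by (auto simp: flat_def)
  then show "0 \<le> smooth_step t" "smooth_step t \<le> 1"
    using pos[of t] by (auto simp: smooth_step_def field_simps)
  show "t \<le> 0 \<Longrightarrow> smooth_step t = 0" by (simp add: smooth_step_def flat_def)
  show "t \<ge> 1 \<Longrightarrow> smooth_step t = 1" by (simp add: smooth_step_def flat_def)
qed

lemma bump_euclidean:
  fixes a :: "'a::euclidean_space"
  assumes "r > 0"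
  obtains \<beta> :: "'a \<Rightarrow> real" where "smooth_on UNIV \<beta>" "\<And>y. 0 \<le> \<beta> y" "\<And>y. \<beta> y \<le> 1"
    "\<And>y. dist a y < r / 2 \<Longrightarrow> \<beta> y = 1" "\<And>y. dist a y \<ge> r \<Longrightarrow> \<beta> y = 0"
proof
  \<comment> \<open>The factor 2 makes this quadratic at least 1 on the ball of radius r/2, while it
    is nonpositive at distance r and beyond.\<close>
  let ?q = "\<lambda>y. 2 / r\<^sup>2 * (r\<^sup>2 - (y - a) \<bullet> (y - a))"
  define \<beta> where "\<beta> = (\<lambda>y. smooth_step (?q y))"
  have "smooth_on UNIV (\<lambda>y. \<Sum>b\<in>Basis. ((y - a) \<bullet> b) * ((y - a) \<bullet> b))"
    by (intro smooth_on_sum smooth_on_mult smooth_on_linear_comp[OF _ bounded_linear_inner_left]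
       smooth_on_diff smooth_on_const smooth_on_ident open_UNIV)
  then have "smooth_on UNIV (\<lambda>y. (y - a) \<bullet> (y - a))"
    by (simp add: euclidean_inner[symmetric])
  then have "smooth_on UNIV ?q"
    by (intro smooth_on_mult smooth_on_diff smooth_on_const open_UNIV)
  then show "smooth_on UNIV \<beta>" unfolding \<beta>_def
    by (intro smooth_on_compose[OF open_UNIV open_UNIV _ _ smooth_step(1)]) auto
  show "0 \<le> \<beta> y" "\<beta> y \<le> 1" for y using smooth_step(2,3) by (auto simp: \<beta>_def)
  have n: "(y - a) \<bullet> (y - a) = (dist a y)\<^sup>2" for y
    by (metis dist_norm norm_minus_commute power2_norm_eq_inner)
  show "\<beta> y = 1" if "dist a y < r / 2" for y
  proof -
    have "(dist a y)\<^sup>2 \<le> (r/2)\<^sup>2" using that by (intro power_mono) auto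
    then have "4 * (dist a y)\<^sup>2 \<le> r\<^sup>2" by (simp add: power_divide)
    with zero_le_power2[of "dist a y"] have "2 * (dist a y)\<^sup>2 \<le> r\<^sup>2" by linarith
    then have "?q y \<ge> 1" using assms unfolding n by (simp add: field_simps)
    then show ?thesis by (simp add: \<beta>_def smooth_step(5))
  qed
  show "\<beta> y = 0" if "dist a y \<ge> r" for y
  proof -
    have "r\<^sup>2 \<le> (dist a y)\<^sup>2" using that assms by (intro power_mono) auto
    then have "?q y \<le> 0" using assms unfolding n by (simp add: mult_nonneg_nonpos divide_nonpos_pos)
    then show ?thesis by (simp add: \<beta>_def smooth_step(4))
  qed
qed

lemma smooth_on_line_derivative:
  fixes f :: "'a::euclidean_space \<Rightarrow> real"
  assumes "smooth_on S f" "open S" "x + t *\<^sub>R v \<in> S"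
  shows "((\<lambda>t. f (x + t *\<^sub>R v)) has_real_derivative frechet_derivative f (at (x + t *\<^sub>R v)) v) (at t)"
proof -
  have "((\<lambda>t. x + t *\<^sub>R v) has_derivative (\<lambda>t. t *\<^sub>R v)) (at t)"
    by (auto intro!: derivative_eq_intros)
  from has_derivative_compose[OF this smooth_on_has_derivative[OF assms]]
  have d: "((\<lambda>t. f (x + t *\<^sub>R v)) has_derivative (\<lambda>s. frechet_derivative f (at (x + t *\<^sub>R v)) (s *\<^sub>R v))) (at t)" .
  have "linear (frechet_derivative f (at (x + t *\<^sub>R v)))"
    using smooth_on_has_derivative[OF assms] has_derivative_linear by blast
  then show ?thesis using d by (simp add: has_field_derivative_def linear_cmul mult_commute_abs)
qed

text \<open>Needed for one of the two terms of a Lie bracket: \<open>adj_flow_derivative\<close>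
  exchanges differentiation along a flow with differentiation in a coordinate direction.\<close>

lemma mixed_derivatives_commute:
  fixes f :: "'a::euclidean_space \<Rightarrow> real"
  assumes f: "smooth_on S f" and "open S" "x \<in> S"
  shows "frechet_derivative (\<lambda>y. frechet_derivative f (at y) v) (at x) w =
    frechet_derivative (\<lambda>y. frechet_derivative f (at y) w) (at x) v"
proof -
  let ?D = "\<lambda>v w y. frechet_derivative (\<lambda>y. frechet_derivative f (at y) v) (at y) w"
  obtain r where r: "r > 0" "ball x r \<subseteq> S" using assms(2,3) by (auto simp: open_contains_ball)
  \<comment> \<open>Moving by at most d along v and along w stays within d * c; the summand 1 makes
    the bound strict, also for v = w = 0.\<close>
  define c where "c = norm v + norm w + 1"
  have c: "c > 0" by (simp add: c_def add_nonneg_pos)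
  text \<open>Second differences along \<open>v\<close> and \<open>w\<close>: the mean value theorem applied in either order.\<close>
  have key: "\<exists>y\<in>ball x (d * c). f (x + d *\<^sub>R v + d *\<^sub>R w) - f (x + d *\<^sub>R v) - f (x + d *\<^sub>R w) + f x = d * d * ?D v w y"
    if d: "0 < d" "d * c < r" "c = norm v + norm w + 1" for d v w
  proof -
    have cb: "x + s *\<^sub>R v + t *\<^sub>R w \<in> ball x (d * c)" if "0 \<le> s" "s \<le> d" "0 \<le> t" "t \<le> d" for s t
    proof -
      have "norm (s *\<^sub>R v + t *\<^sub>R w) \<le> s * norm v + t * norm w"
        using norm_triangle_ineq[of "s *\<^sub>R v" "t *\<^sub>R w"] that by simp
      also have "\<dots> \<le> d * norm v + d * norm w" using that by (intro add_mono mult_right_mono) auto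
      also have "\<dots> < d * c" using d by (simp add: algebra_simps)
      finally have "norm (s *\<^sub>R v + t *\<^sub>R w) < d * c" .
      moreover have "dist x (x + z) = norm z" for z by (simp add: dist_norm)
      ultimately show ?thesis by (simp add: add.assoc)
    qed
    have inS: "x + s *\<^sub>R v + t *\<^sub>R w \<in> S" if "0 \<le> s" "s \<le> d" "0 \<le> t" "t \<le> d" for s t
      using cb[OF that] d(2) r(2) by auto
    have "((\<lambda>s. f ((x + d *\<^sub>R w) + s *\<^sub>R v) - f (x + s *\<^sub>R v)) has_real_derivative
      (frechet_derivative f (at ((x + d *\<^sub>R w) + s *\<^sub>R v)) v - frechet_derivative f (at (x + s *\<^sub>R v)) v)) (at s)"
      if "0 \<le> s" "s \<le> d" for s
      by (intro DERIV_diff smooth_on_line_derivative[OF f \<open>open S\<close>])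
        (use inS[of s d] inS[of s 0] that d(1) in \<open>auto simp: algebra_simps\<close>)
    from MVT2[OF d(1) this] obtain s where s: "0 < s" "s < d"
      and e1: "f ((x + d *\<^sub>R w) + d *\<^sub>R v) - f (x + d *\<^sub>R v) - (f ((x + d *\<^sub>R w) + 0 *\<^sub>R v) - f (x + 0 *\<^sub>R v))
       = (d - 0) * (frechet_derivative f (at ((x + d *\<^sub>R w) + s *\<^sub>R v)) v - frechet_derivative f (at (x + s *\<^sub>R v)) v)"
      by blast
    have "((\<lambda>t. frechet_derivative f (at ((x + s *\<^sub>R v) + t *\<^sub>R w)) v) has_real_derivative
      ?D v w ((x + s *\<^sub>R v) + t *\<^sub>R w)) (at t)" if "0 \<le> t" "t \<le> d" for t
      by (rule smooth_on_line_derivative[OF smooth_on_frechet[OF f \<open>open S\<close>] \<open>open S\<close>])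
        (use inS[of s t] that s in auto)
    from MVT2[OF d(1) this] obtain t where t: "0 < t" "t < d"
      and e2: "frechet_derivative f (at ((x + s *\<^sub>R v) + d *\<^sub>R w)) v - frechet_derivative f (at ((x + s *\<^sub>R v) + 0 *\<^sub>R w)) v =
        (d - 0) * ?D v w ((x + s *\<^sub>R v) + t *\<^sub>R w)" by blast
    have "f (x + d *\<^sub>R v + d *\<^sub>R w) - f (x + d *\<^sub>R v) - f (x + d *\<^sub>R w) + f x = d * d * ?D v w (x + s *\<^sub>R v + t *\<^sub>R w)"
      using e1 e2 by (simp add: algebra_simps)
    then show ?thesis using cb[of s t] s t by auto
  qed
  have cont: "continuous_on S (?D v w)" for v w
    by (intro smooth_on_continuous[OF _ \<open>open S\<close>] smooth_on_frechet f \<open>open S\<close>)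
  have "\<bar>?D v w x - ?D w v x\<bar> \<le> e" if "e > 0" for e
  proof -
    have "continuous (at x) (?D v w)" "continuous (at x) (?D w v)"
      using cont \<open>open S\<close> \<open>x \<in> S\<close> by (auto simp: continuous_on_eq_continuous_at)
    moreover have "e/2 > 0" using that by simp
    ultimately obtain d1 d2 where d12: "d1 > 0" "d2 > 0" "\<And>y. dist y x < d1 \<Longrightarrow> dist (?D v w y) (?D v w x) < e/2"
      "\<And>y. dist y x < d2 \<Longrightarrow> dist (?D w v y) (?D w v x) < e/2"
      unfolding continuous_at_eps_delta by metis
    define d where "d = Min {d1, d2, r} / (2 * c)"
    have m: "Min {d1, d2, r} > 0" using d12 r by simp
    have d: "d > 0" "d * c < Min {d1, d2, r}" using m c by (auto simp: d_def field_simps)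
    then have d': "d * c < r" "d * c < d1" "d * c < d2" by auto
    obtain y where y: "y \<in> ball x (d * c)" "f (x + d *\<^sub>R v + d *\<^sub>R w) - f (x + d *\<^sub>R v) - f (x + d *\<^sub>R w) + f x = d * d * ?D v w y"
      using key[OF d(1) d'(1) c_def] by blast
    have c2: "c = norm w + norm v + 1" by (simp add: c_def)
    obtain z where z: "z \<in> ball x (d * c)" "f (x + d *\<^sub>R w + d *\<^sub>R v) - f (x + d *\<^sub>R w) - f (x + d *\<^sub>R v) + f x = d * d * ?D w v z"
      using key[OF d(1) d'(1) c2] by blast
    have "d * d * ?D v w y = d * d * ?D w v z" using y(2) z(2) by (simp add: algebra_simps)
    then have "?D v w y = ?D w v z" using d(1) by simp
    moreover have "\<bar>?D v w y - ?D v w x\<bar> < e/2" "\<bar>?D w v z - ?D w v x\<bar> < e/2"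
      using d12(3)[of y] d12(4)[of z] y(1) z(1) d' by (auto simp: dist_real_def dist_commute)
    ultimately show ?thesis by linarith
  qed
  then show ?thesis by (metis abs_le_zero_iff eq_iff_diff_eq_0 field_le_epsilon add.left_neutral abs_ge_zero)
qed

text \<open>Differentiation under the integral replaces F by a partial derivative and raises the
  power of t by one, so the weight t^m has to be part of the induction.\<close>

lemma Ck_on_radial_average:
  fixes F :: "'a::euclidean_space \<Rightarrow> real"
  assumes "Ck_on k (ball e r) F"
  shows "Ck_on k (ball e r) (\<lambda>y. integral {0..1} (\<lambda>t. t ^ m * F (e + t *\<^sub>R (y - e))))"
  using assms
proof (induction k arbitrary: F m)
  have seg: "e + t *\<^sub>R (y - e) \<in> ball e r" if "y \<in> ball e r" "t \<in> {0..1}" for y :: 'a and t :: real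
  proof -
    have "norm (t *\<^sub>R (y - e)) \<le> 1 * norm (y - e)" using that(2) by (simp add: mult_right_mono mult_left_le_one_le)
    then show ?thesis using that(1) by (simp add: dist_norm norm_minus_commute)
  qed
  have cts: "continuous_on (ball e r \<times> {0..1}) (\<lambda>(y, t). t ^ m * F (e + t *\<^sub>R (y - e)))"
    if "continuous_on (ball e r) F" for F :: "'a \<Rightarrow> real" and m
    unfolding case_prod_unfold
    by (intro continuous_intros continuous_on_compose2[OF that]) (use seg in fastforce)
  have cts2: "continuous_on {0..1} (\<lambda>t. t ^ m * F (e + t *\<^sub>R (y - e)))"
    if "continuous_on (ball e r) F" "y \<in> ball e r" for F :: "'a \<Rightarrow> real" and m y
    by (intro continuous_intros continuous_on_compose2[OF that(1)]) (use seg[OF that(2)] in fastforce)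
  case 0
  then have "continuous_on (ball e r) F" by simp
  from integral_continuous_on_param[of "ball e r" 0 1 "\<lambda>y t. t ^ m * F (e + t *\<^sub>R (y - e))"] cts[OF this, of m]
  show ?case by simp
next
  have seg: "e + t *\<^sub>R (y - e) \<in> ball e r" if "y \<in> ball e r" "t \<in> {0..1}" for y :: 'a and t :: real
  proof -
    have "norm (t *\<^sub>R (y - e)) \<le> 1 * norm (y - e)" using that(2) by (simp add: mult_right_mono mult_left_le_one_le)
    then show ?thesis using that(1) by (simp add: dist_norm norm_minus_commute)
  qed
  case (Suc k)
  note contF = Ck_on_continuous[OF Suc.prems open_ball]
  from Suc.prems obtain F' where F': "\<And>x. x \<in> ball e r \<Longrightarrow> (F has_derivative F' x) (at x)"
    "\<And>v. Ck_on k (ball e r) (\<lambda>x. F' x v)" by (rule Ck_on_SucE) auto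
  note contF' = Ck_on_continuous[OF F'(2) open_ball]
  define c where "c = (\<lambda>b y t. t ^ Suc m * F' (e + t *\<^sub>R (y - e)) b)"
  \<comment> \<open>The derivative is assembled from partial derivatives as a bounded linear map,
    the form in which \<open>leibniz_rule\<close> expects it.\<close>
  define fx where "fx = (\<lambda>y t. \<Sum>b\<in>Basis. c b y t *\<^sub>R blinfun_inner_left b)"
  have lin: "F' x v = (\<Sum>b\<in>Basis. (v \<bullet> b) * F' x b)" if "x \<in> ball e r" for x v
  proof -
    have "linear (F' x)" using F'(1)[OF that] has_derivative_linear by blast
    then have "F' x (\<Sum>b\<in>Basis. (v \<bullet> b) *\<^sub>R b) = (\<Sum>b\<in>Basis. (v \<bullet> b) *\<^sub>R F' x b)"
      by (simp add: linear_sum linear_cmul)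
    then show ?thesis by (simp add: euclidean_representation)
  qed
  have contc: "continuous_on (ball e r \<times> {0..1}) (\<lambda>(y, t). c b y t)" for b
    unfolding case_prod_unfold c_def
    by (intro continuous_intros continuous_on_compose2[OF contF']) (use seg in fastforce)
  have contc1: "continuous_on {0..1} (c b y)" if "y \<in> ball e r" for b y
    unfolding c_def
    by (intro continuous_intros continuous_on_compose2[OF contF']) (use seg[OF that] in fastforce)
  have der: "((\<lambda>y. integral (cbox 0 1) (\<lambda>t. t ^ m * F (e + t *\<^sub>R (y - e)))) has_derivative
     integral (cbox 0 1) (fx y)) (at y within ball e r)" if y: "y \<in> ball e r" for y
  proof (rule leibniz_rule[OF _ _ _ y convex_ball])
    fix y t :: "_" assume yt: "y \<in> ball e r" "t \<in> cbox 0 (1::real)"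
    have "((\<lambda>y. e + t *\<^sub>R (y - e)) has_derivative (\<lambda>v. t *\<^sub>R v)) (at y)"
      by (auto intro!: derivative_eq_intros)
    from has_derivative_compose[OF this F'(1)] seg yt
    have "((\<lambda>y. F (e + t *\<^sub>R (y - e))) has_derivative (\<lambda>v. F' (e + t *\<^sub>R (y - e)) (t *\<^sub>R v))) (at y)" by auto
    from has_derivative_mult_right[OF this, of "t ^ m"]
    have "((\<lambda>y. t ^ m * F (e + t *\<^sub>R (y - e))) has_derivative (\<lambda>v. t ^ m * F' (e + t *\<^sub>R (y - e)) (t *\<^sub>R v))) (at y)" .
    moreover have "(\<lambda>v. t ^ m * F' (e + t *\<^sub>R (y - e)) (t *\<^sub>R v)) = blinfun_apply (fx y t)"
    proof
      fix v
      have "e + t *\<^sub>R (y - e) \<in> ball e r" using seg yt by auto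
      from lin[OF this, of "t *\<^sub>R v"] show "t ^ m * F' (e + t *\<^sub>R (y - e)) (t *\<^sub>R v) = blinfun_apply (fx y t) v"
        by (simp add: fx_def c_def blinfun.sum_left blinfun.scaleR_left sum_distrib_left sum_distrib_right algebra_simps)
    qed
    ultimately show "((\<lambda>y. t ^ m * F (e + t *\<^sub>R (y - e))) has_derivative blinfun_apply (fx y t)) (at y within ball e r)"
      by (simp add: has_derivative_at_withinI)
  next
    fix y assume "y \<in> ball e r"
    then show "(\<lambda>t. t ^ m * F (e + t *\<^sub>R (y - e))) integrable_on cbox 0 1"
      by (intro integrable_continuous continuous_intros continuous_on_compose2[OF contF]) (use seg in fastforce)
  next
    show "continuous_on (ball e r \<times> cbox 0 1) (\<lambda>(y, t). fx y t)"
      using contc unfolding fx_def case_prod_unfold by (auto intro!: continuous_intros)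
  qed
  have eqi: "blinfun_apply (integral (cbox 0 1) (fx y)) v = (\<Sum>b\<in>Basis. (v \<bullet> b) *\<^sub>R integral {0..1} (c b y))"
    if "y \<in> ball e r" for y v
  proof -
    have i: "c b y integrable_on {0..1}" for b
      using contc1[OF that] by (rule integrable_continuous_real)
    have i2: "(\<lambda>t. c b y t *\<^sub>R blinfun_inner_left b) integrable_on {0..1}" for b
      using i[of b] by (rule integrable_on_scaleR_left)
    have "integral (cbox 0 1) (fx y) = (\<Sum>b\<in>Basis. integral {0..1} (\<lambda>t. c b y t *\<^sub>R blinfun_inner_left b))"
      unfolding fx_def using i2 by (simp add: integral_sum)
    also have "\<dots> = (\<Sum>b\<in>Basis. integral {0..1} (c b y) *\<^sub>R blinfun_inner_left b)"
      using i by (intro sum.cong refl integral_unique has_integral_scaleR_left integrable_integral)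
    finally show ?thesis
      by (simp add: blinfun.sum_left blinfun.scaleR_left mult.commute)
  qed
  show ?case
  proof (rule Ck_on_SucI[where f' = "\<lambda>y. blinfun_apply (integral (cbox 0 1) (fx y))"])
    show "((\<lambda>y. integral {0..1} (\<lambda>t. t ^ m * F (e + t *\<^sub>R (y - e)))) has_derivative
      blinfun_apply (integral (cbox 0 1) (fx y))) (at y)" if "y \<in> ball e r" for y
      using der[OF that] at_within_open[OF that open_ball] by simp
    fix v
    have "Ck_on k (ball e r) (\<lambda>y. \<Sum>b\<in>Basis. (v \<bullet> b) *\<^sub>R integral {0..1} (c b y))"
      unfolding c_def by (intro Ck_on_sum Ck_on_scaleR Ck_on_const open_ball Suc.IH F'(2))
    then show "Ck_on k (ball e r) (\<lambda>y. blinfun_apply (integral (cbox 0 1) (fx y)) v)"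
      by (rule Ck_on_cong[OF open_ball]) (simp only: eqi real_scaleR_def)
  qed simp
qed

text \<open>Integrate the derivative along the segment from e to y and expand y - e in
  \<open>Basis\<close>: the coefficients are radial averages of partial derivatives, hence smooth,
  and at e they are the partial derivatives themselves.\<close>

lemma hadamard:
  fixes f :: "'a::euclidean_space \<Rightarrow> real"
  assumes f: "smooth_on (ball e r) f" and r: "r > 0"
  obtains g where "\<And>b. smooth_on (ball e r) (g b)"
    "\<And>y. y \<in> ball e r \<Longrightarrow> f y = f e + (\<Sum>b\<in>Basis. ((y - e) \<bullet> b) * g b y)"
    "\<And>b. g b e = frechet_derivative f (at e) b"
proof
  define g where "g = (\<lambda>b y. integral {0..1} (\<lambda>t::real. t ^ 0 * frechet_derivative f (at (e + t *\<^sub>R (y - e))) b))"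
  note sm = smooth_on_frechet[OF f open_ball]
  show "smooth_on (ball e r) (g b)" for b
    unfolding smooth_on_def g_def using Ck_on_radial_average sm smooth_onD by blast
  show "g b e = frechet_derivative f (at e) b" for b by (simp add: g_def)
  fix y assume y: "y \<in> ball e r"
  have seg: "e + t *\<^sub>R (y - e) \<in> ball e r" if "t \<in> {0..1}" for t :: real
  proof -
    have "norm (t *\<^sub>R (y - e)) \<le> 1 * norm (y - e)" using that by (simp add: mult_right_mono mult_left_le_one_le)
    then show ?thesis using y by (simp add: dist_norm norm_minus_commute)
  qed
  have lin: "frechet_derivative f (at (e + t *\<^sub>R (y - e))) (y - e)
     = (\<Sum>b\<in>Basis. ((y - e) \<bullet> b) * frechet_derivative f (at (e + t *\<^sub>R (y - e))) b)" if "t \<in> {0..1}" for t :: real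
  proof -
    have "linear (frechet_derivative f (at (e + t *\<^sub>R (y - e))))"
      using smooth_on_has_derivative[OF f open_ball seg[OF that]] has_derivative_linear by blast
    then have "frechet_derivative f (at (e + t *\<^sub>R (y - e))) (\<Sum>b\<in>Basis. ((y - e) \<bullet> b) *\<^sub>R b) =
       (\<Sum>b\<in>Basis. ((y - e) \<bullet> b) * frechet_derivative f (at (e + t *\<^sub>R (y - e))) b)"
      by (simp add: linear_sum linear_cmul)
    then show ?thesis by (simp add: euclidean_representation)
  qed
  have int: "(\<lambda>t. frechet_derivative f (at (e + t *\<^sub>R (y - e))) b) integrable_on {0..1::real}" for b
    by (intro integrable_continuous_real continuous_on_compose2[OF smooth_on_continuous[OF sm open_ball]] continuous_intros)
      (use seg in auto)
  have "((\<lambda>t. frechet_derivative f (at (e + t *\<^sub>R (y - e))) (y - e)) has_integral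
     f (e + 1 *\<^sub>R (y - e)) - f (e + 0 *\<^sub>R (y - e))) {0..1}"
    by (rule fundamental_theorem_of_calculus)
      (auto intro!: has_field_derivative_at_within smooth_on_line_derivative[OF f open_ball] seg
        simp: has_real_derivative_iff_has_vector_derivative[symmetric] simp del: mem_ball)
  then have "f y - f e = integral {0..1} (\<lambda>t. frechet_derivative f (at (e + t *\<^sub>R (y - e))) (y - e))"
    by (simp add: integral_unique)
  also have "\<dots> = integral {0..1} (\<lambda>t. \<Sum>b\<in>Basis. ((y - e) \<bullet> b) * frechet_derivative f (at (e + t *\<^sub>R (y - e))) b)"
    by (rule integral_cong) (rule lin)
  also have "\<dots> = (\<Sum>b\<in>Basis. ((y - e) \<bullet> b) * g b y)"
    using int by (simp add: integral_sum integrable_on_mult_right g_def)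
  finally show "f y = f e + (\<Sum>b\<in>Basis. ((y - e) \<bullet> b) * g b y)" by simp
qed

section \<open>Local existence for ordinary differential equations\<close>

lemma Ck_on_Lipschitz_cball:
  fixes F :: "'a::euclidean_space \<Rightarrow> 'b::euclidean_space"
  assumes F: "Ck_on 1 Q F" and Q: "open Q" "cball e r \<subseteq> Q"
  obtains L where "L \<ge> 0" "\<And>x y. x \<in> cball e r \<Longrightarrow> y \<in> cball e r \<Longrightarrow> norm (F x - F y) \<le> L * norm (x - y)"
proof -
  obtain F' where F': "\<And>x. x \<in> Q \<Longrightarrow> (F has_derivative F' x) (at x)" "\<And>v. Ck_on 0 Q (\<lambda>x. F' x v)"
    using F Q(1) by (auto elim!: Ck_on_SucE simp only: One_nat_def)
  have "continuous_on (cball e r) (\<lambda>x. \<Sum>b\<in>Basis. norm (F' x b))"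
    using F'(2) Q(2) by (auto intro!: continuous_intros intro: continuous_on_subset)
  then have "compact ((\<lambda>x. \<Sum>b\<in>Basis. norm (F' x b)) ` cball e r)"
    by (rule compact_continuous_image) simp
  then obtain B where B: "\<And>x. x \<in> cball e r \<Longrightarrow> norm (\<Sum>b\<in>Basis. norm (F' x b)) \<le> B"
    by (meson bounded_iff compact_imp_bounded imageI)
  have "norm (F x - F y) \<le> max B 0 * norm (x - y)" if "x \<in> cball e r" "y \<in> cball e r" for x y
  proof (rule differentiable_bound[of "cball e r" F F'])
    fix z assume z: "z \<in> cball e r"
    then have d: "(F has_derivative F' z) (at z)" using F'(1) Q(2) by blast
    then show "(F has_derivative F' z) (at z within cball e r)" by (rule has_derivative_at_withinI)
    have "onorm (F' z) \<le> (\<Sum>b\<in>Basis. norm (F' z b))"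
      using d has_derivative_bounded_linear by (intro onorm_componentwise) blast
    then show "onorm (F' z) \<le> max B 0" using B[OF z] by simp
  qed (use that in auto)
  then show ?thesis using that[of "max B 0"] by simp
qed

text \<open>Composing F with the nearest-point projection onto a closed ball makes it globally
  bounded and Lipschitz, so the Picard operator contracts the whole space of bounded continuous
  functions. The fixed point stays in the ball, where the projection does nothing.\<close>

lemma picard_local_solution:
  fixes F :: "'a::euclidean_space \<Rightarrow> 'a"
  assumes F: "Ck_on 1 Q F" and Q: "open Q" "e \<in> Q"
  obtains \<epsilon> y where "\<epsilon> > 0" "y 0 = e"
    "\<And>t. \<bar>t\<bar> < \<epsilon> \<Longrightarrow> y t \<in> Q \<and> (y has_vector_derivative F (y t)) (at t)"
proof -
  obtain r where r: "r > 0" "cball e r \<subseteq> Q" using Q by (auto simp: open_contains_cball)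
  obtain L where L: "L \<ge> 0" "\<And>x y. x \<in> cball e r \<Longrightarrow> y \<in> cball e r \<Longrightarrow> norm (F x - F y) \<le> L * norm (x - y)"
    using Ck_on_Lipschitz_cball[OF F Q(1) r(2)] by blast
  have cF: "continuous_on (cball e r) F"
    using Ck_on_continuous[OF F Q(1)] r(2) by (rule continuous_on_subset)
  then have "compact (F ` cball e r)" by (rule compact_continuous_image) simp
  then obtain M0 where M0: "\<And>x. x \<in> cball e r \<Longrightarrow> norm (F x) \<le> M0"
    by (meson bounded_iff compact_imp_bounded imageI)
  define M where "M = max M0 1"
  define p where "p = closest_point (cball e r)"
  define K where "K = (\<lambda>x. F (p x))"
  have pin: "p x \<in> cball e r" for x unfolding p_def using r(1) by (intro closest_point_in_set) auto
  have K: "norm (K x) \<le> M" "norm (K x - K y) \<le> L * norm (x - y)" for x y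
  proof -
    show "norm (K x) \<le> M" using M0[OF pin] by (simp add: K_def M_def le_max_iff_disj)
    have "norm (p x - p y) \<le> norm (x - y)"
      using closest_point_lipschitz[of "cball e r" x y] r(1) by (auto simp: p_def dist_norm)
    then show "norm (K x - K y) \<le> L * norm (x - y)"
      using L(2)[OF pin pin, of x y] L(1) unfolding K_def by (meson mult_left_mono order_trans)
  qed
  have contK: "continuous_on UNIV K"
    unfolding K_def p_def using r(1) cF pin
    by (intro continuous_on_compose2[OF cF] continuous_on_closest_point) (auto simp: p_def)
  \<comment> \<open>The integrals below cover a total time of at most 3\<epsilon>: the first bound
    then gives the contraction factor 3/4, the second keeps the solution within distance r of
    e.\<close>
  define \<epsilon> where "\<epsilon> = min (1 / (4 * (L + 1))) (r / (4 * M))"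
  have M1: "M \<ge> 1" by (simp add: M_def)
  have eps: "\<epsilon> > 0" using L(1) r(1) M1 by (simp add: \<epsilon>_def)
  have eL: "3 * \<epsilon> * L \<le> 3/4"
  proof -
    have "\<epsilon> \<le> 1 / (4 * (L + 1))" by (simp add: \<epsilon>_def)
    then have "\<epsilon> * (4 * (L + 1)) \<le> 1 / (4 * (L + 1)) * (4 * (L + 1))"
      by (rule mult_right_mono) (use L(1) in auto)
    also have "\<dots> = 1" using L(1) by simp
    finally have "\<epsilon> * (4 * (L + 1)) \<le> 1" .
    then show ?thesis using eps by (simp add: algebra_simps)
  qed
  have eM: "\<epsilon> * M \<le> r / 4"
  proof -
    have "\<epsilon> \<le> r / (4 * M)" by (simp add: \<epsilon>_def)
    then have "\<epsilon> * M \<le> r / (4 * M) * M" by (rule mult_right_mono) (use M1 in auto)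
    also have "\<dots> = r / 4" using M1 by simp
    finally show ?thesis .
  qed
  \<comment> \<open>Clamping the time lets the operator act on functions of all real times with
    bounded images.\<close>
  define c where "c = (\<lambda>t. max (-\<epsilon>) (min \<epsilon> t))"
  have c: "- \<epsilon> \<le> c t" "c t \<le> \<epsilon>" for t using eps by (auto simp: c_def)
  \<comment> \<open>The difference of the two integrals is the oriented integral from 0 to
    \<open>c t\<close>, whose upper end may be negative.\<close>
  define P where "P = (\<lambda>(y :: real \<Rightarrow> 'a) t. e + integral {-\<epsilon>..c t} (\<lambda>s. K (y s)) - integral {-\<epsilon>..0} (\<lambda>s. K (y s)))"
  have contKy: "continuous_on S (\<lambda>s. K (y s))" if "continuous_on UNIV y" for y :: "real \<Rightarrow> 'a" and S
    using continuous_on_compose2[OF contK that] by (auto intro: continuous_on_subset)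
  have intKy: "(\<lambda>s. K (y s)) integrable_on {a..b}" if "continuous_on UNIV y" for y :: "real \<Rightarrow> 'a" and a b
    using contKy[OF that] by (rule integrable_continuous_real)
  have contP: "continuous_on UNIV (P y)" if y: "continuous_on UNIV y" for y
  proof -
    have "continuous_on {-\<epsilon>..\<epsilon>} (\<lambda>t. integral {-\<epsilon>..t} (\<lambda>s. K (y s)))"
      by (rule indefinite_integral_continuous_1[OF intKy[OF y]])
    then have "continuous_on UNIV (\<lambda>t. integral {-\<epsilon>..c t} (\<lambda>s. K (y s)))"
      by (rule continuous_on_compose2) (use c in \<open>auto simp: c_def intro!: continuous_intros\<close>)
    then show ?thesis unfolding P_def by (intro continuous_intros)
  qed
  have ib: "norm (integral {-\<epsilon>..t} g) \<le> B * (t + \<epsilon>)"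
    if "continuous_on UNIV g" "\<And>s. norm (g s) \<le> B" "- \<epsilon> \<le> t" for g :: "real \<Rightarrow> 'a" and B t
    using integral_bound[of "-\<epsilon>" t g B] that continuous_on_subset[OF that(1)] by auto
  have bP: "norm (P y t - e) \<le> r" if y: "continuous_on UNIV y" for y t
  proof -
    have "norm (P y t - e) \<le> norm (integral {-\<epsilon>..c t} (\<lambda>s. K (y s))) + norm (integral {-\<epsilon>..0} (\<lambda>s. K (y s)))"
      unfolding P_def using norm_triangle_ineq4 by (simp add: norm_triangle_ineq4)
    also have "\<dots> \<le> M * (c t + \<epsilon>) + M * (0 + \<epsilon>)"
      using eps c by (intro add_mono ib contKy[OF y] K(1)) auto
    also have "\<dots> \<le> M * (2 * \<epsilon>) + M * \<epsilon>" using c[of t] M1 by (intro add_mono mult_left_mono) auto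
    also have "\<dots> \<le> r" using eM eps M1 r(1) by (simp add: algebra_simps)
    finally show ?thesis .
  qed
  have PB: "P y \<in> bcontfun" if y: "continuous_on UNIV y" for y
    unfolding bcontfun_def
  proof (clarify, intro conjI contP[OF y])
    have "norm (P y t) \<le> norm e + r" for t
      using bP[OF y, of t] norm_triangle_ineq2[of "P y t" e] by linarith
    then show "bounded (range (P y))" by (auto simp: bounded_iff)
  qed
  have cb: "continuous_on UNIV (apply_bcontfun y)" for y :: "real \<Rightarrow>\<^sub>C 'a"
    using apply_bcontfun[of y] by (simp add: bcontfun_def)
  define T where "T = (\<lambda>y :: real \<Rightarrow>\<^sub>C 'a. Bcontfun (P (apply_bcontfun y)))"
  have T: "apply_bcontfun (T y) = P (apply_bcontfun y)" for y
    unfolding T_def using PB[OF cb] by (rule Bcontfun_inverse)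
  have "dist (T y) (T z) \<le> 3/4 * dist y z" for y z
  proof (rule dist_bound)
    fix t
    let ?g = "\<lambda>s. K (apply_bcontfun y s) - K (apply_bcontfun z s)"
    have g: "continuous_on UNIV ?g" using contKy[OF cb] by (intro continuous_intros)
    have gb: "norm (?g s) \<le> L * dist y z" for s
    proof -
      have "norm (apply_bcontfun y s - apply_bcontfun z s) \<le> dist y z"
        using dist_bounded[of y s z] by (simp add: dist_norm)
      then show ?thesis using K(2) L(1) by (meson mult_left_mono order_trans)
    qed
    have "dist (apply_bcontfun (T y) t) (apply_bcontfun (T z) t) = norm (integral {-\<epsilon>..c t} ?g - integral {-\<epsilon>..0} ?g)"
      unfolding T P_def dist_norm by (simp add: integral_diff intKy[OF cb] algebra_simps)
    also have "\<dots> \<le> norm (integral {-\<epsilon>..c t} ?g) + norm (integral {-\<epsilon>..0} ?g)"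
      by (rule norm_triangle_ineq4)
    also have "\<dots> \<le> (L * dist y z) * (c t + \<epsilon>) + (L * dist y z) * (0 + \<epsilon>)"
      using eps c by (intro add_mono ib g gb) auto
    also have "\<dots> \<le> (L * dist y z) * (2 * \<epsilon>) + (L * dist y z) * \<epsilon>"
      using c[of t] L(1) by (intro add_mono mult_left_mono) auto
    also have "\<dots> = (3 * \<epsilon> * L) * dist y z" by (simp add: algebra_simps)
    also have "\<dots> \<le> 3/4 * dist y z" using eL by (intro mult_right_mono) auto
    finally show "dist (apply_bcontfun (T y) t) (apply_bcontfun (T z) t) \<le> 3/4 * dist y z" .
  qed
  then have "\<exists>!y. T y = y" by (intro banach_fix_type[of "3/4"]) auto
  then obtain Y where "T Y = Y" by blast
  define y where "y = apply_bcontfun Y"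
  have Py: "P y = y" using T[of Y] \<open>T Y = Y\<close> by (simp add: y_def)
  have cy: "continuous_on UNIV y" unfolding y_def by (rule cb)
  show ?thesis
  proof
    show "\<epsilon> > 0" by fact
    have "c 0 = 0" using eps by (simp add: c_def)
    then show "y 0 = e" using fun_cong[OF Py, of 0] by (simp add: P_def)
    fix t assume t: "\<bar>t\<bar> < \<epsilon>"
    have yt: "y t \<in> cball e r" using bP[OF cy, of t] by (simp add: Py dist_norm norm_minus_commute)
    have "K (y t) = F (y t)" unfolding K_def p_def using yt by (simp add: closest_point_self)
    moreover have "((\<lambda>u. integral {-\<epsilon>..u} (\<lambda>s. K (y s))) has_vector_derivative K (y t)) (at t within {-\<epsilon>..\<epsilon>})"
      by (rule integral_has_vector_derivative[OF contKy[OF cy]]) (use t in auto)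
    then have "((\<lambda>u. integral {-\<epsilon>..u} (\<lambda>s. K (y s))) has_vector_derivative K (y t)) (at t)"
      using t at_within_Icc_at[of "-\<epsilon>" t \<epsilon>] by (simp add: abs_less_iff)
    then have "((\<lambda>u. e + integral {-\<epsilon>..u} (\<lambda>s. K (y s)) - integral {-\<epsilon>..0} (\<lambda>s. K (y s))) has_vector_derivative K (y t)) (at t)"
      by (auto intro!: derivative_eq_intros)
    then have "(P y has_vector_derivative K (y t)) (at t)"
      by (rule has_vector_derivative_transform_within_open[of _ _ _ "{-\<epsilon><..<\<epsilon>}"])
        (use t in \<open>auto simp: P_def c_def\<close>)
    ultimately show "y t \<in> Q \<and> (y has_vector_derivative F (y t)) (at t)"
      using yt r(2) Py by auto
  qed
qed

section \<open>Smooth functions on a Lie group\<close>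

locale lie_grp =
  fixes G :: "'g::{second_countable_topology, t2_space} monoid" (structure)
    and A :: "('g, 'e::euclidean_space) atlas"
  assumes lie: "lie_group G A"
begin

lemma carrier_UNIV [simp]: "carrier G = UNIV" using lie by (simp add: lie_group_def)

sublocale group G using lie by (simp add: lie_group_def)

lemma atlas: "smooth_atlas A" using lie by (simp add: lie_group_def)

lemma chart_exists: obtains U \<phi> where "(U, \<phi>) \<in> A" "x \<in> U"
proof -
  have "x \<in> (\<Union>(U, \<phi>)\<in>A. U)" using atlas by (simp add: smooth_atlas_def)
  then show ?thesis using that by auto
qed

lemma chart:
  assumes "(U, \<phi>) \<in> A"
  shows "open U" "open (\<phi> ` U)" "continuous_on U \<phi>" "continuous_on (\<phi> ` U) (inv_into U \<phi>)"
    and "x \<in> U \<Longrightarrow> inv_into U \<phi> (\<phi> x) = x" "y \<in> \<phi> ` U \<Longrightarrow> \<phi> (inv_into U \<phi> y) = y"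
    "y \<in> \<phi> ` U \<Longrightarrow> inv_into U \<phi> y \<in> U"
proof -
  have h: "open U" "open (\<phi> ` U)" "homeomorphism U (\<phi> ` U) \<phi> (inv_into U \<phi>)"
    using bspec[OF atlas[unfolded smooth_atlas_def, THEN conjunct2, THEN conjunct1] assms] by simp_all
  then show "open U" "open (\<phi> ` U)" "continuous_on U \<phi>" "continuous_on (\<phi> ` U) (inv_into U \<phi>)"
    "x \<in> U \<Longrightarrow> inv_into U \<phi> (\<phi> x) = x" "y \<in> \<phi> ` U \<Longrightarrow> \<phi> (inv_into U \<phi> y) = y"
    "y \<in> \<phi> ` U \<Longrightarrow> inv_into U \<phi> y \<in> U"
    by (auto simp: homeomorphism_def)
qed

lemma chart_image_open:
  assumes "(U, \<phi>) \<in> A" "open N"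
  shows "open (\<phi> ` (U \<inter> N))"
proof -
  have "\<phi> ` (U \<inter> N) = \<phi> ` U \<inter> inv_into U \<phi> -` N"
    using chart(5)[OF assms(1)] by auto
  then show ?thesis
    using continuous_open_preimage[OF chart(4)[OF assms(1)] chart(2)[OF assms(1)] assms(2)] by simp
qed

lemma transition_smooth:
  "(U, \<phi>) \<in> A \<Longrightarrow> (V, \<psi>) \<in> A \<Longrightarrow> smooth_on (\<phi> ` (U \<inter> V)) (\<lambda>y. \<psi> (inv_into U \<phi> y))"
  using atlas[unfolded smooth_atlas_def, THEN conjunct2, THEN conjunct2] by (fastforce simp: comp_def)

abbreviation sf :: "('g \<Rightarrow> real) \<Rightarrow> bool" where "sf \<equiv> smooth_fun A"

lemma sf_iff: "sf f \<longleftrightarrow> continuous_on UNIV f \<and> (\<forall>(U, \<phi>)\<in>A. smooth_on (\<phi> ` U) (\<lambda>y. f (inv_into U \<phi> y)))"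
  by (simp add: smooth_map_def comp_def)

lemma sf_continuous: "sf f \<Longrightarrow> continuous_on S f"
  using continuous_on_subset by (auto simp: sf_iff)

lemma sf_chart: "sf f \<Longrightarrow> (U, \<phi>) \<in> A \<Longrightarrow> smooth_on (\<phi> ` U) (\<lambda>y. f (inv_into U \<phi> y))"
  by (auto simp: sf_iff)

text \<open>Continuity follows from the chart expressions, because charts are homeomorphisms onto
  their images and their domains form an open cover.\<close>

lemma sfI:
  assumes "\<And>U \<phi>. (U, \<phi>) \<in> A \<Longrightarrow> smooth_on (\<phi> ` U) (\<lambda>y. f (inv_into U \<phi> y))"
  shows "sf f"
proof -
  have "continuous (at x) f" for x
  proof -
    obtain U \<phi> where U: "(U, \<phi>) \<in> A" "x \<in> U" by (rule chart_exists)
    have "continuous_on U (\<lambda>x. f (inv_into U \<phi> (\<phi> x)))"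
      by (rule continuous_on_compose2[OF smooth_on_continuous[OF assms[OF U(1)] chart(2)[OF U(1)]] chart(3)[OF U(1)]]) auto
    then have "continuous_on U f" by (rule continuous_on_eq) (simp add: chart(5)[OF U(1)])
    then show ?thesis using chart(1)[OF U(1)] U(2) by (simp add: continuous_on_eq_continuous_at)
  qed
  then show ?thesis using assms by (auto simp: sf_iff continuous_on_eq_continuous_at)
qed

lemma sf_const: "sf (\<lambda>x. c)"
  by (rule sfI) (simp add: smooth_on_const chart)

lemma sf_add: "sf f \<Longrightarrow> sf g \<Longrightarrow> sf (\<lambda>x. f x + g x)"
  by (rule sfI) (simp add: smooth_on_add sf_chart chart)

lemma sf_mult: "sf f \<Longrightarrow> sf g \<Longrightarrow> sf (\<lambda>x. f x * g x)"
  by (rule sfI) (simp add: smooth_on_mult sf_chart chart)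

lemma sf_diff: "sf f \<Longrightarrow> sf g \<Longrightarrow> sf (\<lambda>x. f x - g x)"
  by (rule sfI) (simp add: smooth_on_diff sf_chart chart)

lemma sf_sum: "(\<And>i. i \<in> I \<Longrightarrow> sf (f i)) \<Longrightarrow> sf (\<lambda>x. \<Sum>i\<in>I. f i x)"
  by (rule sfI) (simp add: smooth_on_sum sf_chart chart)

lemma sf_prod: "(\<And>i. i \<in> I \<Longrightarrow> sf (f i)) \<Longrightarrow> sf (\<lambda>x. \<Prod>i\<in>I. f i x)"
  by (induction I rule: infinite_finite_induct) (auto simp: sf_const sf_mult)

text \<open>Any other chart is covered by a part near K, where h is composed with a transition map,
  and the complement of K, where the function vanishes. Closedness of K in the whole group makes the
  second part open.\<close>

lemma sf_chart_extend:
  assumes U: "(U, \<phi>) \<in> A" and K: "closed K" "K \<subseteq> U" and Q: "open Q" "\<phi> ` K \<subseteq> Q" "Q \<subseteq> \<phi> ` U"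
    and h: "smooth_on Q h" and z: "\<And>y. y \<in> U - K \<Longrightarrow> h (\<phi> y) = 0"
  shows "sf (\<lambda>y. if y \<in> U then h (\<phi> y) else 0)"
proof (rule sfI, rule smooth_on_local)
  fix V \<psi> assume V: "(V, \<psi>) \<in> A"
  let ?f = "\<lambda>y. if y \<in> U then h (\<phi> y) else 0"
  show "open (\<psi> ` V)" by (rule chart[OF V])
  fix y assume y: "y \<in> \<psi> ` V"
  then obtain x where x: "x \<in> V" "y = \<psi> x" by auto
  show "\<exists>N. open N \<and> y \<in> N \<and> N \<subseteq> \<psi> ` V \<and> smooth_on N (\<lambda>y. ?f (inv_into V \<psi> y))"
  proof (cases "x \<in> K")
    case True
    let ?M = "U \<inter> \<phi> -` Q" and ?N = "\<psi> ` (V \<inter> (U \<inter> \<phi> -` Q))"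
    have oM: "open ?M" using continuous_open_preimage[OF chart(3,1)[OF U] Q(1)] .
    have oN: "open ?N" by (rule chart_image_open[OF V oM])
    have "smooth_on ?N (\<lambda>y. \<phi> (inv_into V \<psi> y))"
      by (rule smooth_on_subset[OF transition_smooth[OF V U]]) (use oN chart_image_open[OF V chart(1)[OF U]] in auto)
    then have "smooth_on ?N (\<lambda>y. h (\<phi> (inv_into V \<psi> y)))"
      by (rule smooth_on_compose[OF oN Q(1) _ _ h, rotated]) (auto simp: chart(5)[OF V])
    then have "smooth_on ?N (\<lambda>y. ?f (inv_into V \<psi> y))"
      by (rule smooth_on_cong[OF oN]) (auto simp: chart(5)[OF V])
    then show ?thesis using oN x True K(2) Q(2) by (intro exI[of _ ?N]) (auto intro!: imageI)
  next
    case False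
    let ?N = "\<psi> ` (V \<inter> - K)"
    have oN: "open ?N" by (rule chart_image_open[OF V]) (use K(1) in auto)
    have "smooth_on ?N (\<lambda>y. ?f (inv_into V \<psi> y))"
      by (rule smooth_on_cong[OF oN smooth_on_const[OF oN, of 0]]) (auto simp: chart(5)[OF V] z)
    then show ?thesis using oN x False by (intro exI[of _ ?N]) auto
  qed
qed

lemma chart_ball:
  assumes U: "(U, \<phi>) \<in> A" "x \<in> U" "open N" "x \<in> N"
  obtains r where "r > 0" "cball (\<phi> x) r \<subseteq> \<phi> ` (U \<inter> N)"
proof -
  have "open (\<phi> ` (U \<inter> N))" "\<phi> x \<in> \<phi> ` (U \<inter> N)" using chart_image_open[OF U(1,3)] U by auto
  then show ?thesis using that by (meson open_contains_cball)
qed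

text \<open>Vector fields act on global functions only, so a function given near one point is cut
  off by a bump and extended by zero.\<close>

lemma local_smooth_extension:
  assumes U: "(U, \<phi>) \<in> A" "x \<in> U" and Q: "open Q" "\<phi> x \<in> Q" and h: "smooth_on Q h"
  obtains f M where "sf f" "open M" "x \<in> M" "M \<subseteq> U" "\<And>y. y \<in> M \<Longrightarrow> \<phi> y \<in> Q \<and> f y = h (\<phi> y)"
proof -
  have "open (U \<inter> \<phi> -` Q)" using continuous_open_preimage[OF chart(3,1)[OF U(1)] Q(1)] .
  then obtain r where r: "r > 0" "cball (\<phi> x) r \<subseteq> \<phi> ` (U \<inter> (U \<inter> \<phi> -` Q))"
    using chart_ball[OF U(1,2), of "U \<inter> \<phi> -` Q"] U Q by blast
  obtain \<beta> :: "'e \<Rightarrow> real" where b: "smooth_on UNIV \<beta>" "\<And>y. 0 \<le> \<beta> y" "\<And>y. \<beta> y \<le> 1"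
    "\<And>y. dist (\<phi> x) y < r / 2 \<Longrightarrow> \<beta> y = 1" "\<And>y. dist (\<phi> x) y \<ge> r \<Longrightarrow> \<beta> y = 0"
    using bump_euclidean[OF r(1)] by blast
  define K where "K = inv_into U \<phi> ` cball (\<phi> x) r"
  have "compact K" unfolding K_def
    using r(2) by (intro compact_continuous_image continuous_on_subset[OF chart(4)[OF U(1)]]) auto
  \<comment> \<open>Here the Hausdorff property enters: the compact image of the coordinate ball is
    closed in the whole group, as extension by zero requires.\<close>
  then have K: "closed K" by (rule compact_imp_closed)
  have KU: "K \<subseteq> U" using r(2) chart(7)[OF U(1)] by (auto simp: K_def)
  have phK: "\<phi> ` K \<subseteq> cball (\<phi> x) r" using r(2) chart(6)[OF U(1)] by (auto simp: K_def)
  let ?Q = "Q \<inter> \<phi> ` U"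
  have "\<phi> ` (U \<inter> (U \<inter> \<phi> -` Q)) \<subseteq> ?Q" by auto
  with r(2) have cQ: "cball (\<phi> x) r \<subseteq> ?Q" by (rule subset_trans)
  have sm: "smooth_on ?Q (\<lambda>y. \<beta> y * h y)"
    using Q(1) chart(2)[OF U(1)]
    by (intro smooth_on_mult smooth_on_subset[OF b(1)] smooth_on_subset[OF h]) auto
  let ?f = "\<lambda>y. if y \<in> U then \<beta> (\<phi> y) * h (\<phi> y) else 0"
  have sf: "sf ?f"
  proof (rule sf_chart_extend[OF U(1) K KU _ _ _ sm])
    show "open ?Q" using Q(1) chart(2)[OF U(1)] by auto
    show "\<phi> ` K \<subseteq> ?Q" using phK cQ by (rule subset_trans)
    fix y assume y: "y \<in> U - K"
    then have "\<phi> y \<notin> cball (\<phi> x) r"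
      unfolding K_def by (metis DiffD1 DiffD2 chart(5)[OF U(1)] imageI)
    then show "\<beta> (\<phi> y) * h (\<phi> y) = 0" using b(5)[of "\<phi> y"] by simp
  qed auto
  let ?M = "U \<inter> \<phi> -` ball (\<phi> x) (r/2)"
  have M: "open ?M" using continuous_open_preimage[OF chart(3,1)[OF U(1)] open_ball] .
  have "\<phi> y \<in> Q \<and> ?f y = h (\<phi> y)" if "y \<in> ?M" for y
  proof -
    have "\<phi> y \<in> cball (\<phi> x) r" using that r(1) by auto
    then show ?thesis using that b(4)[of "\<phi> y"] cQ by auto
  qed
  then show ?thesis using sf M U(2) r(1) by (intro that[of ?f ?M]) auto
qed

lemma bump:
  assumes N: "open N" "x \<in> N"
  obtains f M where "sf f" "\<And>y. 0 \<le> f y" "\<And>y. f y \<le> 1" "open M" "x \<in> M" "\<And>y. y \<in> M \<Longrightarrow> f y = 1"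
    "compact (closure {y. f y \<noteq> 0})" "closure {y. f y \<noteq> 0} \<subseteq> N"
    "\<And>y. y \<notin> N \<Longrightarrow> f y = 0"
proof -
  obtain U \<phi> where U: "(U, \<phi>) \<in> A" "x \<in> U" by (rule chart_exists)
  obtain r where r: "r > 0" "cball (\<phi> x) r \<subseteq> \<phi> ` (U \<inter> N)" using chart_ball[OF U N] by blast
  obtain \<beta> :: "'e \<Rightarrow> real" where b: "smooth_on UNIV \<beta>" "\<And>y. 0 \<le> \<beta> y" "\<And>y. \<beta> y \<le> 1"
    "\<And>y. dist (\<phi> x) y < r / 2 \<Longrightarrow> \<beta> y = 1" "\<And>y. dist (\<phi> x) y \<ge> r \<Longrightarrow> \<beta> y = 0"
    using bump_euclidean[OF r(1)] by blast
  define K where "K = inv_into U \<phi> ` cball (\<phi> x) r"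
  have cK: "compact K" unfolding K_def
    using r(2) by (intro compact_continuous_image continuous_on_subset[OF chart(4)[OF U(1)]]) auto
  then have K: "closed K" by (rule compact_imp_closed)
  have KU: "K \<subseteq> U \<inter> N" using r(2) chart(5)[OF U(1)] by (force simp: K_def)
  let ?f = "\<lambda>y. if y \<in> U then \<beta> (\<phi> y) else 0"
  have z: "\<beta> (\<phi> y) = 0" if "y \<in> U - K" for y
  proof -
    have "\<phi> y \<notin> cball (\<phi> x) r"
      using that unfolding K_def by (metis DiffD1 DiffD2 chart(5)[OF U(1)] imageI)
    then show ?thesis using b(5)[of "\<phi> y"] by simp
  qed
  have sf: "sf ?f"
    by (rule sf_chart_extend[OF U(1) K _ chart(2)[OF U(1)] _ _ smooth_on_subset[OF b(1)] z])
      (use KU chart(2)[OF U(1)] in auto)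
  let ?M = "U \<inter> \<phi> -` ball (\<phi> x) (r/2)"
  have M: "open ?M" using continuous_open_preimage[OF chart(3,1)[OF U(1)] open_ball] .
  have "{y. ?f y \<noteq> 0} \<subseteq> K" using z by auto
  then have cl: "closure {y. ?f y \<noteq> 0} \<subseteq> K" using K by (rule closure_minimal)
  have cpt: "compact (closure {y. ?f y \<noteq> 0})"
    using compact_Int_closed[OF cK closed_closure, of "{y. ?f y \<noteq> 0}"] Int_absorb1[OF cl] by simp
  have clN: "closure {y. ?f y \<noteq> 0} \<subseteq> N" using cl KU by blast
  have z0: "?f y = 0" if "y \<notin> N" for y using that z KU by auto
  show ?thesis
    by (rule that[of ?f ?M, OF sf _ _ M _ _ cpt clN z0]) (use b U(2) r(1) in auto)
qed

lemma smooth_test_separates: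
  assumes "\<And>f. sf f \<Longrightarrow> f x = f y"
  shows "x = y"
proof (rule ccontr)
  assume "x \<noteq> y"
  then obtain N where N: "open N" "x \<in> N" "y \<notin> N" by (meson separation_t1)
  obtain f M where "sf f" "x \<in> M" "\<And>y. y \<in> M \<Longrightarrow> f y = 1" "\<And>y. y \<notin> N \<Longrightarrow> f y = 0"
    using bump[OF N(1,2)] by metis
  then show False using assms[of f] N(3) by (metis zero_neq_one)
qed

text \<open>A bump function equal to 1 at \<open>\<alpha> q\<close> and 0 off N stays positive for
  nearby parameters, which keeps their images in N.\<close>

lemma continuous_on_smooth_test:
  assumes "\<And>f. sf f \<Longrightarrow> continuous_on Q (\<lambda>q. f (\<alpha> q))"
  shows "continuous_on Q \<alpha>"
  unfolding continuous_on_def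
proof (intro ballI topological_tendstoI)
  fix q N assume q: "q \<in> Q" and N: "open N" "\<alpha> q \<in> N"
  obtain f M where f: "sf f" "\<alpha> q \<in> M" "\<And>y. y \<in> M \<Longrightarrow> f y = 1" "\<And>y. y \<notin> N \<Longrightarrow> f y = 0"
    using bump[OF N] by metis
  have "((\<lambda>q. f (\<alpha> q)) \<longlongrightarrow> f (\<alpha> q)) (at q within Q)"
    using assms[OF f(1)] q by (simp add: continuous_on_def)
  then have "eventually (\<lambda>q. f (\<alpha> q) > 0) (at q within Q)"
    by (rule order_tendstoD) (simp add: f(2,3))
  then show "eventually (\<lambda>q. \<alpha> q \<in> N) (at q within Q)"
    by eventually_elim (use f(4) in force)
qed

text \<open>Smoothness is tested on global functions instead of charts, so that later arguments
  about products and integral curves need no choice of charts.\<close>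

definition smooth_into :: "'a::euclidean_space set \<Rightarrow> ('a \<Rightarrow> 'g) \<Rightarrow> bool" where
  "smooth_into Q \<alpha> \<longleftrightarrow> open Q \<and> (\<forall>f. sf f \<longrightarrow> smooth_on Q (\<lambda>q. f (\<alpha> q)))"

lemma smooth_intoD: "smooth_into Q \<alpha> \<Longrightarrow> sf f \<Longrightarrow> smooth_on Q (\<lambda>q. f (\<alpha> q))"
  by (simp add: smooth_into_def)

lemma smooth_into_open: "smooth_into Q \<alpha> \<Longrightarrow> open Q"
  by (simp add: smooth_into_def)

lemma smooth_into_continuous: "smooth_into Q \<alpha> \<Longrightarrow> continuous_on Q \<alpha>"
  by (rule continuous_on_smooth_test) (simp add: smooth_into_def smooth_on_continuous)

lemma smooth_into_const: "open Q \<Longrightarrow> smooth_into Q (\<lambda>q. x)"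
  by (simp add: smooth_into_def smooth_on_const)

lemma smooth_into_compose:
  assumes "smooth_into Q \<alpha>" "open Q'" "smooth_on Q' g" "g ` Q' \<subseteq> Q"
  shows "smooth_into Q' (\<lambda>q. \<alpha> (g q))"
  unfolding smooth_into_def
  using assms(2) smooth_on_compose[OF assms(2) smooth_into_open[OF assms(1)] assms(4,3) smooth_intoD[OF assms(1)]]
  by blast

lemma smooth_into_chart_inv: "(U, \<phi>) \<in> A \<Longrightarrow> smooth_into (\<phi> ` U) (inv_into U \<phi>)"
  by (simp add: smooth_into_def sf_chart chart)

text \<open>Chart coordinates agree locally with global smooth functions, which recovers smoothness
  in a chart from the test-function form.\<close>

lemma smooth_into_chart:
  assumes \<alpha>: "smooth_into Q \<alpha>" and U: "(U, \<phi>) \<in> A"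
  shows "open (Q \<inter> \<alpha> -` U)" "smooth_on (Q \<inter> \<alpha> -` U) (\<lambda>q. \<phi> (\<alpha> q))"
proof -
  note pre = continuous_open_preimage[OF smooth_into_continuous[OF \<alpha>] smooth_into_open[OF \<alpha>]]
  show o: "open (Q \<inter> \<alpha> -` U)" by (rule pre[OF chart(1)[OF U]])
  show "smooth_on (Q \<inter> \<alpha> -` U) (\<lambda>q. \<phi> (\<alpha> q))"
  proof (rule smooth_on_componentwise[OF o], rule smooth_on_local[OF o])
    fix b q assume q: "q \<in> Q \<inter> \<alpha> -` U"
    obtain f M where f: "sf f" "open M" "\<alpha> q \<in> M" "M \<subseteq> U" "\<And>y. y \<in> M \<Longrightarrow> \<phi> y \<in> UNIV \<and> f y = \<phi> y \<bullet> b"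
      using local_smooth_extension[OF U _ open_UNIV _ smooth_on_linear[OF open_UNIV bounded_linear_inner_left], of "\<alpha> q" b]
        q by auto
    have oN: "open (Q \<inter> \<alpha> -` M)" by (rule pre[OF f(2)])
    have "smooth_on (Q \<inter> \<alpha> -` M) (\<lambda>q. f (\<alpha> q))"
      by (rule smooth_on_subset[OF smooth_intoD[OF \<alpha> f(1)] _ smooth_into_open[OF \<alpha>] oN]) auto
    then have "smooth_on (Q \<inter> \<alpha> -` M) (\<lambda>q. \<phi> (\<alpha> q) \<bullet> b)"
      by (rule smooth_on_cong[OF oN]) (simp add: f(5))
    then show "\<exists>N. open N \<and> q \<in> N \<and> N \<subseteq> Q \<inter> \<alpha> -` U \<and> smooth_on N (\<lambda>q. \<phi> (\<alpha> q) \<bullet> b)"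
      using oN f(3,4) q by (intro exI[of _ "Q \<inter> \<alpha> -` M"]) auto
  qed
qed

lemma sf_smooth_map:
  assumes F: "smooth_map A A F" and f: "sf f"
  shows "sf (\<lambda>x. f (F x))"
proof (rule sfI, rule smooth_on_local)
  fix U \<phi> assume U: "(U, \<phi>) \<in> A"
  show "open (\<phi> ` U)" by (rule chart[OF U])
  fix y assume "y \<in> \<phi> ` U"
  then obtain x where x: "x \<in> U" "y = \<phi> x" by auto
  obtain V \<psi> where V: "(V, \<psi>) \<in> A" "F x \<in> V" by (rule chart_exists)
  have cF: "continuous_on UNIV F" and
    sm: "smooth_on (\<phi> ` (U \<inter> F -` V)) (\<lambda>y. \<psi> (F (inv_into U \<phi> y)))"
    using F U V unfolding smooth_map_def comp_def by blast+
  have oN: "open (\<phi> ` (U \<inter> F -` V))"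
    using chart_image_open[OF U] cF chart(1)[OF V(1)] by (simp add: open_vimage)
  have "smooth_on (\<phi> ` (U \<inter> F -` V)) (\<lambda>y. f (inv_into V \<psi> (\<psi> (F (inv_into U \<phi> y)))))"
    by (rule smooth_on_compose[OF oN chart(2)[OF V(1)] _ sm sf_chart[OF f V(1)]])
      (auto simp: chart(5)[OF U])
  then have "smooth_on (\<phi> ` (U \<inter> F -` V)) (\<lambda>y. f (F (inv_into U \<phi> y)))"
    by (rule smooth_on_cong[OF oN]) (auto simp: chart(5)[OF U] chart(5)[OF V(1)])
  then show "\<exists>N. open N \<and> y \<in> N \<and> N \<subseteq> \<phi> ` U \<and> smooth_on N (\<lambda>y. f (F (inv_into U \<phi> y)))"
    using oN x V by (intro exI[of _ "\<phi> ` (U \<inter> F -` V)"]) auto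
qed

lemma smooth_into_map: "smooth_map A A F \<Longrightarrow> smooth_into Q \<alpha> \<Longrightarrow> smooth_into Q (\<lambda>q. F (\<alpha> q))"
  using sf_smooth_map unfolding smooth_into_def by blast

lemma smooth_into_inv: "smooth_into Q \<alpha> \<Longrightarrow> smooth_into Q (\<lambda>q. inv (\<alpha> q))"
  using smooth_into_map[of "\<lambda>x. inv x"] lie by (simp add: lie_group_def)

lemma mult_continuous: "continuous_on UNIV (\<lambda>(x, y). x \<otimes> y)"
  using lie by (simp add: lie_group_def smooth_map_def)

lemma continuous_on_mult [continuous_intros]:
  "continuous_on S f \<Longrightarrow> continuous_on S g \<Longrightarrow> continuous_on S (\<lambda>x. f x \<otimes> g x)"
  using continuous_on_compose2[OF mult_continuous continuous_on_Pair[of S f g]] by simp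

lemma continuous_on_inv [continuous_intros]:
  "continuous_on S f \<Longrightarrow> continuous_on S (\<lambda>x. inv (f x))"
proof -
  assume f: "continuous_on S f"
  have "continuous_on UNIV (\<lambda>x. inv x)" using lie by (simp add: lie_group_def smooth_map_def)
  from continuous_on_compose2[OF this f] show ?thesis by simp
qed

lemma smooth_into_mult:
  assumes \<alpha>: "smooth_into Q \<alpha>" and \<beta>: "smooth_into Q \<beta>"
  shows "smooth_into Q (\<lambda>q. \<alpha> q \<otimes> \<beta> q)"
  unfolding smooth_into_def
proof (intro conjI allI impI)
  show oQ: "open Q" by (rule smooth_into_open[OF \<alpha>])
  fix f assume f: "sf f"
  show "smooth_on Q (\<lambda>q. f (\<alpha> q \<otimes> \<beta> q))"
  proof (rule smooth_on_local[OF oQ])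
    fix q assume q: "q \<in> Q"
    obtain U \<phi> where U: "(U, \<phi>) \<in> A" "\<alpha> q \<in> U" by (rule chart_exists)
    obtain V \<psi> where V: "(V, \<psi>) \<in> A" "\<beta> q \<in> V" by (rule chart_exists)
    obtain W \<theta> where W: "(W, \<theta>) \<in> A" "\<alpha> q \<otimes> \<beta> q \<in> W" by (rule chart_exists)
    let ?m = "\<lambda>(x, y). x \<otimes> y" and ?c = "map_prod \<phi> \<psi>" and ?i = "inv_into (U \<times> V) (map_prod \<phi> \<psi>)"
    let ?T = "?c ` ((U \<times> V) \<inter> ?m -` W)"
    have inj: "inj_on \<phi> U" "inj_on \<psi> V" using chart(5)[OF U(1)] chart(5)[OF V(1)] by (metis inj_onI)+
    then have ijc: "inj_on ?c (U \<times> V)" by (rule map_prod_inj_on)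
    have i: "?i (\<phi> a, \<psi> b) = (a, b)" if "a \<in> U" "b \<in> V" for a b
      using inv_into_f_f[OF ijc, of "(a, b)"] that by simp
    have "smooth_map (prod_atlas A A) A ?m" using lie by (simp add: lie_group_def)
    moreover have "(U \<times> V, ?c) \<in> prod_atlas A A" using U V by (auto simp: prod_atlas_def)
    ultimately have sm: "smooth_on ?T (\<lambda>z. \<theta> (?m (?i z)))"
      using W(1) unfolding smooth_map_def comp_def by blast
    \<comment> \<open>The chart expression is smooth on this set, but composition needs the set to
      be open; writing it as a continuous preimage shows that.\<close>
    have T: "?T = (\<phi> ` U \<times> \<psi> ` V) \<inter> (\<lambda>z. inv_into U \<phi> (fst z) \<otimes> inv_into V \<psi> (snd z)) -` W" (is "_ = ?T'")
    proof (intro equalityI subsetI)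
      fix z assume "z \<in> ?T"
      then show "z \<in> ?T'" by (auto simp: chart(5)[OF U(1)] chart(5)[OF V(1)])
    next
      fix z assume "z \<in> ?T'"
      then show "z \<in> ?T"
        by (intro image_eqI[of _ _ "(inv_into U \<phi> (fst z), inv_into V \<psi> (snd z))"])
          (auto simp: chart(5)[OF U(1)] chart(5)[OF V(1)])
    qed
    have oT: "open ?T" unfolding T
      using chart(1)[OF W(1)] chart(2)[OF U(1)] chart(2)[OF V(1)]
      by (intro continuous_open_preimage open_Times continuous_on_mult
          continuous_on_compose2[OF chart(4)[OF U(1)]] continuous_on_compose2[OF chart(4)[OF V(1)]] continuous_intros) auto
    let ?N = "(Q \<inter> \<alpha> -` U) \<inter> (Q \<inter> \<beta> -` V) \<inter> (Q \<inter> (\<lambda>q. \<alpha> q \<otimes> \<beta> q) -` W)"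
    have "open (Q \<inter> (\<lambda>q. \<alpha> q \<otimes> \<beta> q) -` W)"
      by (intro continuous_open_preimage continuous_on_mult smooth_into_continuous \<alpha> \<beta> oQ chart(1)[OF W(1)])
    then have oN: "open ?N" using smooth_into_chart(1)[OF \<alpha> U(1)] smooth_into_chart(1)[OF \<beta> V(1)] by auto
    have pr: "smooth_on ?N (\<lambda>q. (\<phi> (\<alpha> q), \<psi> (\<beta> q)))"
      by (intro smooth_on_Pair oN smooth_on_subset[OF smooth_into_chart(2)[OF \<alpha> U(1)]]
          smooth_on_subset[OF smooth_into_chart(2)[OF \<beta> V(1)]] smooth_into_chart(1)[OF \<alpha> U(1)]
          smooth_into_chart(1)[OF \<beta> V(1)]) auto
    have im: "(\<lambda>q. (\<phi> (\<alpha> q), \<psi> (\<beta> q))) ` ?N \<subseteq> ?T" by force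
    have 1: "smooth_on ?N (\<lambda>q. \<theta> (?m (?i (\<phi> (\<alpha> q), \<psi> (\<beta> q)))))"
      by (rule smooth_on_compose[OF oN oT im pr sm])
    have "smooth_on ?N (\<lambda>q. f (inv_into W \<theta> (\<theta> (?m (?i (\<phi> (\<alpha> q), \<psi> (\<beta> q)))))))"
      by (rule smooth_on_compose[OF oN chart(2)[OF W(1)] _ 1 sf_chart[OF f W(1)]]) (auto simp: i)
    then have "smooth_on ?N (\<lambda>q. f (\<alpha> q \<otimes> \<beta> q))"
      by (rule smooth_on_cong[OF oN]) (auto simp: i chart(5)[OF W(1)])
    then show "\<exists>N. open N \<and> q \<in> N \<and> N \<subseteq> Q \<and> smooth_on N (\<lambda>q. f (\<alpha> q \<otimes> \<beta> q))"
      using oN q U V W by (intro exI[of _ ?N]) auto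
  qed
qed

lemma sf_translate:
  assumes "sf f"
  shows "sf (\<lambda>x. f (p \<otimes> x))" "sf (\<lambda>x. f (x \<otimes> p))" "sf (\<lambda>x. f (inv x))"
proof -
  show "sf (\<lambda>x. f (p \<otimes> x))"
    by (rule sfI) (intro smooth_intoD[OF _ assms] smooth_into_mult smooth_into_chart_inv smooth_into_const chart(2))
  show "sf (\<lambda>x. f (x \<otimes> p))"
    by (rule sfI) (intro smooth_intoD[OF _ assms] smooth_into_mult smooth_into_chart_inv smooth_into_const chart(2))
  show "sf (\<lambda>x. f (inv x))"
    by (rule sfI) (intro smooth_intoD[OF _ assms] smooth_into_inv smooth_into_chart_inv)
qed

end

section \<open>Left-invariant vector fields\<close>

context lie_grp begin

definition chart1 :: "'g set \<times> ('g \<Rightarrow> 'e)" where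
  "chart1 = (SOME c. c \<in> A \<and> \<one> \<in> fst c)"

definition Q1 :: "'e set" where "Q1 = snd chart1 ` fst chart1"

definition \<xi> :: "'e \<Rightarrow> 'g" where "\<xi> = inv_into (fst chart1) (snd chart1)"

definition e1 :: 'e where "e1 = snd chart1 \<one>"

lemma chart1: "(fst chart1, snd chart1) \<in> A" "\<one> \<in> fst chart1"
proof -
  obtain U \<phi> where "(U, \<phi>) \<in> A" "\<one> \<in> U" by (rule chart_exists)
  then have "\<exists>c. c \<in> A \<and> \<one> \<in> fst c" by force
  from someI_ex[OF this] show "(fst chart1, snd chart1) \<in> A" "\<one> \<in> fst chart1"
    by (auto simp: chart1_def)
qed

lemma smooth_xi: "smooth_into Q1 \<xi>"
  unfolding Q1_def \<xi>_def by (rule smooth_into_chart_inv[OF chart1(1)])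

lemma open_Q1: "open Q1" using smooth_xi by (rule smooth_into_open)

lemma e1: "e1 \<in> Q1" "\<xi> e1 = \<one>"
  using chart1(2) chart(5)[OF chart1] by (auto simp: e1_def Q1_def \<xi>_def)

lemma xi_phi: "x \<in> fst chart1 \<Longrightarrow> \<xi> (snd chart1 x) = x"
  unfolding \<xi>_def by (rule chart(5)[OF chart1(1)])

lemma phi_xi: "z \<in> Q1 \<Longrightarrow> snd chart1 (\<xi> z) = z"
  unfolding \<xi>_def Q1_def by (rule chart(6)[OF chart1(1)])

text \<open>The left-invariant field with coordinates \<open>v\<close> at \<open>\<one>\<close>, in the chart \<open>chart1\<close>.\<close>

definition lf :: "'e \<Rightarrow> 'g vfield" where
  "lf v f x = (if sf f then frechet_derivative (\<lambda>z. f (x \<otimes> \<xi> z)) (at e1) v else 0)"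

lemma smooth_into_translate_xi:
  assumes \<alpha>: "smooth_into Q \<alpha>"
  shows "smooth_into (Q \<times> Q1) (\<lambda>p. \<alpha> (fst p) \<otimes> \<xi> (snd p))"
proof (rule smooth_into_mult)
  have o: "open (Q \<times> Q1)" using smooth_into_open[OF \<alpha>] open_Q1 by (rule open_Times)
  show "smooth_into (Q \<times> Q1) (\<lambda>p. \<alpha> (fst p))"
    by (rule smooth_into_compose[OF \<alpha> o smooth_on_linear[OF o bounded_linear_fst]]) auto
  show "smooth_into (Q \<times> Q1) (\<lambda>p. \<xi> (snd p))"
    by (rule smooth_into_compose[OF smooth_xi o smooth_on_linear[OF o bounded_linear_snd]]) auto
qed

lemma smooth_translate_xi: "sf f \<Longrightarrow> smooth_on Q1 (\<lambda>z. f (x \<otimes> \<xi> z))"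
  by (rule smooth_intoD[OF smooth_into_mult[OF smooth_into_const smooth_xi]]) (simp_all add: open_Q1)

lemma lf_derivative:
  assumes "sf f"
  shows "((\<lambda>z. f (x \<otimes> \<xi> z)) has_derivative (\<lambda>v. lf v f x)) (at e1)"
  using smooth_on_has_derivative[OF smooth_translate_xi[OF assms] open_Q1 e1(1)] assms
  by (simp add: lf_def)

lemma lf_unique:
  assumes "sf f" "((\<lambda>z. f (x \<otimes> \<xi> z)) has_derivative D) (at e1)"
  shows "lf v f x = D v"
  using has_derivative_unique[OF lf_derivative[OF assms(1)] assms(2)] by (rule fun_cong)

text \<open>The value \<open>lf v f (\<alpha> q)\<close> is a partial derivative, at the fixed point
  \<open>e1\<close>, of a function jointly smooth in q and the chart variable; hence it is smooth in
  q.\<close>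

lemma smooth_on_lf:
  assumes \<alpha>: "smooth_into Q \<alpha>" and f: "sf f"
  shows "smooth_on Q (\<lambda>q. lf v f (\<alpha> q))"
proof -
  note oQ = smooth_into_open[OF \<alpha>]
  have oQQ: "open (Q \<times> Q1)" using oQ open_Q1 by (rule open_Times)
  let ?h = "\<lambda>p. f (\<alpha> (fst p) \<otimes> \<xi> (snd p))"
  have h: "smooth_on (Q \<times> Q1) ?h"
    by (rule smooth_intoD[OF smooth_into_translate_xi[OF \<alpha>] f])
  have "smooth_on Q (\<lambda>q. frechet_derivative ?h (at (q, e1)) (0, v))"
    by (rule smooth_on_compose[OF oQ oQQ _ _ smooth_on_frechet[OF h oQQ]])
      (use e1(1) in \<open>auto intro!: smooth_on_Pair oQ smooth_on_const smooth_on_ident\<close>)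
  moreover have "frechet_derivative ?h (at (q, e1)) (0, v) = lf v f (\<alpha> q)" if "q \<in> Q" for q
  proof -
    have "((\<lambda>z. (q, z)) has_derivative (\<lambda>v. (0, v))) (at e1)"
      by (auto intro!: derivative_eq_intros)
    moreover have "(?h has_derivative frechet_derivative ?h (at (q, e1))) (at (q, e1))"
      using smooth_on_has_derivative[OF h oQQ] that e1(1) by auto
    ultimately have "((\<lambda>z. ?h (q, z)) has_derivative (\<lambda>v. frechet_derivative ?h (at (q, e1)) (0, v))) (at e1)"
      by (rule has_derivative_compose)
    then show ?thesis using lf_unique[OF f, of "\<alpha> q"] by simp
  qed
  ultimately show ?thesis by (rule smooth_on_cong[OF oQ])
qed

lemma sf_lf: "sf f \<Longrightarrow> sf (lf v f)"
  by (rule sfI, rule smooth_on_lf[OF smooth_into_chart_inv])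

lemma lf_left_invariant: "sf f \<Longrightarrow> lf v (\<lambda>x. f (g \<otimes> x)) x = lf v f (g \<otimes> x)"
  using lf_derivative[of f "g \<otimes> x"] by (intro lf_unique sf_translate) (simp_all add: m_assoc)

lemma lf_at_one: "sf f \<Longrightarrow> lf v f x = lf v (\<lambda>y. f (x \<otimes> y)) \<one>"
  by (simp add: lf_left_invariant)

lemma lf_lincomb: "sf f \<Longrightarrow> sf g \<Longrightarrow> lf v (\<lambda>x. a * f x + b * g x) x = a * lf v f x + b * lf v g x"
  by (rule lf_unique) (auto intro!: sf_add sf_mult sf_const has_derivative_add has_derivative_mult_right lf_derivative)

lemma lf_leibniz: "sf f \<Longrightarrow> sf g \<Longrightarrow> lf v (\<lambda>x. f x * g x) x = f x * lf v g x + g x * lf v f x"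
proof -
  assume f: "sf f" and g: "sf g"
  have "((\<lambda>z. f (x \<otimes> \<xi> z) * g (x \<otimes> \<xi> z)) has_derivative
      (\<lambda>v. f (x \<otimes> \<xi> e1) * lf v g x + lf v f x * g (x \<otimes> \<xi> e1))) (at e1)"
    by (rule has_derivative_mult[OF lf_derivative[OF f] lf_derivative[OF g]])
  from lf_unique[OF sf_mult[OF f g] this] show ?thesis by (simp add: e1)
qed

lemma lf_in_lie_algebra: "lf v \<in> lie_algebra G A"
  unfolding lie_algebra_def vector_fields_def
  by (auto simp: sf_lf lf_lincomb lf_leibniz lf_left_invariant fun_eq_iff)
    (simp_all add: lf_def)

lemma linear_lf_fun: "linear (\<lambda>v. lf v f x)"
  using has_derivative_linear[OF lf_derivative] by (cases "sf f") (auto simp: lf_def linear_zero)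

lemma linear_lf: "linear lf"
  by (auto intro!: linearI simp: fun_eq_iff linear_add[OF linear_lf_fun] linear_cmul[OF linear_lf_fun] scaleR_fun_def)

text \<open>Coordinates centred at \<open>\<one>\<close> exist only in the chart, whereas fields
  need global arguments: \<open>X b\<close> is a global function that agrees with coordinate b on
  the neighbourhood M.\<close>

definition coord_at_one :: "('e \<Rightarrow> 'g \<Rightarrow> real) \<Rightarrow> 'g set \<Rightarrow> bool" where
  "coord_at_one X M \<longleftrightarrow> open M \<and> \<one> \<in> M \<and> M \<subseteq> fst chart1 \<and>
    (\<forall>b. sf (X b) \<and> (\<forall>y\<in>M. b \<in> Basis \<longrightarrow> X b y = (snd chart1 y - e1) \<bullet> b))"

lemma coord_exists: obtains X M where "coord_at_one X M"
proof -
  have "\<exists>f M. sf f \<and> open M \<and> \<one> \<in> M \<and> M \<subseteq> fst chart1 \<and> (\<forall>y\<in>M. f y = (snd chart1 y - e1) \<bullet> b)" for b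
  proof -
    have "smooth_on UNIV (\<lambda>y. (y - e1) \<bullet> b)"
      by (intro smooth_on_linear_comp[OF _ bounded_linear_inner_left] smooth_on_diff smooth_on_const smooth_on_ident open_UNIV)
    from local_smooth_extension[OF chart1 open_UNIV UNIV_I this] show ?thesis by metis
  qed
  then obtain X N where XN: "\<And>b. sf (X b) \<and> open (N b) \<and> \<one> \<in> N b \<and> N b \<subseteq> fst chart1 \<and>
     (\<forall>y\<in>N b. X b y = (snd chart1 y - e1) \<bullet> b)" by metis
  obtain b0 :: 'e where "b0 \<in> Basis" using nonempty_Basis by blast
  then have "(\<Inter>b\<in>Basis. N b) \<subseteq> fst chart1" using XN by blast
  then have "coord_at_one X (\<Inter>b\<in>Basis. N b)"
    using XN unfolding coord_at_one_def by (auto intro!: open_INT)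
  then show ?thesis by (rule that)
qed

lemma xi_nbhd:
  assumes "open M" "\<one> \<in> M"
  obtains r where "r > 0" "ball e1 r \<subseteq> Q1" "\<xi> ` ball e1 r \<subseteq> M"
proof -
  have "open (Q1 \<inter> \<xi> -` M)"
    by (rule continuous_open_preimage[OF smooth_into_continuous[OF smooth_xi] open_Q1 assms(1)])
  moreover have "e1 \<in> Q1 \<inter> \<xi> -` M" using e1 assms(2) by simp
  ultimately obtain r where "r > 0" "ball e1 r \<subseteq> Q1 \<inter> \<xi> -` M" by (meson open_contains_ball)
  then show ?thesis by (intro that[of r]) auto
qed

lemma lf_coord:
  assumes "coord_at_one X M" "b \<in> Basis"
  shows "lf v (X b) \<one> = v \<bullet> b"
proof (rule lf_unique)
  show "sf (X b)" using assms by (simp add: coord_at_one_def)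
  obtain r where r: "r > 0" "ball e1 r \<subseteq> Q1" "\<xi> ` ball e1 r \<subseteq> M"
    using xi_nbhd[of M] assms by (auto simp: coord_at_one_def)
  have "((\<lambda>z. (z - e1) \<bullet> b) has_derivative (\<lambda>v. v \<bullet> b)) (at e1)"
    by (auto intro!: derivative_eq_intros)
  then show "((\<lambda>z. X b (\<one> \<otimes> \<xi> z)) has_derivative (\<lambda>v. v \<bullet> b)) (at e1)"
  proof (rule has_derivative_transform_within_open[of _ _ _ _ "ball e1 r"])
    fix z assume z: "z \<in> ball e1 r"
    then have "\<xi> z \<in> M" "z \<in> Q1" using r by auto
    then show "(z - e1) \<bullet> b = X b (\<one> \<otimes> \<xi> z)"
      using assms phi_xi[of z] by (simp add: coord_at_one_def)
  qed (use r in auto)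
qed

lemma lf_inj: "lf v = lf w \<Longrightarrow> v = w"
  by (metis coord_exists euclidean_eqI lf_coord)

text \<open>Derivations depend only on the germ of a function, and Hadamard's lemma expresses the germ
  at \<open>\<one>\<close> by a constant plus products with the coordinates.\<close>

lemma lie_algebra_eq: "lie_algebra G A = range lf"
proof
  show "range lf \<subseteq> lie_algebra G A" using lf_in_lie_algebra by blast
  show "lie_algebra G A \<subseteq> range lf"
  proof
    fix Y assume "Y \<in> lie_algebra G A"
    then have nz: "\<And>f. \<not> sf f \<Longrightarrow> Y f = 0"
      and sm: "\<And>f. sf f \<Longrightarrow> sf (Y f)"
      and lin: "\<And>f g a b. sf f \<Longrightarrow> sf g \<Longrightarrow> Y (\<lambda>x. a * f x + b * g x) = (\<lambda>x. a * Y f x + b * Y g x)"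
      and der: "\<And>f g. sf f \<Longrightarrow> sf g \<Longrightarrow> Y (\<lambda>x. f x * g x) = (\<lambda>x. f x * Y g x + g x * Y f x)"
      and inv: "\<And>g f. sf f \<Longrightarrow> Y (\<lambda>x. f (g \<otimes> x)) = (\<lambda>x. Y f (g \<otimes> x))"
      unfolding lie_algebra_def vector_fields_def by blast+
    \<comment> \<open>The product 1 * 1 kills the constant 1 by the Leibniz rule, and linearity the
      other constants.\<close>
    have cst: "Y (\<lambda>x. c) = (\<lambda>x. 0)" for c
    proof -
      have "Y (\<lambda>x. 1) = (\<lambda>x. 0)" using der[OF sf_const sf_const, of 1 1] by (auto simp: fun_eq_iff)
      then show ?thesis using lin[OF sf_const sf_const, of c 1 0 1] by simp
    qed
    have sum: "Y (\<lambda>x. c + (\<Sum>b\<in>B. F b x)) = (\<lambda>x. \<Sum>b\<in>B. Y (F b) x)" if "finite B" "\<And>b. sf (F b)" for c B and F :: "'e \<Rightarrow> 'g \<Rightarrow> real"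
      using that(1)
    proof (induction B)
      case empty
      show ?case by (simp add: cst)
    next
      case (insert b B)
      have "Y (\<lambda>x. 1 * F b x + 1 * (c + (\<Sum>b\<in>B. F b x))) = (\<lambda>x. 1 * Y (F b) x + 1 * Y (\<lambda>x. c + (\<Sum>b\<in>B. F b x)) x)"
        by (intro lin that sf_add sf_const sf_sum)
      then show ?case using insert by (simp add: algebra_simps)
    qed
    \<comment> \<open>With \<beta> equal to 1 near \<open>\<one>\<close> and supported where f = g,
      the product \<beta>(f - g) is zero, and the Leibniz rule at \<open>\<one>\<close> returns Y f
      - Y g.\<close>
    have loc: "Y f \<one> = Y g \<one>" if f: "sf f" and g: "sf g" and M: "open M" "\<one> \<in> M" "\<And>y. y \<in> M \<Longrightarrow> f y = g y" for f g M
    proof -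
      obtain \<beta> N where b0: "sf \<beta>" "\<And>y. 0 \<le> \<beta> y" "\<And>y. \<beta> y \<le> 1" "open N" "\<one> \<in> N" "\<And>y. y \<in> N \<Longrightarrow> \<beta> y = 1"
        "compact (closure {y. \<beta> y \<noteq> 0})" "closure {y. \<beta> y \<noteq> 0} \<subseteq> M" "\<And>y. y \<notin> M \<Longrightarrow> \<beta> y = 0"
        by (rule bump[OF M(1,2)]) (rule that)
      note b = b0(1,5,6,9)
      have "(\<lambda>x. \<beta> x * (f x - g x)) = (\<lambda>x. 0)" using b(4) M(3) by (auto simp: fun_eq_iff)
      then have "0 = Y (\<lambda>x. \<beta> x * (f x - g x)) \<one>" by (simp add: cst)
      also have "\<dots> = Y (\<lambda>x. f x - g x) \<one>" using der[OF b(1) sf_diff[OF f g]] b(2,3) M by simp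
      also have "\<dots> = Y f \<one> - Y g \<one>" using lin[OF f g, of 1 "-1"] by simp
      finally show ?thesis by simp
    qed
    obtain X M where XM: "coord_at_one X M" by (rule coord_exists)
    then have M: "open M" "\<one> \<in> M" "M \<subseteq> fst chart1" and X: "\<And>b. sf (X b)" by (auto simp: coord_at_one_def)
    define v where "v = (\<Sum>b\<in>Basis. Y (X b) \<one> *\<^sub>R b)"
    have vb: "v \<bullet> b = Y (X b) \<one>" if "b \<in> Basis" for b
      unfolding v_def using that by (simp add: inner_sum_left inner_Basis if_distrib cong: if_cong)
    obtain r where r: "r > 0" "ball e1 r \<subseteq> Q1" "\<xi> ` ball e1 r \<subseteq> M" using xi_nbhd[OF M(1,2)] by blast
    have at1: "Y f \<one> = lf v f \<one>" if f: "sf f" for f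
    proof -
      have sm1: "smooth_on (ball e1 r) (\<lambda>z. f (\<xi> z))"
        by (rule smooth_on_subset[OF smooth_intoD[OF smooth_xi f] r(2) open_Q1 open_ball])
      obtain g where g: "\<And>b. smooth_on (ball e1 r) (g b)"
        "\<And>y. y \<in> ball e1 r \<Longrightarrow> f (\<xi> y) = f (\<xi> e1) + (\<Sum>b\<in>Basis. ((y - e1) \<bullet> b) * g b y)"
        "\<And>b. g b e1 = frechet_derivative (\<lambda>z. f (\<xi> z)) (at e1) b"
        using hadamard[OF sm1 r(1)] by blast
      have "\<exists>h N. sf h \<and> open N \<and> \<one> \<in> N \<and> N \<subseteq> fst chart1 \<and> (\<forall>y\<in>N. snd chart1 y \<in> ball e1 r \<and> h y = g b (snd chart1 y))" for b
      proof -
        have "snd chart1 \<one> \<in> ball e1 r" using r(1) by (simp add: e1_def[symmetric])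
        then obtain h N where "sf h" "open N" "\<one> \<in> N" "N \<subseteq> fst chart1"
          "\<And>y. y \<in> N \<Longrightarrow> snd chart1 y \<in> ball e1 r \<and> h y = g b (snd chart1 y)"
          by (rule local_smooth_extension[OF chart1 open_ball _ g(1)[of b]]) (rule that)
        then show ?thesis by (intro exI[of _ h] exI[of _ N]) simp
      qed
      then have "\<forall>b. \<exists>h N. sf h \<and> open N \<and> \<one> \<in> N \<and> N \<subseteq> fst chart1 \<and>
         (\<forall>y\<in>N. snd chart1 y \<in> ball e1 r \<and> h y = g b (snd chart1 y))" ..
      from choice[OF this] obtain H where "\<forall>b. \<exists>N. sf (H b) \<and> open N \<and> \<one> \<in> N \<and> N \<subseteq> fst chart1 \<and>
         (\<forall>y\<in>N. snd chart1 y \<in> ball e1 r \<and> H b y = g b (snd chart1 y))" ..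
      from choice[OF this] obtain N where "\<forall>b. sf (H b) \<and> open (N b) \<and> \<one> \<in> N b \<and> N b \<subseteq> fst chart1 \<and>
         (\<forall>y\<in>N b. snd chart1 y \<in> ball e1 r \<and> H b y = g b (snd chart1 y))" ..
      then have HN: "\<And>b. sf (H b) \<and> open (N b) \<and> \<one> \<in> N b \<and> N b \<subseteq> fst chart1 \<and>
         (\<forall>y\<in>N b. snd chart1 y \<in> ball e1 r \<and> H b y = g b (snd chart1 y))" by (rule spec)
      then have H: "\<And>b. sf (H b)" by blast
      let ?N = "M \<inter> (\<Inter>b\<in>Basis. N b)"
      have "Y f \<one> = Y (\<lambda>x. f \<one> + (\<Sum>b\<in>Basis. X b x * H b x)) \<one>"
      proof (rule loc[OF f])
        show "sf (\<lambda>x. f \<one> + (\<Sum>b\<in>Basis. X b x * H b x))"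
          by (intro sf_add sf_const sf_sum sf_mult X H)
        show "open ?N" using M HN by (auto intro!: open_INT)
        show "\<one> \<in> ?N" using M HN by auto
        fix y assume y: "y \<in> ?N"
        obtain b0 :: 'e where "b0 \<in> Basis" using nonempty_Basis by blast
        then have y': "snd chart1 y \<in> ball e1 r" using y HN by blast
        have "y \<in> fst chart1" using y M by blast
        then have "f y = f \<one> + (\<Sum>b\<in>Basis. ((snd chart1 y - e1) \<bullet> b) * g b (snd chart1 y))"
          using g(2)[OF y'] by (simp add: xi_phi e1)
        also have "(\<Sum>b\<in>Basis. ((snd chart1 y - e1) \<bullet> b) * g b (snd chart1 y)) = (\<Sum>b\<in>Basis. X b y * H b y)"
          using y HN XM by (intro sum.cong) (auto simp: coord_at_one_def)
        finally show "f y = f \<one> + (\<Sum>b\<in>Basis. X b y * H b y)" .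
      qed
      also have "\<dots> = (\<Sum>b\<in>Basis. Y (\<lambda>x. X b x * H b x) \<one>)"
        by (simp add: sum[OF finite_Basis sf_mult[OF X H]])
      \<comment> \<open>Only one Leibniz term survives, because \<open>X b\<close> vanishes at
        \<open>\<one>\<close>; the remaining value \<open>H b \<one>\<close> is a partial derivative
        of f there.\<close>
      also have "\<dots> = (\<Sum>b\<in>Basis. (v \<bullet> b) * lf b f \<one>)"
      proof (rule sum.cong[OF refl])
        fix b :: 'e assume b: "b \<in> Basis"
        have "X b \<one> = 0" using XM M(2) b by (auto simp: coord_at_one_def e1_def)
        moreover have "H b \<one> = lf b f \<one>"
          using HN[of b] g(3)[of b] f by (simp add: lf_def e1_def[symmetric])
        ultimately show "Y (\<lambda>x. X b x * H b x) \<one> = (v \<bullet> b) * lf b f \<one>"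
          using der[OF X H, of b b] vb[OF b] by simp
      qed
      also have "\<dots> = lf (\<Sum>b\<in>Basis. (v \<bullet> b) *\<^sub>R b) f \<one>"
        by (simp add: linear_sum[OF linear_lf_fun] linear_cmul[OF linear_lf_fun])
      finally show ?thesis by (simp add: euclidean_representation)
    qed
    have "Y f x = lf v f x" for f x
    proof (cases "sf f")
      case True
      have "Y f x = Y (\<lambda>y. f (x \<otimes> y)) \<one>" using inv[OF True, of x] by simp
      also have "\<dots> = lf v f x" using at1[OF sf_translate(1)[OF True]] lf_at_one[OF True] by simp
      finally show ?thesis .
    next
      case False
      then show ?thesis using nz by (simp add: lf_def)
    qed
    then show "Y \<in> range lf" by (auto simp: fun_eq_iff)
  qed
qed

definition ev :: "'g vfield \<Rightarrow> 'e" where "ev = inv_into UNIV lf"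

lemma ev_lf [simp]: "ev (lf v) = v"
  unfolding ev_def using lf_inj by (intro inv_into_f_f injI) auto

lemma lf_ev: "Y \<in> lie_algebra G A \<Longrightarrow> lf (ev Y) = Y"
  by (auto simp: lie_algebra_eq)

lemma smooth_test_coord_eq:
  assumes "\<And>f. sf f \<Longrightarrow> lf v f \<one> = lf w f \<one>"
  shows "v = w"
  by (metis assms coord_exists coord_at_one_def euclidean_eqI lf_coord)

end

section \<open>Integral curves of left-invariant vector fields\<close>

text \<open>The total derivative at (h, h) is the sum of its values at (h, 0) and (0, h). This
  serves for products in which one parameter moves two factors.\<close>

lemma has_derivative_diagonal:
  fixes H :: "'a::euclidean_space \<times> 'a \<Rightarrow> 'b::real_normed_vector"
  assumes "smooth_on Q H" "open Q" "(a, a) \<in> Q"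
    and 1: "((\<lambda>s. H (s, a)) has_derivative D1) (at a)" and 2: "((\<lambda>t. H (a, t)) has_derivative D2) (at a)"
  shows "((\<lambda>t. H (t, t)) has_derivative (\<lambda>h. D1 h + D2 h)) (at a)"
proof -
  let ?D = "frechet_derivative H (at (a, a))"
  have H: "(H has_derivative ?D) (at (a, a))" by (rule smooth_on_has_derivative[OF assms(1-3)])
  then have lin: "linear ?D" by (rule has_derivative_linear)
  have "((\<lambda>s. (s, a)) has_derivative (\<lambda>h. (h, 0))) (at a)" by (auto intro!: derivative_eq_intros)
  from has_derivative_compose[OF this H] have "D1 = (\<lambda>h. ?D (h, 0))"
    by (rule has_derivative_unique[OF 1])
  moreover have "((\<lambda>s. (a, s)) has_derivative (\<lambda>h. (0, h))) (at a)" by (auto intro!: derivative_eq_intros)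
  from has_derivative_compose[OF this H] have "D2 = (\<lambda>h. ?D (0, h))"
    by (rule has_derivative_unique[OF 2])
  moreover have "((\<lambda>s. (s, s)) has_derivative (\<lambda>h. (h, h))) (at a)" by (auto intro!: derivative_eq_intros)
  from has_derivative_compose[OF this H] have "((\<lambda>t. H (t, t)) has_derivative (\<lambda>h. ?D (h, h))) (at a)" .
  moreover have "?D (h, h) = ?D (h, 0) + ?D (0, h)" for h
    using linear_add[OF lin, of "(h, 0)" "(0, h)"] by simp
  ultimately show ?thesis by simp
qed

context lie_grp begin

definition curve_on :: "real set \<Rightarrow> 'e \<Rightarrow> (real \<Rightarrow> 'g) \<Rightarrow> bool" where
  "curve_on I v \<gamma> \<longleftrightarrow> (\<forall>f. sf f \<longrightarrow> (\<forall>t\<in>I. ((\<lambda>s. f (\<gamma> s)) has_real_derivative lf v f (\<gamma> t)) (at t)))"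

lemma curve_onD: "curve_on I v \<gamma> \<Longrightarrow> sf f \<Longrightarrow> t \<in> I \<Longrightarrow> ((\<lambda>s. f (\<gamma> s)) has_real_derivative lf v f (\<gamma> t)) (at t)"
  by (auto simp: curve_on_def)

lemma curve_on_subset: "curve_on I v \<gamma> \<Longrightarrow> J \<subseteq> I \<Longrightarrow> curve_on J v \<gamma>"
  by (auto simp: curve_on_def)

text \<open>Differentiating along the curve replaces f by the smooth function \<open>lf v f\<close>,
  so the curve equation bootstraps to all orders.\<close>

lemma curve_smooth:
  assumes "open I" "curve_on I v \<gamma>"
  shows "smooth_into I \<gamma>"
proof -
  have "Ck_on k I (\<lambda>t. f (\<gamma> t))" if "sf f" for k f
    using that
  proof (induction k arbitrary: f)
    case 0
    then show ?case using curve_onD[OF assms(2)] assms(1)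
      by (auto simp: continuous_on_eq_continuous_at intro: DERIV_isCont)
  next
    case (Suc k)
    show ?case
    proof (rule Ck_on_SucI[OF assms(1), where f' = "\<lambda>t h. h * lf v f (\<gamma> t)"])
      show "((\<lambda>t. f (\<gamma> t)) has_derivative (\<lambda>h. h * lf v f (\<gamma> t))) (at t)" if "t \<in> I" for t
        using curve_onD[OF assms(2) Suc.prems that] by (simp add: has_field_derivative_def mult_commute_abs)
      fix h :: real
      have "Ck_on k I (\<lambda>t. h *\<^sub>R lf v f (\<gamma> t))"
        by (intro Ck_on_scaleR Ck_on_const assms(1) Suc.IH sf_lf Suc.prems)
      then show "Ck_on k I (\<lambda>t. h * lf v f (\<gamma> t))" by simp
    qed
  qed
  then show ?thesis using assms(1) by (simp add: smooth_into_def smooth_on_def)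
qed

text \<open>Moving k and y by the same right factor \<open>\<xi> t\<close> leaves
  \<open>k \<otimes> inv y\<close> unchanged; the two partial derivatives of this constant must
  cancel.\<close>

lemma lf_inverse_cancel:
  assumes f: "sf f"
  shows "lf v (\<lambda>x. f (x \<otimes> inv y)) k + lf v (\<lambda>x. f (k \<otimes> inv x)) y = 0"
proof -
  let ?H = "\<lambda>p. f (k \<otimes> \<xi> (fst p) \<otimes> inv (y \<otimes> \<xi> (snd p)))"
  have o: "open (Q1 \<times> Q1)" by (intro open_Times open_Q1)
  have "smooth_into (Q1 \<times> Q1) (\<lambda>p. \<xi> (fst p))" "smooth_into (Q1 \<times> Q1) (\<lambda>p. \<xi> (snd p))"
    by (rule smooth_into_compose[OF smooth_xi o smooth_on_linear[OF o bounded_linear_fst]], auto)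
      (rule smooth_into_compose[OF smooth_xi o smooth_on_linear[OF o bounded_linear_snd]], auto)
  then have H: "smooth_on (Q1 \<times> Q1) ?H"
    by (intro smooth_intoD[OF _ f] smooth_into_mult smooth_into_inv smooth_into_const o)
  have f2: "sf (\<lambda>x. f (k \<otimes> inv x))" by (rule sf_translate(3)[OF sf_translate(1)[OF f]])
  have "((\<lambda>t. ?H (t, t)) has_derivative
     (\<lambda>v. lf v (\<lambda>x. f (x \<otimes> inv y)) k + lf v (\<lambda>x. f (k \<otimes> inv x)) y)) (at e1)"
    by (rule has_derivative_diagonal[OF H o])
      (use e1 lf_derivative[OF sf_translate(2)[OF f], of k "inv y"]
         lf_derivative[OF f2, of y] in simp_all)
  moreover have "(\<lambda>t. ?H (t, t)) = (\<lambda>t. f (k \<otimes> inv y))"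
    by (simp add: inv_mult_group m_assoc) (simp add: m_assoc[symmetric] m_assoc[of k])
  ultimately have "((\<lambda>t. f (k \<otimes> inv y)) has_derivative
     (\<lambda>v. lf v (\<lambda>x. f (x \<otimes> inv y)) k + lf v (\<lambda>x. f (k \<otimes> inv x)) y)) (at e1)" by simp
  from has_derivative_unique[OF this has_derivative_const] show ?thesis by meson
qed

text \<open>Left invariance replaces a Gronwall estimate:
  \<open>\<gamma>1 t \<otimes> inv (\<gamma>2 t)\<close> has derivative zero by
  \<open>lf_inverse_cancel\<close>, hence is constant.\<close>

lemma curve_unique:
  assumes I: "open I" "convex I" and c: "curve_on I v \<gamma>1" "curve_on I v \<gamma>2"
    and t0: "t0 \<in> I" "\<gamma>1 t0 = \<gamma>2 t0" and t: "t \<in> I"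
  shows "\<gamma>1 t = \<gamma>2 t"
proof -
  have "f (\<gamma>1 t \<otimes> inv (\<gamma>2 t)) = f \<one>" if f: "sf f" for f
  proof -
    let ?H = "\<lambda>p. f (\<gamma>1 (fst p) \<otimes> inv (\<gamma>2 (snd p)))"
    have o: "open (I \<times> I)" using I(1) by (simp add: open_Times)
    have "smooth_into (I \<times> I) (\<lambda>p. \<gamma>1 (fst p))" "smooth_into (I \<times> I) (\<lambda>p. \<gamma>2 (snd p))"
      by (rule smooth_into_compose[OF curve_smooth[OF I(1) c(1)] o smooth_on_linear[OF o bounded_linear_fst]], auto)
        (rule smooth_into_compose[OF curve_smooth[OF I(1) c(2)] o smooth_on_linear[OF o bounded_linear_snd]], auto)
    then have H: "smooth_on (I \<times> I) ?H"
      by (intro smooth_intoD[OF _ f] smooth_into_mult smooth_into_inv)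
    have d: "((\<lambda>t. f (\<gamma>1 t \<otimes> inv (\<gamma>2 t))) has_derivative (\<lambda>h. 0)) (at s)" if s: "s \<in> I" for s
    proof -
      let ?a = "lf v (\<lambda>x. f (x \<otimes> inv (\<gamma>2 s))) (\<gamma>1 s)" and ?b = "lf v (\<lambda>x. f (\<gamma>1 s \<otimes> inv x)) (\<gamma>2 s)"
      have "((\<lambda>t. ?H (t, t)) has_derivative (\<lambda>h. ?a * h + ?b * h)) (at s)"
        by (rule has_derivative_diagonal[OF H o])
          (use s curve_onD[OF c(1) sf_translate(2)[OF f] s, of "inv (\<gamma>2 s)"]
             curve_onD[OF c(2) sf_translate(3)[OF sf_translate(1)[OF f]] s, of "\<gamma>1 s"]
           in \<open>simp_all add: has_field_derivative_def\<close>)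
      moreover have "(\<lambda>h. ?a * h + ?b * h) = (\<lambda>h. 0)"
        using lf_inverse_cancel[OF f] by (simp add: distrib_right[symmetric])
      ultimately show ?thesis by simp
    qed
    obtain c where c: "\<And>s. s \<in> I \<Longrightarrow> f (\<gamma>1 s \<otimes> inv (\<gamma>2 s)) = c"
      using has_derivative_zero_constant[OF I(2), of "\<lambda>t. f (\<gamma>1 t \<otimes> inv (\<gamma>2 t))"]
        d has_derivative_at_withinI by blast
    show ?thesis using c[OF t] c[OF t0(1)] t0(2) by simp
  qed
  then have "\<gamma>1 t \<otimes> inv (\<gamma>2 t) = \<one>" by (rule smooth_test_separates)
  then show ?thesis
    using inv_equality[of "\<gamma>1 t" "inv (\<gamma>2 t)"] by simp
qed

text \<open>In the chart at \<open>\<one>\<close> the components of the field are its values on the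
  coordinate functions. This gives the right-hand side to which Picard iteration is applied.\<close>

lemma lf_chart_derivative:
  assumes XM: "coord_at_one X M" and f: "sf f" and y: "y \<in> Q1" "\<xi> y \<in> M"
  shows "lf v f (\<xi> y) = frechet_derivative (\<lambda>y. f (\<xi> y)) (at y) (\<Sum>b\<in>Basis. lf v (X b) (\<xi> y) *\<^sub>R b)"
proof (rule lf_unique[OF f])
  have X: "\<And>b. sf (X b)" and M: "open M" "M \<subseteq> fst chart1"
    and XX: "\<And>b y. b \<in> Basis \<Longrightarrow> y \<in> M \<Longrightarrow> X b y = (snd chart1 y - e1) \<bullet> b"
    using XM by (auto simp: coord_at_one_def)
  \<comment> \<open>Near \<open>e1\<close> these are the chart coordinates of
    \<open>\<xi> y \<otimes> \<xi> z\<close>, written with global functions so that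
    \<open>lf_derivative\<close> applies to them.\<close>
  let ?k = "\<lambda>z. e1 + (\<Sum>b\<in>Basis. X b (\<xi> y \<otimes> \<xi> z) *\<^sub>R b)"
  have k: "?k z = snd chart1 (\<xi> y \<otimes> \<xi> z)" if "\<xi> y \<otimes> \<xi> z \<in> M" for z
    using XX[OF _ that] by (simp add: euclidean_representation)
  have ke: "?k e1 = y" using k[of e1] y phi_xi by (simp add: e1)
  have d1: "(?k has_derivative (\<lambda>v. \<Sum>b\<in>Basis. lf v (X b) (\<xi> y) *\<^sub>R b)) (at e1)"
    by (rule has_derivative_eq_rhs, rule has_derivative_add[OF has_derivative_const has_derivative_sum[OF has_derivative_scaleR_left[OF lf_derivative[OF X]]]]) simp
  have "((\<lambda>y. f (\<xi> y)) has_derivative frechet_derivative (\<lambda>y. f (\<xi> y)) (at y)) (at (?k e1))"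
    unfolding ke by (rule smooth_on_has_derivative[OF smooth_intoD[OF smooth_xi f] open_Q1 y(1)])
  from has_derivative_compose[OF d1 this]
  have d: "((\<lambda>z. f (\<xi> (?k z))) has_derivative (\<lambda>v. frechet_derivative (\<lambda>y. f (\<xi> y)) (at y) (\<Sum>b\<in>Basis. lf v (X b) (\<xi> y) *\<^sub>R b))) (at e1)" .
  let ?N = "Q1 \<inter> (\<lambda>z. \<xi> y \<otimes> \<xi> z) -` M"
  have "open ?N"
    by (intro continuous_open_preimage smooth_into_continuous smooth_into_mult smooth_into_const smooth_xi open_Q1 M(1))
  moreover have "e1 \<in> ?N" using e1 y by simp
  ultimately show "((\<lambda>z. f (\<xi> y \<otimes> \<xi> z)) has_derivative (\<lambda>v. frechet_derivative (\<lambda>y. f (\<xi> y)) (at y) (\<Sum>b\<in>Basis. lf v (X b) (\<xi> y) *\<^sub>R b))) (at e1)"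
  proof (rule has_derivative_transform_within_open[OF d])
    fix z assume "z \<in> ?N"
    then have "\<xi> y \<otimes> \<xi> z \<in> M" by simp
    then show "f (\<xi> (?k z)) = f (\<xi> y \<otimes> \<xi> z)" using M(2) by (simp add: k xi_phi subset_iff)
  qed
qed

lemma local_curve:
  obtains \<epsilon> \<gamma> where "\<epsilon> > 0" "\<gamma> 0 = \<one>" "curve_on {-\<epsilon><..<\<epsilon>} v \<gamma>"
proof -
  obtain X M where XM: "coord_at_one X M" by (rule coord_exists)
  then have M: "open M" "\<one> \<in> M" "M \<subseteq> fst chart1" and X: "\<And>b. sf (X b)" by (auto simp: coord_at_one_def)
  define F where "F = (\<lambda>y. \<Sum>b\<in>Basis. lf v (X b) (\<xi> y) *\<^sub>R b)"
  let ?Q = "Q1 \<inter> \<xi> -` M"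
  have oQ: "open ?Q"
    by (rule continuous_open_preimage[OF smooth_into_continuous[OF smooth_xi] open_Q1 M(1)])
  have "smooth_on Q1 F" unfolding F_def
    by (intro smooth_on_sum smooth_on_scaleR smooth_on_const open_Q1 smooth_on_lf smooth_xi X)
  then have F: "Ck_on 1 ?Q F"
    using smooth_on_subset[OF _ _ open_Q1 oQ] smooth_onD by blast
  have eQ: "e1 \<in> ?Q" using e1 M(2) by simp
  obtain \<epsilon> y where y: "\<epsilon> > 0" "y 0 = e1"
    "\<And>t. \<bar>t\<bar> < \<epsilon> \<Longrightarrow> y t \<in> ?Q \<and> (y has_vector_derivative F (y t)) (at t)"
    by (rule picard_local_solution[OF F oQ eQ]) (rule that)
  have "curve_on {-\<epsilon><..<\<epsilon>} v (\<lambda>t. \<xi> (y t))"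
    unfolding curve_on_def
  proof (intro allI impI ballI)
    fix f t assume f: "sf f" and "t \<in> {-\<epsilon><..<\<epsilon>}"
    then have t: "\<bar>t\<bar> < \<epsilon>" by auto
    have yt: "y t \<in> Q1" "\<xi> (y t) \<in> M" using y(3)[OF t] by auto
    have d: "((\<lambda>y. f (\<xi> y)) has_derivative frechet_derivative (\<lambda>y. f (\<xi> y)) (at (y t))) (at (y t))"
      by (rule smooth_on_has_derivative[OF smooth_intoD[OF smooth_xi f] open_Q1 yt(1)])
    have "(y has_derivative (\<lambda>h. h *\<^sub>R F (y t))) (at t)"
      using y(3)[OF t] by (simp add: has_vector_derivative_def)
    from has_derivative_compose[OF this d]
    have "((\<lambda>t. f (\<xi> (y t))) has_derivative (\<lambda>h. frechet_derivative (\<lambda>y. f (\<xi> y)) (at (y t)) (h *\<^sub>R F (y t)))) (at t)" .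
    moreover have "frechet_derivative (\<lambda>y. f (\<xi> y)) (at (y t)) (h *\<^sub>R F (y t)) = lf v f (\<xi> (y t)) * h" for h
      using linear_cmul[OF has_derivative_linear[OF d]] lf_chart_derivative[OF XM f yt, of v]
      by (simp add: F_def)
    ultimately show "((\<lambda>s. f (\<xi> (y s))) has_real_derivative lf v f (\<xi> (y t))) (at t)"
      by (simp add: has_field_derivative_def)
  qed
  then show ?thesis using y e1 by (intro that[of \<epsilon> "\<lambda>t. \<xi> (y t)"]) auto
qed

lemma integral_curve_lf: "integral_curve A (lf v) \<gamma> \<longleftrightarrow> curve_on UNIV v \<gamma>"
  by (simp add: integral_curve_def curve_on_def)

lemma curve_on_translate: "curve_on I v \<gamma> \<Longrightarrow> curve_on I v (\<lambda>t. x \<otimes> \<gamma> t)"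
  unfolding curve_on_def
proof (intro allI impI ballI)
  fix f t assume c: "\<forall>f. sf f \<longrightarrow> (\<forall>t\<in>I. ((\<lambda>s. f (\<gamma> s)) has_real_derivative lf v f (\<gamma> t)) (at t))"
    and f: "sf f" and t: "t \<in> I"
  have "((\<lambda>s. f (x \<otimes> \<gamma> s)) has_real_derivative lf v (\<lambda>y. f (x \<otimes> y)) (\<gamma> t)) (at t)"
    using c sf_translate(1)[OF f] t by blast
  then show "((\<lambda>s. f (x \<otimes> \<gamma> s)) has_real_derivative lf v f (x \<otimes> \<gamma> t)) (at t)"
    by (simp add: lf_left_invariant[OF f])
qed

lemma curve_on_rescale:
  assumes "curve_on I v \<gamma>" "\<And>t. t \<in> J \<Longrightarrow> a * t + b \<in> I"
  shows "curve_on J (a *\<^sub>R v) (\<lambda>t. \<gamma> (a * t + b))"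
  unfolding curve_on_def
proof (intro allI impI ballI)
  fix f t assume f: "sf f" and t: "t \<in> J"
  have "((\<lambda>t. f (\<gamma> (a * t + b))) has_real_derivative lf v f (\<gamma> (a * t + b)) * a) (at t)"
    by (rule DERIV_chain2[where f = "\<lambda>s. f (\<gamma> s)" and g = "\<lambda>t. a * t + b", OF curve_onD[OF assms(1) f assms(2)[OF t]]]) (auto intro!: derivative_eq_intros)
  then show "((\<lambda>t. f (\<gamma> (a * t + b))) has_real_derivative lf (a *\<^sub>R v) f (\<gamma> (a * t + b))) (at t)"
    by (simp add: linear_cmul[OF linear_lf_fun] mult.commute)
qed

end

declare One_nat_def [simp del]

section \<open>Horizontal one-parameter subgroups and dilations\<close>

locale carnot = lie_grp G A
  for G :: "'g::{second_countable_topology, t2_space} monoid" (structure)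
    and A :: "('g, 'e::euclidean_space) atlas" +
  fixes s :: nat and V :: "nat \<Rightarrow> 'g vfield set" and \<delta> :: "real \<Rightarrow> 'g \<Rightarrow> 'g"
  assumes carnot: "carnot_group G A s V" and dil: "dilations G A (V 1) \<delta>"
begin

lemma V1: "subspace (V 1)" "V 1 \<subseteq> lie_algebra G A"
  using carnot by (auto simp: carnot_group_def stratification_def)

lemma V1_lf: "Y \<in> V 1 \<Longrightarrow> lf (ev Y) = Y"
  using V1(2) lf_ev by blast

lemma dil_hom: "t > 0 \<Longrightarrow> \<delta> t (x \<otimes> y) = \<delta> t x \<otimes> \<delta> t y"
  using dil by (auto simp: dilations_def iso_def hom_def)

lemma dil_one: "t > 0 \<Longrightarrow> \<delta> t \<one> = \<one>"
  using dil_hom[of t \<one> \<one>] by (metis UNIV_I carrier_UNIV l_cancel_one one_closed)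

lemma dil_inv: "t > 0 \<Longrightarrow> \<delta> t (inv x) = inv (\<delta> t x)"
  using dil_hom[of t "inv x" x] dil_one[of t] by (metis UNIV_I carrier_UNIV inv_equality l_inv)

lemma dil_smooth: "t > 0 \<Longrightarrow> smooth_map A A (\<delta> t)"
  using dil by (auto simp: dilations_def)

lemma dil_continuous:
  assumes "t > 0"
  shows "continuous_on S (\<delta> t)" "continuous_on S (inv_into UNIV (\<delta> t))"
proof -
  from assms have "smooth_map A A (\<delta> t)" "smooth_map A A (inv_into UNIV (\<delta> t))"
    using dil unfolding dilations_def by blast+
  then show "continuous_on S (\<delta> t)" "continuous_on S (inv_into UNIV (\<delta> t))"
    using continuous_on_subset[OF _ subset_UNIV] unfolding smooth_map_def by blast+
qed

lemma dil_field: "t > 0 \<Longrightarrow> Y \<in> V 1 \<Longrightarrow> sf f \<Longrightarrow> Y (\<lambda>x. f (\<delta> t x)) x = t * Y f (\<delta> t x)"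
  using dil by (simp add: dilations_def)

text \<open>The differential of \<open>\<delta> T\<close> multiplies horizontal fields by T, so
  image curves run T times as fast; slowing down time then returns a curve of the original
  field.\<close>

lemma curve_on_dil:
  assumes v: "lf v \<in> V 1" and T: "T > 0" and c: "curve_on I v \<gamma>"
  shows "curve_on I (T *\<^sub>R v) (\<lambda>t. \<delta> T (\<gamma> t))"
  unfolding curve_on_def
proof (intro allI impI ballI)
  fix f t assume f: "sf f" and t: "t \<in> I"
  have "((\<lambda>s. f (\<delta> T (\<gamma> s))) has_real_derivative lf v (\<lambda>x. f (\<delta> T x)) (\<gamma> t)) (at t)"
    by (rule curve_onD[OF c sf_smooth_map[OF dil_smooth[OF T] f] t])
  then show "((\<lambda>s. f (\<delta> T (\<gamma> s))) has_real_derivative lf (T *\<^sub>R v) f (\<delta> T (\<gamma> t))) (at t)"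
    using dil_field[OF T v f] by (simp add: linear_cmul[OF linear_lf_fun])
qed

text \<open>The dilations extend a local integral curve of a horizontal field to all times.\<close>

lemma global_curve:
  assumes v: "lf v \<in> V 1"
  obtains \<gamma> where "\<gamma> 0 = \<one>" "curve_on UNIV v \<gamma>"
proof -
  obtain \<epsilon> \<gamma> where g: "\<epsilon> > 0" "\<gamma> 0 = \<one>" "curve_on {-\<epsilon><..<\<epsilon>} v \<gamma>" by (rule local_curve)
  \<comment> \<open>The factor 1/T from the time change cancels the factor T from the dilation, so
    \<open>c T\<close> again follows v, now for |t| < T\<epsilon>.\<close>
  define c where "c = (\<lambda>T t. \<delta> T (\<gamma> (t / T)))"
  have c: "curve_on {-(T*\<epsilon>)<..<T*\<epsilon>} v (c T)" if T: "T > 0" for T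
  proof -
    have "curve_on {-(T*\<epsilon>)<..<T*\<epsilon>} ((1/T) *\<^sub>R v) (\<lambda>t. \<gamma> ((1/T) * t + 0))"
      by (rule curve_on_rescale[OF g(3)]) (use T in \<open>auto simp: field_simps\<close>)
    moreover have "lf ((1/T) *\<^sub>R v) \<in> V 1"
      using subspace_scale[OF V1(1) v] by (simp add: linear_cmul[OF linear_lf])
    ultimately have "curve_on {-(T*\<epsilon>)<..<T*\<epsilon>} (T *\<^sub>R (1/T) *\<^sub>R v) (\<lambda>t. \<delta> T (\<gamma> ((1/T) * t + 0)))"
      using curve_on_dil[OF _ T] by blast
    then show ?thesis using T by (simp add: c_def)
  qed
  have c0: "c T 0 = \<one>" if "T > 0" for T using g(2) that by (simp add: c_def dil_one)
  have cc: "c T t = c T' t" if "T > 0" "T' > 0" "\<bar>t\<bar> < T * \<epsilon>" "\<bar>t\<bar> < T' * \<epsilon>" for T T' t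
  proof -
    let ?m = "min (T * \<epsilon>) (T' * \<epsilon>)"
    have "0 < ?m" using that g(1) by simp
    then show ?thesis
      by (intro curve_unique[of "{-?m<..<?m}" v "c T" "c T'" 0 t] curve_on_subset[OF c] that)
        (use that c0 in auto)
  qed
  \<comment> \<open>By \<open>cc\<close> every T with |t| < T\<epsilon> gives the same value; this T
    satisfies the inequality.\<close>
  define \<Gamma> where "\<Gamma> = (\<lambda>t. c (\<bar>t\<bar> / \<epsilon> + 1) t)"
  have \<Gamma>: "\<Gamma> t = c T t" if "T > 0" "\<bar>t\<bar> < T * \<epsilon>" for T t
    unfolding \<Gamma>_def by (rule cc) (use that g(1) in \<open>auto simp: field_simps add_pos_nonneg\<close>)
  have "curve_on UNIV v \<Gamma>"
    unfolding curve_on_def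
  proof (intro allI impI ballI)
    fix f t assume f: "sf f"
    have "\<bar>t\<bar> / \<epsilon> + 1 > 0 \<and> \<bar>t\<bar> < (\<bar>t\<bar> / \<epsilon> + 1) * \<epsilon>"
      using g(1) by (auto simp: field_simps add_pos_nonneg)
    then obtain T where T: "T > 0" "\<bar>t\<bar> < T * \<epsilon>" by blast
    have "((\<lambda>s. f (c T s)) has_real_derivative lf v f (c T t)) (at t)"
      by (rule curve_onD[OF c[OF T(1)] f]) (use T(2) in auto)
    then have "((\<lambda>s. f (\<Gamma> s)) has_real_derivative lf v f (c T t)) (at t)"
      by (rule has_field_derivative_transform_within_open[of _ _ _ "{-(T * \<epsilon>)<..<T * \<epsilon>}"])
        (use T(2) \<Gamma>[OF T(1)] in auto)
    then show "((\<lambda>s. f (\<Gamma> s)) has_real_derivative lf v f (\<Gamma> t)) (at t)"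
      using \<Gamma>[OF T] by simp
  qed
  moreover have "\<Gamma> 0 = \<one>" using c0 by (simp add: \<Gamma>_def)
  ultimately show ?thesis by (intro that)
qed

definition flow :: "'g vfield \<Rightarrow> real \<Rightarrow> 'g" where
  "flow Y = (SOME \<gamma>. \<gamma> 0 = \<one> \<and> curve_on UNIV (ev Y) \<gamma>)"

lemma flow:
  assumes "Y \<in> V 1"
  shows "flow Y 0 = \<one>" "curve_on UNIV (ev Y) (flow Y)"
proof -
  have "lf (ev Y) \<in> V 1" using assms by (simp add: V1_lf)
  then obtain \<gamma> where "\<gamma> 0 = \<one>" "curve_on UNIV (ev Y) \<gamma>" by (rule global_curve)
  then have "\<exists>\<gamma>. \<gamma> 0 = \<one> \<and> curve_on UNIV (ev Y) \<gamma>" by blast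
  from someI_ex[OF this] show "flow Y 0 = \<one>" "curve_on UNIV (ev Y) (flow Y)" by (auto simp: flow_def)
qed

lemma flow_unique:
  assumes "Y \<in> V 1" "curve_on UNIV (ev Y) \<gamma>" "\<gamma> 0 = x"
  shows "\<gamma> t = x \<otimes> flow Y t"
  by (rule curve_unique[OF open_UNIV convex_UNIV assms(2) curve_on_translate[OF flow(2)[OF assms(1)]], of 0])
    (use flow(1)[OF assms(1)] assms(3) in auto)

lemma V1_scale: "Y \<in> V 1 \<Longrightarrow> t *\<^sub>R Y \<in> V 1"
  using V1(1) by (rule subspace_scale)

lemma ev_scale: "Y \<in> V 1 \<Longrightarrow> ev (t *\<^sub>R Y) = t *\<^sub>R ev Y"
  using V1_lf[of Y] linear_cmul[OF linear_lf, of t "ev Y"] by (metis ev_lf)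

lemma flow_scale: "Y \<in> V 1 \<Longrightarrow> flow (a *\<^sub>R Y) t = flow Y (a * t)"
proof -
  assume Y: "Y \<in> V 1"
  have "curve_on UNIV (a *\<^sub>R ev Y) (\<lambda>t. flow Y (a * t + 0))"
    by (rule curve_on_rescale[OF flow(2)[OF Y]]) simp
  then show ?thesis
    using flow_unique[OF V1_scale[OF Y, of a], of "\<lambda>t. flow Y (a * t)" \<one> t] flow(1)[OF Y]
    by (simp add: ev_scale[OF Y])
qed

lemma flow_add: "Y \<in> V 1 \<Longrightarrow> flow Y (a + b) = flow Y a \<otimes> flow Y b"
proof -
  assume Y: "Y \<in> V 1"
  have "curve_on UNIV (1 *\<^sub>R ev Y) (\<lambda>t. flow Y (1 * t + a))"
    by (rule curve_on_rescale[OF flow(2)[OF Y]]) simp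
  then show ?thesis
    using flow_unique[OF Y, of "\<lambda>t. flow Y (t + a)" "flow Y a" b] by (simp add: add.commute)
qed

lemma flow_minus: "Y \<in> V 1 \<Longrightarrow> flow Y (- a) = inv (flow Y a)"
  using flow_add[of Y "-a" a] flow(1)[of Y] by (simp add: inv_equality)

lemma dil_flow: "Y \<in> V 1 \<Longrightarrow> T > 0 \<Longrightarrow> \<delta> T (flow Y t) = flow Y (T * t)"
proof -
  assume Y: "Y \<in> V 1" and T: "T > 0"
  have "curve_on UNIV (T *\<^sub>R ev Y) (\<lambda>t. \<delta> T (flow Y t))"
    by (rule curve_on_dil[OF _ T flow(2)[OF Y]]) (simp add: V1_lf Y)
  then show ?thesis
    using flow_unique[OF V1_scale[OF Y, of T], of "\<lambda>t. \<delta> T (flow Y t)" \<one> t] flow(1)[OF Y] T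
    by (simp add: ev_scale[OF Y] dil_one flow_scale[OF Y])
qed

text \<open>Existence and uniqueness of integral curves make the definite description in
  \<open>lie_exp\<close> meaningful on \<open>V 1\<close>.\<close>

lemma lie_exp_flow:
  assumes Y: "Y \<in> V 1"
  shows "lie_exp G A Y = flow Y 1"
  unfolding lie_exp_def
proof (rule the_equality)
  have eq: "integral_curve A Y \<gamma> \<longleftrightarrow> curve_on UNIV (ev Y) \<gamma>" for \<gamma>
    using integral_curve_lf[of "ev Y"] by (simp add: V1_lf[OF Y])
  then show "\<exists>\<gamma>. integral_curve A Y \<gamma> \<and> \<gamma> 0 = \<one> \<and> \<gamma> 1 = flow Y 1"
    using flow[OF Y] by blast
  show "g = flow Y 1" if "\<exists>\<gamma>. integral_curve A Y \<gamma> \<and> \<gamma> 0 = \<one> \<and> \<gamma> 1 = g" for g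
  proof -
    from that obtain \<gamma> where g: "integral_curve A Y \<gamma>" "\<gamma> 0 = \<one>" "\<gamma> 1 = g" by blast
    then have "curve_on UNIV (ev Y) \<gamma>" by (simp add: eq)
    then show ?thesis using flow_unique[OF Y, of \<gamma> \<one> 1] g by simp
  qed
qed

lemma flow_smooth: "Y \<in> V 1 \<Longrightarrow> smooth_into UNIV (flow Y)"
  using curve_smooth[OF open_UNIV flow(2)] .

lemma flow_derivative:
  assumes "Y \<in> V 1" "sf f"
  shows "((\<lambda>t. f (x \<otimes> flow Y t)) has_real_derivative Y f (x \<otimes> flow Y t)) (at t)"
  using curve_onD[OF curve_on_translate[OF flow(2)[OF assms(1)]] assms(2) UNIV_I] V1_lf[OF assms(1)] by simp

end

section \<open>Horizontal curves\<close>

lemma has_integral_double_speed: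
  fixes F :: "real \<Rightarrow> real"
  assumes "(F has_integral i) {a..b}" "a \<le> b"
  shows "((\<lambda>s. 2 * F (2 * s + c)) has_integral i) {(a - c) / 2..(b - c) / 2}"
proof -
  have "((\<lambda>s. F (2 *\<^sub>R s + c)) has_integral (1 / \<bar>2\<bar> ^ DIM(real)) *\<^sub>R i) ((\<lambda>s. (1/2) *\<^sub>R s + - ((1/2) *\<^sub>R c)) ` cbox a b)"
    by (rule has_integral_affinity) (use assms in auto)
  moreover have "(\<lambda>s. (1/2) *\<^sub>R s + - ((1/2) *\<^sub>R c)) ` cbox a b = {(a - c) / 2..(b - c) / 2}"
  proof (intro equalityI subsetI)
    fix x assume "x \<in> {(a - c) / 2..(b - c) / 2}"
    then show "x \<in> (\<lambda>s. (1/2) *\<^sub>R s + - ((1/2) *\<^sub>R c)) ` cbox a b"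
      by (intro image_eqI[of _ _ "2 * x + c"]) (auto simp: field_simps)
  qed (auto simp: field_simps)
  ultimately have "((\<lambda>s. F (2 * s + c)) has_integral i / 2) {(a - c) / 2..(b - c) / 2}" by simp
  from has_integral_mult_right[OF this, of 2] show ?thesis by simp
qed

lemma concat_integral:
  fixes F1 F2 :: "real \<Rightarrow> real"
  assumes 1: "F1 absolutely_integrable_on {0..1}" and 2: "F2 absolutely_integrable_on {0..1}"
  defines "F \<equiv> \<lambda>s. if s \<le> 1/2 then 2 * F1 (2 * s) else 2 * F2 (2 * s - 1)"
  shows "F absolutely_integrable_on {0..1}"
    and "0 \<le> t \<Longrightarrow> t \<le> 1/2 \<Longrightarrow> integral {0..t} F = integral {0..2 * t} F1"
    and "1/2 \<le> t \<Longrightarrow> t \<le> 1 \<Longrightarrow> integral {0..t} F = integral {0..1} F1 + integral {0..2 * t - 1} F2"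
proof -
  \<comment> \<open>This fact and the next are stated for arbitrary integrands, since absolute
    integrability needs them again for the norms of F1 and F2.\<close>
  have A: "((\<lambda>s. if s \<le> 1/2 then 2 * H1 (2 * s) else 2 * H2 (2 * s - 1)) has_integral integral {0..2 * t} H1) {0..t}"
    if "H1 integrable_on {0..1}" "0 \<le> t" "t \<le> 1/2" for H1 H2 :: "real \<Rightarrow> real" and t
  proof -
    have "H1 integrable_on {0..2 * t}"
      by (rule integrable_on_subinterval[OF that(1)]) (use that in auto)
    then have "(H1 has_integral integral {0..2 * t} H1) {0..2 * t}" by (rule integrable_integral)
    from has_integral_double_speed[OF this, of 0] that
    have "((\<lambda>s. 2 * H1 (2 * s)) has_integral integral {0..2 * t} H1) {0..t}" by simp
    then show ?thesis by (rule has_integral_eq[rotated]) (use that in auto)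
  qed
  have B: "((\<lambda>s. if s \<le> 1/2 then 2 * H1 (2 * s) else 2 * H2 (2 * s - 1)) has_integral
      integral {0..1} H1 + integral {0..2 * t - 1} H2) {0..t}"
    if "H1 integrable_on {0..1}" "H2 integrable_on {0..1}" "1/2 \<le> t" "t \<le> 1" for H1 H2 :: "real \<Rightarrow> real" and t
  proof -
    have "H2 integrable_on {0..2 * t - 1}"
      by (rule integrable_on_subinterval[OF that(2)]) (use that in auto)
    then have "(H2 has_integral integral {0..2 * t - 1} H2) {0..2 * t - 1}" by (rule integrable_integral)
    from has_integral_double_speed[OF this, of "-1"] that
    have "((\<lambda>s. 2 * H2 (2 * s - 1)) has_integral integral {0..2 * t - 1} H2) {1/2..t}" by simp
    \<comment> \<open>At s = 1/2 the first branch is taken, so the integrands may differ at this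
      single point.\<close>
    then have "((\<lambda>s. if s \<le> 1/2 then 2 * H1 (2 * s) else 2 * H2 (2 * s - 1)) has_integral
      integral {0..2 * t - 1} H2) {1/2..t}"
      by (rule has_integral_spike_finite[rotated 2, of _ _ _ "{1/2}"]) auto
    with A[OF that(1), of "1/2" H2] show ?thesis
      using that by (intro has_integral_combine[of 0 "1/2" t]) auto
  qed
  note i1 = set_lebesgue_integral_eq_integral(1)[OF 1] and i2 = set_lebesgue_integral_eq_integral(1)[OF 2]
  show "0 \<le> t \<Longrightarrow> t \<le> 1/2 \<Longrightarrow> integral {0..t} F = integral {0..2 * t} F1"
    unfolding F_def by (rule integral_unique[OF A[OF i1]])
  show "1/2 \<le> t \<Longrightarrow> t \<le> 1 \<Longrightarrow> integral {0..t} F = integral {0..1} F1 + integral {0..2 * t - 1} F2"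
    unfolding F_def by (rule integral_unique[OF B[OF i1 i2]])
  have n1: "(\<lambda>s. norm (F1 s)) integrable_on {0..1}" and n2: "(\<lambda>s. norm (F2 s)) integrable_on {0..1}"
    using 1 2 by (auto simp: absolutely_integrable_on_def)
  have "F integrable_on {0..1}" unfolding F_def using B[OF i1 i2, of 1] by (auto simp: integrable_on_def)
  moreover have "(\<lambda>s. norm (F s)) = (\<lambda>s. if s \<le> 1/2 then 2 * norm (F1 (2 * s)) else 2 * norm (F2 (2 * s - 1)))"
    by (auto simp: F_def abs_mult fun_eq_iff)
  then have "(\<lambda>s. norm (F s)) integrable_on {0..1}"
    using B[OF n1 n2, of 1] by (auto simp: integrable_on_def)
  ultimately show "F absolutely_integrable_on {0..1}" by (simp add: absolutely_integrable_on_def)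
qed

section \<open>Lengths of horizontal curves\<close>

locale carnot_metric = carnot G A s V \<delta>
  for G :: "'g::{second_countable_topology, t2_space} monoid" (structure)
    and A :: "('g, 'e::euclidean_space) atlas"
    and s :: nat and V :: "nat \<Rightarrow> 'g vfield set" and \<delta> :: "real \<Rightarrow> 'g \<Rightarrow> 'g" +
  fixes h :: "'g vfield \<Rightarrow> 'g vfield \<Rightarrow> real"
  assumes h: "scalar_product_on (V 1) h"
begin

lemma V1_zero: "0 \<in> V 1" using V1(1) by (rule subspace_0)

lemma h_lin: "X \<in> V 1 \<Longrightarrow> Y \<in> V 1 \<Longrightarrow> Z \<in> V 1 \<Longrightarrow> h (a *\<^sub>R X + b *\<^sub>R Y) Z = a * h X Z + b * h Y Z"
  and h_sym: "X \<in> V 1 \<Longrightarrow> Y \<in> V 1 \<Longrightarrow> h X Y = h Y X"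
  and h_pos: "X \<in> V 1 \<Longrightarrow> X \<noteq> 0 \<Longrightarrow> h X X > 0"
  using h by (auto simp: scalar_product_on_def)

lemma h_scale: "X \<in> V 1 \<Longrightarrow> Y \<in> V 1 \<Longrightarrow> h (a *\<^sub>R X) Y = a * h X Y"
  using h_lin[of X X Y a 0] by simp

lemma h_zero: "Y \<in> V 1 \<Longrightarrow> h 0 Y = 0"
  using h_scale[OF V1_zero, of Y 0] by simp

lemma h_scale2: "X \<in> V 1 \<Longrightarrow> h (a *\<^sub>R X) (a *\<^sub>R X) = a\<^sup>2 * h X X"
  using h_scale[of X "a *\<^sub>R X" a] h_sym[of X "a *\<^sub>R X"] h_scale[of X X a] V1_scale[of X a]
  by (simp add: power2_eq_square)

lemma h_nonneg: "X \<in> V 1 \<Longrightarrow> h X X \<ge> 0"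
  using h_pos[of X] h_zero[OF V1_zero] by (cases "X = 0") auto

lemma sqrt_h_scale: "X \<in> V 1 \<Longrightarrow> a \<ge> 0 \<Longrightarrow> sqrt (h (a *\<^sub>R X) (a *\<^sub>R X)) = a * sqrt (h X X)"
  by (simp add: h_scale2 real_sqrt_mult)

lemma h_sum: "finite B \<Longrightarrow> (\<And>b. b \<in> B \<Longrightarrow> X b \<in> V 1) \<Longrightarrow> Z \<in> V 1 \<Longrightarrow>
    h (\<Sum>b\<in>B. c b *\<^sub>R X b) Z = (\<Sum>b\<in>B. c b * h (X b) Z)"
proof (induction B rule: finite_induct)
  case empty
  show ?case unfolding sum.empty by (rule h_zero) fact
next
  case (insert b B)
  have "(\<Sum>b\<in>B. c b *\<^sub>R X b) \<in> V 1"
    by (intro subspace_sum V1(1) V1_scale) (use insert in auto)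
  then have "h (c b *\<^sub>R X b + 1 *\<^sub>R (\<Sum>b\<in>B. c b *\<^sub>R X b)) Z = c b * h (X b) Z + 1 * h (\<Sum>b\<in>B. c b *\<^sub>R X b) Z"
    using insert by (intro h_lin) auto
  moreover have "h (\<Sum>b\<in>B. c b *\<^sub>R X b) Z = (\<Sum>b\<in>B. c b * h (X b) Z)" using insert by blast
  ultimately show ?case by (simp only: sum.insert[OF insert.hyps(1,2)] scaleR_one mult_1_left)
qed

text \<open>Lengths of connecting curves are kept as a relation and the infimum is taken later,
  because it is informative only once connecting curves are known to exist.\<close>

definition hc :: "'g \<Rightarrow> 'g \<Rightarrow> real \<Rightarrow> bool" where
  "hc x y l \<longleftrightarrow> (\<exists>\<gamma> u. horizontal_curve A (V 1) \<gamma> u \<and> \<gamma> 0 = x \<and> \<gamma> 1 = y \<and>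
     (\<lambda>s. sqrt (h (u s) (u s))) absolutely_integrable_on {0..1} \<and>
     l = integral {0..1} (\<lambda>s. sqrt (h (u s) (u s))))"

lemma carnot_distance_hc: "carnot_distance A (V 1) h x y = Inf {l. hc x y l}"
  unfolding carnot_distance_def hc_def by (rule arg_cong[where f = Inf]) blast

lemma hc_nonneg: "hc x y l \<Longrightarrow> l \<ge> 0"
  by (auto simp: hc_def horizontal_curve_def h_nonneg intro!: integral_nonneg set_lebesgue_integral_eq_integral(1))

lemma hcI:
  fixes u :: "real \<Rightarrow> 'g vfield" and \<gamma> :: "real \<Rightarrow> 'g"
  assumes "\<And>s. s \<in> {0..1} \<Longrightarrow> u s \<in> V 1"
    "\<And>f. sf f \<Longrightarrow> (\<lambda>s. u s f (\<gamma> s)) absolutely_integrable_on {0..1}"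
    "\<And>f t. sf f \<Longrightarrow> t \<in> {0..1} \<Longrightarrow> f (\<gamma> t) = f (\<gamma> 0) + integral {0..t} (\<lambda>s. u s f (\<gamma> s))"
    "\<gamma> 0 = x" "\<gamma> 1 = y"
    "(\<lambda>s. sqrt (h (u s) (u s))) absolutely_integrable_on {0..1}"
    "l = integral {0..1} (\<lambda>s. sqrt (h (u s) (u s)))"
  shows "hc x y l"
  unfolding hc_def horizontal_curve_def using assms by (intro exI[of _ \<gamma>] exI[of _ u]) simp

lemma horizontal_curveD:
  assumes "horizontal_curve A (V 1) \<gamma> u"
  shows "\<And>s. s \<in> {0..1} \<Longrightarrow> u s \<in> V 1"
    "\<And>f. sf f \<Longrightarrow> (\<lambda>s. u s f (\<gamma> s)) absolutely_integrable_on {0..1}"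
    "\<And>f t. sf f \<Longrightarrow> t \<in> {0..1} \<Longrightarrow> f (\<gamma> t) = f (\<gamma> 0) + integral {0..t} (\<lambda>s. u s f (\<gamma> s))"
  using assms unfolding horizontal_curve_def by blast+

lemma V1_left_invariant: "Y \<in> V 1 \<Longrightarrow> sf f \<Longrightarrow> Y (\<lambda>x. f (g \<otimes> x)) x = Y f (g \<otimes> x)"
  using V1_lf lf_left_invariant by metis

lemma hc_translate:
  assumes "hc x y l" shows "hc (g \<otimes> x) (g \<otimes> y) l"
proof -
  from assms obtain \<gamma> u where c0: "horizontal_curve A (V 1) \<gamma> u" "\<gamma> 0 = x" "\<gamma> 1 = y"
    "(\<lambda>s. sqrt (h (u s) (u s))) absolutely_integrable_on {0..1}"
    "l = integral {0..1} (\<lambda>s. sqrt (h (u s) (u s)))" unfolding hc_def by blast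
  note c = horizontal_curveD[OF c0(1)] c0(2-5)
  show ?thesis
  proof (rule hcI[of u "\<lambda>s. g \<otimes> \<gamma> s"])
    have e: "u s f (g \<otimes> \<gamma> s) = u s (\<lambda>x. f (g \<otimes> x)) (\<gamma> s)" if "sf f" "s \<in> {0..1}" for f s
      using V1_left_invariant[OF c(1)[OF that(2)] that(1)] by simp
    show "(\<lambda>s. u s f (g \<otimes> \<gamma> s)) absolutely_integrable_on {0..1}" if "sf f" for f
      by (rule absolutely_integrable_spike[OF c(2)[OF sf_translate(1)[OF that]], of "{}"]) (use e[OF that] in auto)
    show "f (g \<otimes> \<gamma> t) = f (g \<otimes> \<gamma> 0) + integral {0..t} (\<lambda>s. u s f (g \<otimes> \<gamma> s))" if "sf f" "t \<in> {0..1}" for f t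
    proof -
      have "integral {0..t} (\<lambda>s. u s f (g \<otimes> \<gamma> s)) = integral {0..t} (\<lambda>s. u s (\<lambda>x. f (g \<otimes> x)) (\<gamma> s))"
        by (rule integral_cong) (use e[OF that(1)] that(2) in auto)
      then show ?thesis using c(3)[OF sf_translate(1)[OF that(1)] that(2)] by simp
    qed
  qed (use c in auto)
qed

lemma hc_dil:
  assumes T: "T > 0" and "hc x y l" shows "hc (\<delta> T x) (\<delta> T y) (T * l)"
proof -
  from assms(2) obtain \<gamma> u where c0: "horizontal_curve A (V 1) \<gamma> u" "\<gamma> 0 = x" "\<gamma> 1 = y"
    "(\<lambda>s. sqrt (h (u s) (u s))) absolutely_integrable_on {0..1}"
    "l = integral {0..1} (\<lambda>s. sqrt (h (u s) (u s)))" unfolding hc_def by blast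
  note c = horizontal_curveD[OF c0(1)] c0(2-5)
  show ?thesis
  proof (rule hcI[of "\<lambda>s. T *\<^sub>R u s" "\<lambda>s. \<delta> T (\<gamma> s)"])
    have e: "(T *\<^sub>R u s) f (\<delta> T (\<gamma> s)) = u s (\<lambda>x. f (\<delta> T x)) (\<gamma> s)" if "sf f" "s \<in> {0..1}" for f s
      using dil_field[OF T c(1)[OF that(2)] that(1)] by (simp add: scaleR_fun_def)
    note sfd = sf_smooth_map[OF dil_smooth[OF T]]
    show "(\<lambda>s. (T *\<^sub>R u s) f (\<delta> T (\<gamma> s))) absolutely_integrable_on {0..1}" if "sf f" for f
      by (rule absolutely_integrable_spike[OF c(2)[OF sfd[OF that]], of "{}"]) (use e[OF that] in auto)
    show "f (\<delta> T (\<gamma> t)) = f (\<delta> T (\<gamma> 0)) + integral {0..t} (\<lambda>s. (T *\<^sub>R u s) f (\<delta> T (\<gamma> s)))" if "sf f" "t \<in> {0..1}" for f t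
    proof -
      have "integral {0..t} (\<lambda>s. (T *\<^sub>R u s) f (\<delta> T (\<gamma> s))) = integral {0..t} (\<lambda>s. u s (\<lambda>x. f (\<delta> T x)) (\<gamma> s))"
        by (rule integral_cong) (use e[OF that(1)] that(2) in auto)
      then show ?thesis using c(3)[OF sfd[OF that(1)] that(2)] by simp
    qed
    have e2: "sqrt (h (T *\<^sub>R u s) (T *\<^sub>R u s)) = T * sqrt (h (u s) (u s))" if "s \<in> {0..1}" for s
      using sqrt_h_scale[OF c(1)[OF that]] T by simp
    show "(\<lambda>s. sqrt (h (T *\<^sub>R u s) (T *\<^sub>R u s))) absolutely_integrable_on {0..1}"
      by (rule absolutely_integrable_spike[OF absolutely_integrable_scaleR_left[OF c(6), of T], of "{}"]) (use e2 in auto)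
    have "integral {0..1} (\<lambda>s. sqrt (h (T *\<^sub>R u s) (T *\<^sub>R u s))) = integral {0..1} (\<lambda>s. T * sqrt (h (u s) (u s)))"
      by (rule integral_cong) (rule e2)
    then show "T * l = integral {0..1} (\<lambda>s. sqrt (h (T *\<^sub>R u s) (T *\<^sub>R u s)))" using c(7) by simp
  qed (use c V1_scale in auto)
qed

lemma hc_trans:
  assumes "hc x y a" "hc y z b" shows "hc x z (a + b)"
proof -
  from assms(1) obtain \<gamma> u where c0: "horizontal_curve A (V 1) \<gamma> u" "\<gamma> 0 = x" "\<gamma> 1 = y"
    "(\<lambda>s. sqrt (h (u s) (u s))) absolutely_integrable_on {0..1}"
    "a = integral {0..1} (\<lambda>s. sqrt (h (u s) (u s)))" unfolding hc_def by blast
  note c = horizontal_curveD[OF c0(1)] c0(2-5)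
  from assms(2) obtain \<gamma>' u' where d0: "horizontal_curve A (V 1) \<gamma>' u'" "\<gamma>' 0 = y" "\<gamma>' 1 = z"
    "(\<lambda>s. sqrt (h (u' s) (u' s))) absolutely_integrable_on {0..1}"
    "b = integral {0..1} (\<lambda>s. sqrt (h (u' s) (u' s)))" unfolding hc_def by blast
  note d = horizontal_curveD[OF d0(1)] d0(2-5)
  define \<beta> where "\<beta> = (\<lambda>s. if s \<le> 1/2 then \<gamma> (2 * s) else \<gamma>' (2 * s - 1))"
  \<comment> \<open>Each half is run at double speed; the doubled velocity over half the time keeps
    its length.\<close>
  define w where "w = (\<lambda>s. if s \<le> 1/2 then 2 *\<^sub>R u (2 * s) else 2 *\<^sub>R u' (2 * s - 1))"
  have wf: "(\<lambda>s. w s f (\<beta> s)) = (\<lambda>s. if s \<le> 1/2 then 2 * (\<lambda>s. u s f (\<gamma> s)) (2 * s) else 2 * (\<lambda>s. u' s f (\<gamma>' s)) (2 * s - 1))" for f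
    by (auto simp: w_def \<beta>_def scaleR_fun_def)
  show ?thesis
  proof (rule hcI[of w \<beta>])
    show "w s \<in> V 1" if "s \<in> {0..1}" for s
      using that c(1)[of "2 * s"] d(1)[of "2 * s - 1"] by (auto simp: w_def intro!: V1_scale)
    show "(\<lambda>s. w s f (\<beta> s)) absolutely_integrable_on {0..1}" if "sf f" for f
      unfolding wf by (rule concat_integral(1)[OF c(2)[OF that] d(2)[OF that]])
    show "f (\<beta> t) = f (\<beta> 0) + integral {0..t} (\<lambda>s. w s f (\<beta> s))" if f: "sf f" and t: "t \<in> {0..1}" for f t
    proof (cases "t \<le> 1/2")
      case True
      have "integral {0..t} (\<lambda>s. w s f (\<beta> s)) = integral {0..2 * t} (\<lambda>s. u s f (\<gamma> s))"
        unfolding wf by (rule concat_integral(2)[OF c(2)[OF f] d(2)[OF f]]) (use True t in auto)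
      then show ?thesis using c(3)[OF f, of "2 * t"] True t by (simp add: \<beta>_def)
    next
      case False
      have "integral {0..t} (\<lambda>s. w s f (\<beta> s)) = integral {0..1} (\<lambda>s. u s f (\<gamma> s)) + integral {0..2 * t - 1} (\<lambda>s. u' s f (\<gamma>' s))"
        unfolding wf by (rule concat_integral(3)[OF c(2)[OF f] d(2)[OF f]]) (use False t in auto)
      then show ?thesis using c(3)[OF f, of 1] d(3)[OF f, of "2 * t - 1"] c(4,5) d(4,5) False t by (simp add: \<beta>_def)
    qed
    show "\<beta> 0 = x" "\<beta> 1 = z" using c d by (auto simp: \<beta>_def)
    let ?F = "\<lambda>s. if s \<le> 1/2 then 2 * (\<lambda>s. sqrt (h (u s) (u s))) (2 * s) else 2 * (\<lambda>s. sqrt (h (u' s) (u' s))) (2 * s - 1)"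
    have wl: "sqrt (h (w s) (w s)) = ?F s" if "s \<in> {0..1}" for s
      using that c(1)[of "2 * s"] d(1)[of "2 * s - 1"] by (auto simp: w_def sqrt_h_scale)
    note F = concat_integral[OF c(6) d(6)]
    show "(\<lambda>s. sqrt (h (w s) (w s))) absolutely_integrable_on {0..1}"
      by (rule absolutely_integrable_spike[OF F(1), of "{}"]) (use wl in auto)
    have "integral {0..1} (\<lambda>s. sqrt (h (w s) (w s))) = integral {0..1} ?F"
      by (rule integral_cong) (rule wl)
    then show "a + b = integral {0..1} (\<lambda>s. sqrt (h (w s) (w s)))"
      using F(3)[of 1] c(7) d(7) by simp
  qed
qed

lemma flow_field_integral:
  assumes Y: "Y \<in> V 1" and f: "sf f" and "0 \<le> t"
  shows "f (flow Y t) = f (flow Y 0) + integral {0..t} (\<lambda>s. Y f (flow Y s))"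
proof -
  have "((\<lambda>s. f (flow Y s)) has_vector_derivative Y f (flow Y s)) (at s within {0..t})" for s
    using has_field_derivative_at_within[OF flow_derivative[OF Y f, of \<one> s]]
    by (simp add: has_real_derivative_iff_has_vector_derivative[symmetric])
  from fundamental_theorem_of_calculus[OF assms(3) this]
  show ?thesis by (simp add: integral_unique)
qed

lemma hc_flow:
  assumes Y: "Y \<in> V 1" shows "hc \<one> (flow Y 1) (sqrt (h Y Y))"
proof (rule hcI[of "\<lambda>s. Y" "flow Y"])
  show "(\<lambda>s. Y f (flow Y s)) absolutely_integrable_on {0..1}" if "sf f" for f
  proof -
    have "sf (Y f)" using sf_lf[OF that, of "ev Y"] by (simp add: V1_lf[OF Y])
    then have "continuous_on UNIV (\<lambda>s. Y f (flow Y s))"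
      using smooth_on_continuous[OF smooth_intoD[OF flow_smooth[OF Y]]] by blast
    from continuous_on_subset[OF this subset_UNIV] show ?thesis
      by (rule absolutely_integrable_continuous_real)
  qed
qed (use Y flow(1)[OF Y] flow_field_integral[OF Y] in auto)

lemma hc_refl: "hc \<one> \<one> 0"
proof -
  have "flow 0 1 = \<one>"
    using flow_scale[OF V1_zero, of 0 1] flow(1)[OF V1_zero] by simp
  then show ?thesis using hc_flow[OF V1_zero] by (simp add: h_zero[OF V1_zero])
qed

lemma hc_mult: "hc \<one> x a \<Longrightarrow> hc \<one> y b \<Longrightarrow> hc \<one> (x \<otimes> y) (a + b)"
  using hc_trans[OF _ hc_translate[of \<one> y b x]] by simp

text \<open>Comparison of \<open>h\<close> with the norm of the coordinate space: minimise over a unit sphere.\<close>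

lemma norm_ev_le:
  obtains C where "C > 0" "\<And>Y. Y \<in> V 1 \<Longrightarrow> norm (ev Y) \<le> C * sqrt (h Y Y)"
proof -
  define P where "P = {v. lf v \<in> V 1}"
  have P: "subspace P"
    using V1(1) unfolding P_def
    by (simp add: subspace_def linear_0[OF linear_lf] linear_add[OF linear_lf] linear_cmul[OF linear_lf])
  obtain B where B: "B \<subseteq> P" "pairwise orthogonal B" "\<And>x. x \<in> B \<Longrightarrow> norm x = 1" "independent B" "span B = P"
    using orthonormal_basis_subspace[OF P] by metis
  have fB: "finite B" using B(4) by (rule independent_imp_finite)
  have ex: "y = (\<Sum>b\<in>B. (y \<bullet> b) *\<^sub>R b)" if "y \<in> P" for y
  proof -
    have "y \<in> range (\<lambda>c. \<Sum>b\<in>B. c b *\<^sub>R b)" using that B(5) span_finite[OF fB] by simp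
    then obtain c where c: "y = (\<Sum>b\<in>B. c b *\<^sub>R b)" by (rule rangeE)
    have "y \<bullet> b = c b" if b: "b \<in> B" for b
    proof -
      have "y \<bullet> b = (\<Sum>a\<in>B. c a * (a \<bullet> b))" unfolding c by (simp add: inner_sum_left)
      also have "\<dots> = (\<Sum>a\<in>B. if a = b then c a else 0)"
        using B(2,3) b by (intro sum.cong) (auto simp: pairwise_def orthogonal_def norm_eq_1)
      also have "\<dots> = c b" using b fB by simp
      finally show ?thesis .
    qed
    then show ?thesis using c by simp
  qed
  \<comment> \<open>On P this is \<open>h\<close> read in coordinates; as an explicit quadratic
    polynomial it is visibly continuous, which the minimisation needs.\<close>
  define q where "q = (\<lambda>y. \<Sum>b\<in>B. \<Sum>c\<in>B. (y \<bullet> b) * ((y \<bullet> c) * h (lf c) (lf b)))"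
  have BV: "lf b \<in> V 1" if "b \<in> B" for b using that B(1) by (auto simp: P_def)
  have q: "h (lf y) (lf y) = q y" if "y \<in> P" for y
  proof -
    have y: "lf y = (\<Sum>b\<in>B. (y \<bullet> b) *\<^sub>R lf b)"
      using arg_cong[OF ex[OF that], of lf] by (simp add: linear_sum[OF linear_lf] linear_cmul[OF linear_lf])
    have yV: "lf y \<in> V 1" using that by (simp add: P_def)
    have "h (lf y) (lf y) = (\<Sum>b\<in>B. (y \<bullet> b) * h (lf b) (lf y))"
      using h_sum[where c = "\<lambda>b. y \<bullet> b", OF fB BV yV] y by simp
    also have "\<dots> = (\<Sum>b\<in>B. (y \<bullet> b) * (\<Sum>c\<in>B. (y \<bullet> c) * h (lf c) (lf b)))"
    proof (intro sum.cong refl)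
      fix b assume b: "b \<in> B"
      have "h (lf b) (lf y) = h (lf y) (lf b)" using h_sym[OF BV[OF b] yV] .
      also have "\<dots> = (\<Sum>c\<in>B. (y \<bullet> c) * h (lf c) (lf b))"
        using h_sum[where c = "\<lambda>b. y \<bullet> b", OF fB BV BV[OF b]] y by simp
      finally show "(y \<bullet> b) * h (lf b) (lf y) = (y \<bullet> b) * (\<Sum>c\<in>B. (y \<bullet> c) * h (lf c) (lf b))" by simp
    qed
    finally show ?thesis by (simp add: q_def sum_distrib_left)
  qed
  have cq: "continuous_on UNIV q" unfolding q_def by (intro continuous_intros)
  let ?K = "sphere 0 1 \<inter> P"
  have K: "compact ?K" using closed_subspace[OF P] by (intro compact_Int_closed compact_sphere)
  \<comment> \<open>The sphere is empty when P = {0}; then any positive bound serves.\<close>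
  obtain m where m: "m > 0" "\<And>y. y \<in> ?K \<Longrightarrow> q y \<ge> m"
  proof (cases "?K = {}")
    case True
    then show ?thesis using that[of 1] by auto
  next
    case False
    obtain y0 where y0: "y0 \<in> ?K" "\<And>y. y \<in> ?K \<Longrightarrow> q y0 \<le> q y"
      using continuous_attains_inf[OF K False continuous_on_subset[OF cq]] by auto
    have "lf y0 \<noteq> 0" using y0(1) lf_inj[of y0 0] linear_0[OF linear_lf] by auto
    then have "q y0 > 0" using h_pos[of "lf y0"] q[of y0] y0(1) by (auto simp: P_def)
    then show ?thesis using that y0(2) by blast
  qed
  have "norm (ev Y) \<le> (1 / sqrt m) * sqrt (h Y Y)" if Y: "Y \<in> V 1" for Y
  proof (cases "ev Y = 0")
    case True
    then show ?thesis using h_nonneg[OF Y] m(1) by simp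
  next
    case False
    let ?n = "norm (ev Y)"
    have n: "?n > 0" using False by simp
    have 1: "lf ((1 / ?n) *\<^sub>R ev Y) = (1 / ?n) *\<^sub>R Y"
      by (simp add: linear_cmul[OF linear_lf] V1_lf[OF Y])
    have PY: "(1 / ?n) *\<^sub>R ev Y \<in> P" unfolding P_def using 1 V1_scale[OF Y] by simp
    then have "(1 / ?n) *\<^sub>R ev Y \<in> ?K" using n by simp
    then have "m \<le> h (lf ((1 / ?n) *\<^sub>R ev Y)) (lf ((1 / ?n) *\<^sub>R ev Y))"
      using m(2) q[OF PY] by simp
    also have "\<dots> = (1 / ?n)\<^sup>2 * h Y Y" unfolding 1 by (rule h_scale2[OF Y])
    finally have "m * ?n\<^sup>2 \<le> h Y Y" using n by (simp add: field_simps power2_eq_square)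
    then have "sqrt (m * ?n\<^sup>2) \<le> sqrt (h Y Y)" by simp
    then have "sqrt m * ?n \<le> sqrt (h Y Y)" using n by (simp add: real_sqrt_mult)
    then show ?thesis using m(1) by (simp add: field_simps)
  qed
  then show ?thesis using m(1) that[of "1 / sqrt m"] by simp
qed

lemma lf_zero_off_support:
  assumes f: "sf f" and x: "x \<notin> closure {y. f y \<noteq> 0}"
  shows "lf v f x = 0"
proof (rule lf_unique[OF f, of x "\<lambda>v. 0" v])
  let ?N = "Q1 \<inter> (\<lambda>z. x \<otimes> \<xi> z) -` (- closure {y. f y \<noteq> 0})"
  have N: "open ?N"
    by (intro continuous_open_preimage smooth_into_continuous smooth_into_mult smooth_into_const smooth_xi open_Q1) auto
  show "((\<lambda>z. f (x \<otimes> \<xi> z)) has_derivative (\<lambda>v. 0)) (at e1)"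
  proof (rule has_derivative_transform_within_open[OF has_derivative_const N])
    show "e1 \<in> ?N" using e1 x by simp
    fix z assume "z \<in> ?N"
    then have "x \<otimes> \<xi> z \<notin> closure {y. f y \<noteq> 0}" by simp
    then have "x \<otimes> \<xi> z \<notin> {y. f y \<noteq> 0}" by (rule contra_subsetD[OF closure_subset])
    then show "0 = f (x \<otimes> \<xi> z)" by simp
  qed
qed

lemma bounded_lf:
  assumes f: "sf f" and K: "compact (closure {y. f y \<noteq> 0})"
  obtains C where "C > 0" "\<And>v x. \<bar>lf v f x\<bar> \<le> C * norm v"
proof -
  have "\<exists>B. \<forall>x. \<bar>lf b f x\<bar> \<le> B" for b
  proof -
    have "compact (lf b f ` closure {y. f y \<noteq> 0})"
      by (intro compact_continuous_image sf_continuous sf_lf f K)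
    then have "bounded (lf b f ` closure {y. f y \<noteq> 0})" by (rule compact_imp_bounded)
    then obtain B where "\<forall>r\<in>lf b f ` closure {y. f y \<noteq> 0}. norm r \<le> B" unfolding bounded_iff ..
    then have B: "\<bar>lf b f x\<bar> \<le> B" if "x \<in> closure {y. f y \<noteq> 0}" for x using that by auto
    have "\<bar>lf b f x\<bar> \<le> max B 0" for x
      using B[of x] lf_zero_off_support[OF f, of x b] by (cases "x \<in> closure {y. f y \<noteq> 0}") auto
    then show ?thesis by blast
  qed
  then obtain B where B: "\<And>b x. \<bar>lf b f x\<bar> \<le> B b" by metis
  have "\<bar>lf v f x\<bar> \<le> ((\<Sum>b\<in>Basis. \<bar>B b\<bar>) + 1) * norm v" for v x
  proof -
    have "lf v f x = lf (\<Sum>b\<in>Basis. (v \<bullet> b) *\<^sub>R b) f x" by (simp add: euclidean_representation)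
    also have "\<dots> = (\<Sum>b\<in>Basis. (v \<bullet> b) * lf b f x)"
      by (simp only: linear_sum[OF linear_lf_fun] linear_cmul[OF linear_lf_fun] real_scaleR_def)
    also have "\<bar>\<dots>\<bar> \<le> (\<Sum>b\<in>Basis. norm v * \<bar>B b\<bar>)"
      by (intro order_trans[OF sum_abs] sum_mono)
        (use B in \<open>auto simp: abs_mult intro!: mult_mono Basis_le_norm order_trans[OF B]\<close>)
    also have "\<dots> \<le> ((\<Sum>b\<in>Basis. \<bar>B b\<bar>) + 1) * norm v"
      by (simp add: sum_distrib_left sum_distrib_right algebra_simps)
    finally show ?thesis .
  qed
  moreover have "(\<Sum>b\<in>(Basis::'e set). \<bar>B b\<bar>) + 1 > 0" by (simp add: add_nonneg_pos sum_nonneg)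
  ultimately show ?thesis using that by blast
qed

text \<open>A cut-off function changes along a horizontal curve at most in proportion to the length.\<close>

lemma short_curves_stay:
  assumes N: "open N" "\<one> \<in> N"
  obtains \<epsilon> where "\<epsilon> > 0" "\<And>x l. hc \<one> x l \<Longrightarrow> l < \<epsilon> \<Longrightarrow> x \<in> N"
proof -
  obtain f M where f: "sf f" "\<And>y. 0 \<le> f y" "\<And>y. f y \<le> 1" "open M" "\<one> \<in> M" "\<And>y. y \<in> M \<Longrightarrow> f y = 1"
    "compact (closure {y. f y \<noteq> 0})" "closure {y. f y \<noteq> 0} \<subseteq> N" "\<And>y. y \<notin> N \<Longrightarrow> f y = 0"
    by (rule bump[OF N]) (rule that)
  obtain C1 where C1: "C1 > 0" "\<And>v x. \<bar>lf v f x\<bar> \<le> C1 * norm v" using bounded_lf[OF f(1,7)] by blast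
  obtain C2 where C2: "C2 > 0" "\<And>Y. Y \<in> V 1 \<Longrightarrow> norm (ev Y) \<le> C2 * sqrt (h Y Y)" using norm_ev_le by blast
  have b: "\<bar>Y f x\<bar> \<le> C1 * C2 * sqrt (h Y Y)" if "Y \<in> V 1" for Y x
  proof -
    have "\<bar>Y f x\<bar> \<le> C1 * norm (ev Y)" using C1(2)[of "ev Y" x] by (simp add: V1_lf[OF that])
    also have "\<dots> \<le> C1 * (C2 * sqrt (h Y Y))" using C2(2)[OF that] C1(1) by (intro mult_left_mono) auto
    finally show ?thesis by (simp add: mult.assoc)
  qed
  have "x \<in> N" if x: "hc \<one> x l" "l < 1 / (C1 * C2)" for x l
  proof (rule ccontr)
    assume nx: "x \<notin> N"
    from x(1) obtain \<gamma> u where c0: "horizontal_curve A (V 1) \<gamma> u" "\<gamma> 0 = \<one>" "\<gamma> 1 = x"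
      "(\<lambda>s. sqrt (h (u s) (u s))) absolutely_integrable_on {0..1}"
      "l = integral {0..1} (\<lambda>s. sqrt (h (u s) (u s)))" unfolding hc_def by blast
    note c = horizontal_curveD[OF c0(1)] c0(2-5)
    have "f x - f \<one> = integral {0..1} (\<lambda>s. u s f (\<gamma> s))" using c(3)[OF f(1), of 1] c(4,5) by simp
    then have "1 \<le> norm (integral {0..1} (\<lambda>s. u s f (\<gamma> s)))"
      using f(6)[OF f(5)] f(9)[OF nx] by simp
    also have "\<dots> \<le> integral {0..1} (\<lambda>s. C1 * C2 * sqrt (h (u s) (u s)))"
      by (intro integral_norm_bound_integral integrable_on_mult_right set_lebesgue_integral_eq_integral(1) c(2)[OF f(1)] c(6))
        (use b c(1) in auto)
    also have "\<dots> = C1 * C2 * l" using c(7) by simp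
    also have "\<dots> < 1" using x(2) C1(1) C2(1) by (simp add: field_simps)
    finally show False by simp
  qed
  then show ?thesis using C1(1) C2(1) by (intro that[of "1 / (C1 * C2)"]) auto
qed

end

section \<open>The semigroup generated by a half-space\<close>

context carnot begin

abbreviation gen :: "'g vfield set \<Rightarrow> 'g set" where "gen \<equiv> generated_semigroup G A"

lemma foldr_mult: "foldr (\<otimes>) xs a = foldr (\<otimes>) xs \<one> \<otimes> a"
  by (induction xs) (simp_all add: m_assoc)

lemma gen_mult:
  assumes "x \<in> gen K" "y \<in> gen K" shows "x \<otimes> y \<in> gen K"
proof -
  from assms obtain us ws where u: "x = foldr (\<otimes>) (map (lie_exp G A) us) \<one>" "us \<noteq> []" "set us \<subseteq> K"
    and w: "y = foldr (\<otimes>) (map (lie_exp G A) ws) \<one>" "ws \<noteq> []" "set ws \<subseteq> K"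
    unfolding generated_semigroup_def by blast
  have "x \<otimes> y = foldr (\<otimes>) (map (lie_exp G A) (us @ ws)) \<one>"
    unfolding map_append foldr_append w(1)[symmetric] u(1) by (rule foldr_mult[symmetric])
  then show ?thesis unfolding generated_semigroup_def using u w
    by (intro CollectI exI[of _ "us @ ws"]) auto
qed

lemma gen_flow:
  assumes "Y \<in> K" "K \<subseteq> V 1" shows "flow Y 1 \<in> gen K"
proof -
  have "flow Y 1 = foldr (\<otimes>) (map (lie_exp G A) [Y]) \<one>"
    using assms by (auto simp: lie_exp_flow)
  then show ?thesis unfolding generated_semigroup_def using assms(1)
    by (intro CollectI exI[of _ "[Y]"]) simp
qed

lemma gen_induct [consumes 2, case_names flow mult]:
  assumes "x \<in> gen K" "K \<subseteq> V 1" and flow: "\<And>Y. Y \<in> K \<Longrightarrow> P (flow Y 1)"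
    and mult: "\<And>x y. x \<in> gen K \<Longrightarrow> y \<in> gen K \<Longrightarrow> P x \<Longrightarrow> P y \<Longrightarrow> P (x \<otimes> y)"
  shows "P x"
proof -
  from assms(1) obtain ws where w: "x = foldr (\<otimes>) (map (lie_exp G A) ws) \<one>" "ws \<noteq> []" "set ws \<subseteq> K"
    unfolding generated_semigroup_def by blast
  have "P (foldr (\<otimes>) (map (lie_exp G A) ws) \<one>) \<and> foldr (\<otimes>) (map (lie_exp G A) ws) \<one> \<in> gen K"
    using w(2,3)
  proof (induction ws rule: list_nonempty_induct)
    case (single Y)
    then have "Y \<in> K" by simp
    then show ?case using flow gen_flow[OF _ assms(2)] assms(2) by (auto simp: lie_exp_flow)
  next
    case (cons Y ws)
    then have "Y \<in> K" "Y \<in> V 1" using assms(2) by auto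
    then show ?case using cons flow gen_flow[OF _ assms(2)] mult gen_mult by (simp add: lie_exp_flow)
  qed
  then show ?thesis using w(1) by simp
qed

lemma dil_gen:
  assumes K: "K \<subseteq> V 1" "\<And>Y t. Y \<in> K \<Longrightarrow> t > 0 \<Longrightarrow> t *\<^sub>R Y \<in> K" and t: "t > 0"
  shows "\<delta> t ` gen K = gen K"
proof -
  have 1: "\<delta> t x \<in> gen K" if "x \<in> gen K" "t > 0" for x t
    using that(1) K(1)
  proof (induction rule: gen_induct)
    case (flow Y)
    then have Y: "Y \<in> V 1" using K(1) by blast
    have "\<delta> t (flow Y 1) = flow (t *\<^sub>R Y) 1" using Y that(2) by (simp add: dil_flow flow_scale)
    then show ?case using gen_flow[OF K(2)[OF flow that(2)] K(1)] by simp
  next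
    case (mult x y)
    then show ?case using that(2) by (simp add: dil_hom gen_mult)
  qed
  \<comment> \<open>That \<delta> t and \<delta> (1/t) are mutually inverse is verified only on
    \<open>gen K\<close> here; on the whole group it awaits the fact that \<open>V 1\<close>
    generates.\<close>
  have 2: "\<delta> t (\<delta> (1/t) x) = x" if "x \<in> gen K" for x
    using that K(1)
  proof (induction rule: gen_induct)
    case (flow Y)
    then have Y: "Y \<in> V 1" using K(1) by blast
    then show ?case using t by (simp add: dil_flow)
  next
    case (mult x y)
    then show ?case using t by (simp add: dil_hom)
  qed
  show ?thesis
  proof (intro equalityI subsetI)
    fix x assume x: "x \<in> gen K"
    have "\<delta> (1/t) x \<in> gen K" using 1[OF x] t by simp
    then show "x \<in> \<delta> t ` gen K" using 2[OF x] by (intro image_eqI[of _ _ "\<delta> (1/t) x"]) auto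
  qed (use 1 t in auto)
qed

end

context lie_grp begin

subsection \<open>The adjoint representation on the Lie algebra\<close>

text \<open>The map Ad(p) in coordinates. The field inside is the push-forward of
  \<open>lf v\<close> under right translation by \<open>inv p\<close>; it is again left-invariant,
  so \<open>ev\<close> reads off its vector. The familiar form by conjugation is
  \<open>lf_adj\<close>.\<close>

definition adj :: "'g \<Rightarrow> 'e \<Rightarrow> 'e" where
  "adj p v = ev (\<lambda>f x. lf v (\<lambda>y. f (y \<otimes> inv p)) (x \<otimes> p))"

lemma sf_conj: "sf f \<Longrightarrow> sf (\<lambda>x. f (p \<otimes> x \<otimes> q))"
  using sf_translate(1)[OF sf_translate(2)] by blast

lemma sf_right_iff: "sf (\<lambda>y. f (y \<otimes> p)) \<longleftrightarrow> sf f"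
  using sf_translate(2)[of "\<lambda>y. f (y \<otimes> p)" "inv p"] sf_translate(2)[of f p]
  by (auto simp: m_assoc)

lemma adj_field: "(\<lambda>f x. lf v (\<lambda>y. f (y \<otimes> inv p)) (x \<otimes> p)) \<in> lie_algebra G A"
proof -
  have 1: "sf (\<lambda>x. lf v (\<lambda>y. f (y \<otimes> inv p)) (x \<otimes> p))" if "sf f" for f
    by (rule sf_translate(2)[OF sf_lf[OF sf_translate(2)[OF that]]])
  have 2: "lf v (\<lambda>y. f (y \<otimes> inv p)) x = 0" if "\<not> sf f" for f x
    using that by (simp add: lf_def sf_right_iff del: smooth_map_def)
  have 3: "lf v (\<lambda>y. f (g \<otimes> (y \<otimes> inv p))) x = lf v (\<lambda>y. f (y \<otimes> inv p)) (g \<otimes> x)" if "sf f" for f g x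
    using lf_left_invariant[OF sf_translate(2)[OF that, of "inv p"], of v g x] by (simp add: m_assoc)
  show ?thesis
    unfolding lie_algebra_def vector_fields_def
    by (intro CollectI conjI allI impI ballI)
      (simp_all add: 1 2 3 lf_lincomb lf_leibniz sf_translate(2) fun_eq_iff m_assoc)
qed

lemma lf_adj:
  assumes f: "sf f" shows "lf (adj p v) f \<one> = lf v (\<lambda>x. f (p \<otimes> x \<otimes> inv p)) \<one>"
proof -
  have "lf (adj p v) f \<one> = lf v (\<lambda>y. f (y \<otimes> inv p)) p"
    unfolding adj_def using lf_ev[OF adj_field] by simp
  also have "\<dots> = lf v (\<lambda>x. f (p \<otimes> x \<otimes> inv p)) \<one>"
    using lf_at_one[OF sf_translate(2)[OF f, of "inv p"], of v p] by simp
  finally show ?thesis .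
qed

lemma linear_adj: "linear (adj p)"
proof (rule linearI)
  show "adj p (v + w) = adj p v + adj p w" for v w
    by (rule smooth_test_coord_eq) (simp add: lf_adj linear_add[OF linear_lf_fun])
  show "adj p (r *\<^sub>R v) = r *\<^sub>R adj p v" for r v
    by (rule smooth_test_coord_eq) (simp add: lf_adj linear_cmul[OF linear_lf_fun])
qed

lemma adj_mult: "adj (p \<otimes> q) v = adj p (adj q v)"
proof (rule smooth_test_coord_eq)
  fix f assume f: "sf f"
  show "lf (adj (p \<otimes> q) v) f \<one> = lf (adj p (adj q v)) f \<one>"
    unfolding lf_adj[OF f] lf_adj[OF sf_conj[OF f]] by (simp add: inv_mult_group m_assoc)
qed

lemma adj_one: "adj \<one> v = v"
  by (rule smooth_test_coord_eq) (simp add: lf_adj)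

lemma surj_adj: "surj (adj p)"
proof (rule surjI)
  show "adj p (adj (inv p) v) = v" for v
    by (simp add: adj_mult[symmetric] adj_one)
qed

end

section \<open>Lie brackets as derivatives of the adjoint action\<close>

context carnot begin

lemma V_step: "j \<in> {1..<s} \<Longrightarrow> span {lie_bracket X Y | X Y. X \<in> V 1 \<and> Y \<in> V j} = V (Suc j)"
  using carnot by (simp add: carnot_group_def stratification_def)

lemma V_decompose: "Z \<in> lie_algebra G A \<Longrightarrow> \<exists>v. (\<forall>i\<in>{1..s}. v i \<in> V i) \<and> Z = (\<Sum>i=1..s. v i)"
proof -
  assume Z: "Z \<in> lie_algebra G A"
  have "\<forall>X\<in>lie_algebra G A. \<exists>!v. (\<forall>i\<in>{1..s}. v i \<in> V i) \<and> (\<forall>i. i \<notin> {1..s} \<longrightarrow> v i = 0) \<and> X = (\<Sum>i=1..s. v i)"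
    using carnot unfolding carnot_group_def stratification_def by (elim conjE)
  from ex1_implies_ex[OF bspec[OF this Z]] show ?thesis by (elim exE conjE) (intro exI conjI)
qed

text \<open>Each layer is spanned by brackets of \<open>V 1\<close> with the preceding one, so
  stability under brackets with \<open>V 1\<close> alone captures all layers.\<close>

lemma lie_algebra_generated:
  assumes K: "subspace K" "V 1 \<subseteq> K" and br: "\<And>X Z. X \<in> V 1 \<Longrightarrow> Z \<in> K \<Longrightarrow> lie_bracket X Z \<in> K"
  shows "lie_algebra G A \<subseteq> K"
proof
  have VK: "V i \<subseteq> K" if "i \<in> {1..s}" for i
  proof -
    have "1 \<le> i" using that by simp
    then show ?thesis using that
    proof (induction i rule: dec_induct)
      case base
      then show ?case using K(2) by simp
    next
      case (step j)
      have "V (Suc j) = span {lie_bracket X Y | X Y. X \<in> V 1 \<and> Y \<in> V j}"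
        using V_step[of j] step by simp
      also have "\<dots> \<subseteq> K"
        using step br by (intro span_minimal K(1)) auto
      finally show ?case .
    qed
  qed
  fix Z assume "Z \<in> lie_algebra G A"
  then obtain v where v: "\<forall>i\<in>{1..s}. v i \<in> V i" "Z = (\<Sum>i=1..s. v i)" using V_decompose by blast
  show "Z \<in> K" unfolding v(2) using v(1) VK by (intro subspace_sum K(1)) blast
qed

text \<open>In the conjugation the flow occurs as left factor and as inverse right factor. With
  separate times for the two, the partial derivatives at 0 are \<open>Y (lf v f) \<one>\<close> and
  \<open>- lf v (Y f) \<one>\<close>, the latter after exchanging two derivatives; on the diagonal
  they add up to the commutator.\<close>

lemma adj_flow_derivative:
  assumes Y: "Y \<in> V 1" and f: "sf f"
  shows "((\<lambda>t. lf (adj (flow Y t) v) f \<one>) has_real_derivative lie_bracket Y (lf v) f \<one>) (at 0)"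
proof -
  let ?w = "ev Y"
  have w: "lf ?w = Y" by (rule V1_lf[OF Y])
  have sm1: "smooth_into UNIV (\<lambda>p::real\<times>real. flow Y (fst p))" "smooth_into UNIV (\<lambda>p::real\<times>real. inv (flow Y (snd p)))"
    by (rule smooth_into_compose[OF flow_smooth[OF Y] open_UNIV smooth_on_linear[OF open_UNIV bounded_linear_fst]], simp)
      (rule smooth_into_inv[OF smooth_into_compose[OF flow_smooth[OF Y] open_UNIV smooth_on_linear[OF open_UNIV bounded_linear_snd]]], simp)
  have o: "open ((UNIV :: (real\<times>real) set) \<times> Q1)" by (simp add: open_Times open_Q1)
  \<comment> \<open>The chart variable realises \<open>lf v\<close> as a partial derivative, so
    smoothness in both times comes from a single smooth function.\<close>
  let ?h = "\<lambda>q::(real\<times>real)\<times>'e. f (flow Y (fst (fst q)) \<otimes> \<xi> (snd q) \<otimes> inv (flow Y (snd (fst q))))"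
  have h: "smooth_on (UNIV \<times> Q1) ?h"
  proof (rule smooth_intoD[OF _ f], intro smooth_into_mult)
    show "smooth_into (UNIV \<times> Q1) (\<lambda>q::(real\<times>real)\<times>'e. flow Y (fst (fst q)))"
      by (rule smooth_into_compose[OF sm1(1) o smooth_on_linear[OF o bounded_linear_fst]]) simp
    show "smooth_into (UNIV \<times> Q1) (\<lambda>q::(real\<times>real)\<times>'e. inv (flow Y (snd (fst q))))"
      by (rule smooth_into_compose[OF sm1(2) o smooth_on_linear[OF o bounded_linear_fst]]) simp
    show "smooth_into (UNIV \<times> Q1) (\<lambda>q::(real\<times>real)\<times>'e. \<xi> (snd q))"
      by (rule smooth_into_compose[OF smooth_xi o smooth_on_linear[OF o bounded_linear_snd]]) auto
  qed
  let ?K = "\<lambda>p::real\<times>real. lf v (\<lambda>x. f (x \<otimes> inv (flow Y (snd p)))) (flow Y (fst p))"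
  have Kh: "frechet_derivative ?h (at (p, e1)) (0, v) = ?K p" for p
  proof -
    have "((\<lambda>z. (p, z)) has_derivative (\<lambda>v. (0, v))) (at e1)"
      by (auto intro!: derivative_eq_intros)
    moreover have "(?h has_derivative frechet_derivative ?h (at (p, e1))) (at (p, e1))"
      using smooth_on_has_derivative[OF h o] e1(1) by auto
    ultimately have "((\<lambda>z. ?h (p, z)) has_derivative (\<lambda>v. frechet_derivative ?h (at (p, e1)) (0, v))) (at e1)"
      by (rule has_derivative_compose)
    then show ?thesis using lf_unique[OF sf_translate(2)[OF f, of "inv (flow Y (snd p))"], of "flow Y (fst p)"] by simp
  qed
  have "smooth_on UNIV (\<lambda>p. frechet_derivative ?h (at (p, e1)) (0, v))"
    by (rule smooth_on_compose[OF open_UNIV o _ _ smooth_on_frechet[OF h o]])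
      (use e1(1) in \<open>auto intro!: smooth_on_Pair smooth_on_const smooth_on_ident\<close>)
  then have K: "smooth_on UNIV ?K" by (simp only: Kh)
  have d1: "((\<lambda>a. ?K (a, 0)) has_derivative (\<lambda>r. Y (lf v f) \<one> * r)) (at 0)"
    using curve_onD[OF flow(2)[OF Y] sf_lf[OF f, of v] UNIV_I, of 0]
    by (simp add: flow(1)[OF Y] w has_field_derivative_def)
  have d2: "((\<lambda>b. ?K (0, b)) has_derivative (\<lambda>r. - lf v (Y f) \<one> * r)) (at 0)"
  proof -
    let ?J = "\<lambda>q::'e\<times>real. f (\<xi> (fst q) \<otimes> flow Y (- snd q))"
    have o: "open (Q1 \<times> (UNIV::real set))" by (simp add: open_Times open_Q1)
    have "smooth_on (Q1 \<times> (UNIV::real set)) (\<lambda>q. - snd q)"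
      by (intro smooth_on_minus o smooth_on_linear bounded_linear_snd)
    then have J: "smooth_on (Q1 \<times> UNIV) ?J"
      by (intro smooth_intoD[OF _ f] smooth_into_mult smooth_into_compose[OF flow_smooth[OF Y] o]
         smooth_into_compose[OF smooth_xi o smooth_on_linear[OF o bounded_linear_fst]]) auto
    have Jv: "frechet_derivative ?J (at (e1, b)) (v, 0) = ?K (0, b)" for b
    proof -
      have "((\<lambda>z. (z, b)) has_derivative (\<lambda>v. (v, 0))) (at e1)"
        by (auto intro!: derivative_eq_intros)
      moreover have "(?J has_derivative frechet_derivative ?J (at (e1, b))) (at (e1, b))"
        using smooth_on_has_derivative[OF J o] e1(1) by auto
      ultimately have "((\<lambda>z. ?J (z, b)) has_derivative (\<lambda>v. frechet_derivative ?J (at (e1, b)) (v, 0))) (at e1)"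
        by (rule has_derivative_compose)
      then show ?thesis using lf_unique[OF sf_translate(2)[OF f, of "inv (flow Y b)"], of \<one>]
        by (simp add: flow(1)[OF Y] flow_minus[OF Y])
    qed
    have Jw: "frechet_derivative ?J (at (z, 0)) (0, 1) = - Y f (\<xi> z)" if z: "z \<in> Q1" for z
    proof -
      have "((\<lambda>b. (z, b)) has_derivative (\<lambda>v. (0, v))) (at 0)"
        by (auto intro!: derivative_eq_intros)
      moreover have "(?J has_derivative frechet_derivative ?J (at (z, 0))) (at (z, 0))"
        using smooth_on_has_derivative[OF J o] z by auto
      ultimately have 1: "((\<lambda>b. ?J (z, b)) has_derivative (\<lambda>v. frechet_derivative ?J (at (z, 0)) (0, v))) (at 0)"
        by (rule has_derivative_compose)
      have "((\<lambda>b. f (\<xi> z \<otimes> flow Y (- b))) has_real_derivative Y f (\<xi> z \<otimes> flow Y (- 0)) * (- 1)) (at 0)"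
        by (rule DERIV_chain2[where f = "\<lambda>b. f (\<xi> z \<otimes> flow Y b)", OF flow_derivative[OF Y f]]) (auto intro!: derivative_eq_intros)
      then have "((\<lambda>b. ?J (z, b)) has_derivative (*) (- Y f (\<xi> z))) (at 0)"
        by (simp add: has_field_derivative_def flow(1)[OF Y])
      from fun_cong[OF has_derivative_unique[OF 1 this], of 1] show ?thesis by simp
    qed
    have e: "(e1, 0) \<in> Q1 \<times> (UNIV::real set)" using e1 by simp
    let ?M = "frechet_derivative (\<lambda>y. frechet_derivative ?J (at y) (v, 0)) (at (e1, 0))"
    have M: "((\<lambda>y. frechet_derivative ?J (at y) (v, 0)) has_derivative ?M) (at (e1, 0))"
      by (rule smooth_on_has_derivative[OF smooth_on_frechet[OF J o] o e])
    have "((\<lambda>b. (e1, b)) has_derivative (\<lambda>v. (0, v))) (at 0)"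
      by (auto intro!: derivative_eq_intros)
    from has_derivative_compose[OF this M]
    have 1: "((\<lambda>b. ?K (0, b)) has_derivative (\<lambda>r. ?M (0, r))) (at 0)" by (simp only: Jv)
    let ?N = "frechet_derivative (\<lambda>y. frechet_derivative ?J (at y) (0, 1)) (at (e1, 0))"
    have N: "((\<lambda>y. frechet_derivative ?J (at y) (0, 1)) has_derivative ?N) (at (e1, 0))"
      by (rule smooth_on_has_derivative[OF smooth_on_frechet[OF J o] o e])
    have "((\<lambda>z. (z, 0::real)) has_derivative (\<lambda>v. (v, 0))) (at e1)"
      by (auto intro!: derivative_eq_intros)
    from has_derivative_compose[OF this N]
    have 2: "((\<lambda>z. frechet_derivative ?J (at (z, 0)) (0, 1)) has_derivative (\<lambda>v. ?N (v, 0))) (at e1)" .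
    have sY: "sf (Y f)" using sf_lf[OF f, of ?w] w by simp
    have "((\<lambda>z. - Y f (\<xi> z)) has_derivative (\<lambda>v. - lf v (Y f) \<one>)) (at e1)"
      using has_derivative_minus[OF lf_derivative[OF sY, of \<one>]] by simp
    then have "((\<lambda>z. frechet_derivative ?J (at (z, 0)) (0, 1)) has_derivative (\<lambda>v. - lf v (Y f) \<one>)) (at e1)"
      by (rule has_derivative_transform_within_open[OF _ open_Q1 e1(1)]) (simp add: Jw)
    from fun_cong[OF has_derivative_unique[OF 2 this], of v] have N': "?N (v, 0) = - lf v (Y f) \<one>" .
    have "?M (0, r) = - lf v (Y f) \<one> * r" for r
    proof -
      have "?M (0, r) = r * ?M (0, 1)"
        using linear_cmul[OF has_derivative_linear[OF M], of r "(0, 1)"] by simp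
      also have "?M (0, 1) = ?N (v, 0)" by (rule mixed_derivatives_commute[OF J o e])
      finally show ?thesis unfolding N' by simp
    qed
    then show ?thesis using 1 by (simp only:)
  qed
  have "((\<lambda>t. ?K (t, t)) has_derivative (\<lambda>r. Y (lf v f) \<one> * r + - lf v (Y f) \<one> * r)) (at 0)"
    by (rule has_derivative_diagonal[OF K open_UNIV UNIV_I d1 d2])
  moreover have "?K (t, t) = lf (adj (flow Y t) v) f \<one>" for t
    unfolding lf_adj[OF f] using lf_at_one[OF sf_translate(2)[OF f, of "inv (flow Y t)"], of v "flow Y t"] by simp
  moreover have "(\<lambda>r. Y (lf v f) \<one> * r + - lf v (Y f) \<one> * r) = (*) (lie_bracket Y (lf v) f \<one>)"
    by (simp add: lie_bracket_def fun_eq_iff left_diff_distrib)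
  ultimately show ?thesis by (simp add: has_field_derivative_def)
qed

lemma adj_flow_vector_derivative:
  assumes Y: "Y \<in> V 1"
  obtains D where "((\<lambda>t. adj (flow Y t) v) has_vector_derivative D) (at 0)" "lf D = lie_bracket Y (lf v)"
proof -
  obtain X M where XM: "coord_at_one X M" by (rule coord_exists)
  then have X: "\<And>b. sf (X b)" by (simp add: coord_at_one_def)
  \<comment> \<open>The components of the bracket at \<open>\<one>\<close>. That D represents the
    bracket is tested at \<open>\<one>\<close> and then spread over the group by left
    invariance.\<close>
  define D where "D = (\<Sum>b\<in>Basis. lie_bracket Y (lf v) (X b) \<one> *\<^sub>R b)"
  have "adj p v = (\<Sum>b\<in>Basis. lf (adj p v) (X b) \<one> *\<^sub>R b)" for p
    by (simp add: lf_coord[OF XM] euclidean_representation)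
  moreover have "((\<lambda>t. \<Sum>b\<in>Basis. lf (adj (flow Y t) v) (X b) \<one> *\<^sub>R b) has_derivative
     (\<lambda>r. \<Sum>b\<in>Basis. (lie_bracket Y (lf v) (X b) \<one> * r) *\<^sub>R b)) (at 0)"
    by (intro has_derivative_sum has_derivative_scaleR_left adj_flow_derivative[OF Y X, unfolded has_field_derivative_def])
  ultimately have D: "((\<lambda>t. adj (flow Y t) v) has_vector_derivative D) (at 0)"
    by (simp add: has_vector_derivative_def D_def scaleR_sum_right mult.commute)
  have "lf D f \<one> = lie_bracket Y (lf v) f \<one>" if f: "sf f" for f
  proof -
    have "((\<lambda>t. lf (adj (flow Y t) v) f \<one>) has_derivative (\<lambda>r. lf (r *\<^sub>R D) f \<one>)) (at 0)"
      by (rule bounded_linear.has_derivative[OF linear_conv_bounded_linear[THEN iffD1, OF linear_lf_fun] D[unfolded has_vector_derivative_def]])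
    from fun_cong[OF has_derivative_unique[OF this adj_flow_derivative[OF Y f, of v, unfolded has_field_derivative_def]], of 1]
    show ?thesis by simp
  qed note at1 = this
  have "lf D f x = lie_bracket Y (lf v) f x" for f x
  proof (cases "sf f")
    case True
    have sY: "sf (Y f)" "sf (lf v f)" "\<And>g. sf g \<Longrightarrow> sf (Y g)"
      using sf_lf[OF True] sf_lf[of _ "ev Y"] V1_lf[OF Y] True by auto
    have inv: "Y (\<lambda>y. g (x \<otimes> y)) = (\<lambda>y. Y g (x \<otimes> y))" if "sf g" for g
      using lf_left_invariant[OF that, of "ev Y" x] V1_lf[OF Y] by (simp add: fun_eq_iff)
    have inv2: "lf v (\<lambda>y. g (x \<otimes> y)) = (\<lambda>y. lf v g (x \<otimes> y))" if "sf g" for g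
      using lf_left_invariant[OF that, of v x] by (simp add: fun_eq_iff)
    have "lf D f x = lie_bracket Y (lf v) (\<lambda>y. f (x \<otimes> y)) \<one>"
      using lf_at_one[OF True] at1[OF sf_translate(1)[OF True]] by simp
    also have "\<dots> = lie_bracket Y (lf v) f x"
      using inv[OF sY(2)] inv2[OF sY(1)] by (simp add: lie_bracket_def inv[OF True] inv2[OF True])
    finally show ?thesis .
  next
    case False
    have z: "lf w f = (\<lambda>x. 0)" for w using False by (simp add: lf_def fun_eq_iff del: smooth_map_def)
    have z2: "lf w (\<lambda>x. 0) y = 0" for w y
      by (rule lf_unique[OF sf_const]) simp
    show ?thesis using z[of "ev Y"] z[of v] z[of D] z2[of "ev Y"] z2[of v] V1_lf[OF Y]
      by (simp add: lie_bracket_def)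
  qed
  then have "lf D = lie_bracket Y (lf v)" by (simp add: fun_eq_iff)
  with D show ?thesis by (rule that)
qed

end

section \<open>Adjoint orbit of the half-space and interior of the semigroup\<close>

locale half_space = carnot_metric G A s V \<delta> h
  for G :: "'g::{second_countable_topology, t2_space} monoid" (structure)
    and A :: "('g, 'e::euclidean_space) atlas"
    and s :: nat and V :: "nat \<Rightarrow> 'g vfield set" and \<delta> :: "real \<Rightarrow> 'g \<Rightarrow> 'g"
    and h :: "'g vfield \<Rightarrow> 'g vfield \<Rightarrow> real" +
  fixes W :: "'g vfield set"
  assumes W: "horizontal_half_space (V 1) W"
begin

abbreviation SW :: "'g set" where "SW \<equiv> gen W"

text \<open>These four facts are what the later arguments retain of the shape of \<open>W\<close>: a
  cone in \<open>V 1\<close> through 0 that contains Y or -Y for each horizontal Y.\<close>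

lemma half_space:
  shows W_V1: "W \<subseteq> V 1" and W_scale: "Y \<in> W \<Longrightarrow> t \<ge> 0 \<Longrightarrow> t *\<^sub>R Y \<in> W"
    and W_or: "Y \<in> V 1 \<Longrightarrow> Y \<in> W \<or> - Y \<in> W" and W_zero: "0 \<in> W"
proof -
  obtain k X where k: "scalar_product_on (V 1) k" "X \<in> V 1" "W = {Y \<in> V 1. k Y X \<ge> 0}"
    using W unfolding horizontal_half_space_def by blast
  have lin: "k (t *\<^sub>R Y) X = t * k Y X" if "Y \<in> V 1" for Y t
  proof -
    have "k (t *\<^sub>R Y + 0 *\<^sub>R Y) X = t * k Y X + 0 * k Y X"
      using k(1,2) that unfolding scalar_product_on_def by blast
    then show ?thesis by simp
  qed
  show "W \<subseteq> V 1" using k(3) by blast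
  show "Y \<in> W \<Longrightarrow> t \<ge> 0 \<Longrightarrow> t *\<^sub>R Y \<in> W" using k(3) lin V1_scale by auto
  show "Y \<in> V 1 \<Longrightarrow> Y \<in> W \<or> - Y \<in> W"
    using k(3) lin[of Y "-1"] V1_scale[of Y "-1"] by auto
  show "0 \<in> W" using k(3) lin[OF k(2), of 0] V1_zero by simp
qed

lemma SW_flow: "Y \<in> W \<Longrightarrow> t \<ge> 0 \<Longrightarrow> flow Y t \<in> SW"
  using gen_flow[OF W_scale W_V1, of Y t] flow_scale[of Y t 1] W_V1 by auto

lemma flow_zero: "flow 0 t = \<one>"
  using flow_scale[OF V1_zero, of 0 t] flow(1)[OF V1_zero] by simp

lemma SW_one: "\<one> \<in> SW"
  using gen_flow[OF W_zero W_V1] by (simp add: flow_zero)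

text \<open>Left multiplication by a forward flow keeps the points p of the orbit in
  \<open>SW\<close>, so the spanning set is mapped into itself.\<close>

lemma adj_half_flow:
  assumes h: "v \<in> span {adj p (ev Y) | p Y. p \<in> SW \<and> Y \<in> W}" and Y: "Y \<in> W" "t \<ge> 0"
  shows "adj (flow Y t) v \<in> span {adj p (ev Y) | p Y. p \<in> SW \<and> Y \<in> W}" (is "_ \<in> span ?H")
proof -
  have "adj (flow Y t) ` ?H \<subseteq> ?H"
  proof
    fix u assume "u \<in> adj (flow Y t) ` ?H"
    then obtain p Z where "u = adj (flow Y t) (adj p (ev Z))" "p \<in> SW" "Z \<in> W" by blast
    then have "u = adj (flow Y t \<otimes> p) (ev Z)" "flow Y t \<otimes> p \<in> SW"
      using gen_mult[OF SW_flow[OF Y]] by (simp_all add: adj_mult)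
    then show "u \<in> ?H" using \<open>Z \<in> W\<close> by blast
  qed
  then have sub: "span (adj (flow Y t) ` ?H) \<subseteq> span ?H" by (rule span_mono)
  have "adj (flow Y t) v \<in> adj (flow Y t) ` span ?H" using h by (rule imageI)
  then have "adj (flow Y t) v \<in> span (adj (flow Y t) ` ?H)"
    by (simp only: linear_span_image[OF linear_adj])
  then show ?thesis using sub by (rule subsetD[rotated])
qed

text \<open>For Y in \<open>V 1\<close> the curve \<open>adj (flow Y t) v\<close> stays in the span
  for all t of one sign. Subspaces are closed, so its derivative at 0, the bracket with Y, lies
  there too, and \<open>lie_algebra_generated\<close> applies.\<close>

lemma adj_span_UNIV: "span {adj p (ev Y) | p Y. p \<in> SW \<and> Y \<in> W} = UNIV"
proof -
  define H where "H = span {adj p (ev Y) | p Y. p \<in> SW \<and> Y \<in> W}"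
  have H: "subspace H" by (simp add: H_def)
  have WH: "ev Y \<in> H" if "Y \<in> W" for Y
    unfolding H_def by (rule span_base, rule CollectI, rule exI[of _ \<one>], rule exI[of _ Y]) (simp add: that SW_one adj_one)
  have V1H: "ev Y \<in> H" if Y: "Y \<in> V 1" for Y
  proof (cases "Y \<in> W")
    case False
    then have "- Y \<in> W" using W_or[OF Y] by blast
    from WH[OF this] have "- ev Y \<in> H" using ev_scale[OF Y, of "-1"] by simp
    then show ?thesis using subspace_neg[OF H, of "- ev Y"] by simp
  qed (use WH in blast)
  have br: "lie_bracket Y (lf v) \<in> lf ` H" if Y: "Y \<in> V 1" and v: "v \<in> H" for Y v
  proof -
    obtain D where D: "((\<lambda>t. adj (flow Y t) v) has_vector_derivative D) (at 0)" "lf D = lie_bracket Y (lf v)"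
      by (rule adj_flow_vector_derivative[OF Y])
    \<comment> \<open>The sign for which \<sigma> Y lies in \<open>W\<close>; the admissible times
      of \<open>flow Y\<close> are then \<sigma> t with t \<ge> 0.\<close>
    define \<sigma> :: real where "\<sigma> = (if Y \<in> W then 1 else - 1)"
    have \<sigma>: "\<sigma> \<noteq> 0" "\<sigma> *\<^sub>R Y \<in> W" "\<sigma> * \<sigma> = 1" using W_or[OF Y] by (auto simp: \<sigma>_def)
    have inH: "adj (flow Y (\<sigma> * t)) v \<in> H" if "t \<ge> 0" for t
      using adj_half_flow[OF v[unfolded H_def] \<sigma>(2) that] flow_scale[OF Y, of \<sigma> t] by (simp add: H_def)
    \<comment> \<open>Pairing with the orthogonal complement reduces membership of D in H to a
      scalar limit along times of the admissible sign.\<close>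
    have "D \<bullet> x = 0" if x: "x \<in> H\<^sup>\<bottom>" for x
    proof -
      have orth: "y \<bullet> x = 0" if "y \<in> H" for y
        using x that by (auto simp: orthogonal_comp_def orthogonal_def inner_commute)
      have "((\<lambda>t. adj (flow Y t) v \<bullet> x) has_real_derivative D \<bullet> x) (at 0)"
        unfolding has_real_derivative_iff_has_vector_derivative
        by (rule bounded_linear.has_vector_derivative[OF bounded_linear_inner_left D(1)])
      then have "(\<lambda>h. (adj (flow Y (0 + h)) v \<bullet> x - adj (flow Y 0) v \<bullet> x) / h) \<midarrow>0\<rightarrow> D \<bullet> x"
        by (simp only: DERIV_def)
      moreover have "filterlim (\<lambda>n. \<sigma> * inverse (real (Suc n))) (at 0) sequentially"
        unfolding filterlim_at using \<sigma>(1) LIMSEQ_inverse_real_of_nat tendsto_mult_right_zero by force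
      ultimately have "(\<lambda>n. (adj (flow Y (0 + \<sigma> * inverse (real (Suc n)))) v \<bullet> x - adj (flow Y 0) v \<bullet> x)
          / (\<sigma> * inverse (real (Suc n)))) \<longlonglongrightarrow> D \<bullet> x"
        by (rule filterlim_compose)
      moreover have "adj (flow Y (0 + \<sigma> * inverse (real (Suc n)))) v \<bullet> x = 0" "adj (flow Y 0) v \<bullet> x = 0" for n
        using orth[OF inH[of "inverse (real (Suc n))"]] orth[OF inH[of 0]] by simp_all
      ultimately show ?thesis by (simp add: LIMSEQ_const_iff)
    qed
    then have "D \<in> (H\<^sup>\<bottom>)\<^sup>\<bottom>" by (auto simp: orthogonal_comp_def orthogonal_def inner_commute)
    then have "D \<in> H" by (simp add: orthogonal_comp_self[OF H])
    then show ?thesis unfolding D(2)[symmetric] by (rule imageI)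
  qed
  have "lie_algebra G A \<subseteq> lf ` H"
  proof (rule lie_algebra_generated)
    show "subspace (lf ` H)" by (rule linear_subspace_image[OF linear_lf H])
    show "V 1 \<subseteq> lf ` H"
    proof
      fix Y assume Y: "Y \<in> V 1"
      show "Y \<in> lf ` H" by (rule image_eqI[where f = lf, OF V1_lf[OF Y, symmetric] V1H[OF Y]])
    qed
  qed (use br in blast)
  then have "v \<in> H" for v using lf_in_lie_algebra[of v] lf_inj by blast
  then show ?thesis by (auto simp: H_def)
qed

definition reach :: "real \<Rightarrow> 'g \<Rightarrow> bool" where
  "reach C x \<longleftrightarrow> (\<exists>l\<le>C. hc \<one> x l)"

lemma reach_mult: "reach a x \<Longrightarrow> reach b y \<Longrightarrow> reach (a + b) (x \<otimes> y)"
  unfolding reach_def using hc_mult add_mono by blast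

lemma reach_flow:
  assumes "Y \<in> V 1" shows "reach (\<bar>t\<bar> * sqrt (h Y Y)) (flow Y t)"
  using hc_flow[OF V1_scale[OF assms, of t]] assms flow_scale[OF assms, of t 1]
  unfolding reach_def by (auto simp: h_scale2 real_sqrt_mult)

lemma reach_one: "reach 0 \<one>" unfolding reach_def using hc_refl by blast

lemma reach_mono: "reach a x \<Longrightarrow> a \<le> b \<Longrightarrow> reach b x"
  unfolding reach_def by (meson order_trans)

lemma reach_gen:
  assumes "x \<in> gen K" "K \<subseteq> V 1" shows "\<exists>C. reach C x"
  using assms
proof (induction rule: gen_induct)
  case (flow Y)
  then show ?case using reach_flow assms(2) by blast
next
  case (mult x y)
  then show ?case using reach_mult by blast
qed

lemma mult_inv_cancel_right: "(x \<otimes> a) \<otimes> inv (y \<otimes> a) = x \<otimes> inv y"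
proof -
  have "(x \<otimes> a) \<otimes> inv (y \<otimes> a) = ((x \<otimes> a) \<otimes> inv a) \<otimes> inv y"
    by (simp add: inv_mult_group m_assoc[symmetric])
  also have "(x \<otimes> a) \<otimes> inv a = x" by (simp add: m_assoc)
  finally show ?thesis .
qed

text \<open>One flow factor is multiplied per basis direction. Since the adjoint orbit of \<open>W\<close> under
  \<open>SW\<close> spans, the factors in between can be chosen to make the velocities at \<open>One\<close> independent.\<close>

lemma nested_flows:
  assumes "finite B" "B \<subseteq> (Basis :: 'e set)"
  shows "\<exists>\<alpha> v. smooth_into UNIV (\<alpha> :: 'e \<Rightarrow> 'g) \<and> (\<forall>t. (\<forall>b\<in>Basis. 0 \<le> t \<bullet> b) \<longrightarrow> \<alpha> t \<in> SW) \<and>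
    (\<exists>C. \<forall>t. (\<forall>b\<in>Basis. 0 \<le> t \<bullet> b \<and> t \<bullet> b \<le> 2) \<longrightarrow> reach C (\<alpha> t)) \<and>
    (\<forall>b\<in>Basis - B. \<forall>t r. \<alpha> (t + r *\<^sub>R b) = \<alpha> t) \<and>
    (\<forall>b\<in>B. \<forall>f. sf f \<longrightarrow> ((\<lambda>r. f (\<alpha> (One + r *\<^sub>R b) \<otimes> inv (\<alpha> One))) has_real_derivative lf (v b) f \<one>) (at 0)) \<and>
    independent (v ` B) \<and> inj_on v B"
  using assms
proof (induction B rule: finite_induct)
  case empty
  show ?case
    by (intro exI[of _ "\<lambda>t. \<one>"] exI[of _ "\<lambda>b. 0"])
      (use SW_one reach_one in \<open>auto simp: smooth_into_const independent_empty\<close>)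
next
  case (insert b B)
  then have bB: "b \<in> Basis" "b \<notin> B" "B \<subseteq> Basis" by auto
  obtain \<alpha> v C where \<alpha>: "smooth_into UNIV \<alpha>" "\<And>t. (\<forall>b\<in>Basis. 0 \<le> t \<bullet> b) \<Longrightarrow> \<alpha> t \<in> SW"
    "\<And>t. (\<forall>b\<in>Basis. 0 \<le> t \<bullet> b \<and> t \<bullet> b \<le> 2) \<Longrightarrow> reach C (\<alpha> t)"
    "\<And>b t r. b \<in> Basis - B \<Longrightarrow> \<alpha> (t + r *\<^sub>R b) = \<alpha> t"
    "\<And>b f. b \<in> B \<Longrightarrow> sf f \<Longrightarrow> ((\<lambda>r. f (\<alpha> (One + r *\<^sub>R b) \<otimes> inv (\<alpha> One))) has_real_derivative lf (v b) f \<one>) (at 0)"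
    "independent (v ` B)" "inj_on v B"
    using insert.IH[OF bB(3)] by (elim exE conjE) blast
  \<comment> \<open>Otherwise fewer than DIM('e) vectors would span the image of the whole space
    under the surjection \<open>adj (\<alpha> One)\<close>.\<close>
  have "\<exists>q Y. q \<in> SW \<and> Y \<in> W \<and> adj (\<alpha> One) (adj q (ev Y)) \<notin> span (v ` B)"
  proof (rule ccontr)
    assume "\<not> ?thesis"
    then have "{adj p (ev Y) | p Y. p \<in> SW \<and> Y \<in> W} \<subseteq> adj (\<alpha> One) -` span (v ` B)" by blast
    moreover have "subspace (adj (\<alpha> One) -` span (v ` B))"
      by (intro linear_subspace_vimage linear_adj) simp
    ultimately have "span {adj p (ev Y) | p Y. p \<in> SW \<and> Y \<in> W} \<subseteq> adj (\<alpha> One) -` span (v ` B)"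
      by (rule span_minimal)
    then have "adj (\<alpha> One) u \<in> span (v ` B)" for u unfolding adj_span_UNIV by auto
    then have "UNIV \<subseteq> span (v ` B)" using surj_adj[of "\<alpha> One"] by (metis subsetI surjD)
    then have "dim (UNIV :: 'e set) \<le> card (v ` B)" by (rule dim_le_card) (simp add: insert.hyps(1))
    also have "\<dots> \<le> card B" by (rule card_image_le) (rule insert.hyps(1))
    also have "\<dots> < card (Basis :: 'e set)"
      using bB by (intro psubset_card_mono) auto
    finally show False by simp
  qed
  then obtain q Y where qY: "q \<in> SW" "Y \<in> W" "adj (\<alpha> One) (adj q (ev Y)) \<notin> span (v ` B)" by blast
  then have Y: "Y \<in> V 1" using W_V1 by blast
  obtain Cq where Cq: "reach Cq q" using reach_gen[OF qY(1) W_V1] by blast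
  \<comment> \<open>The new factors stand on the right: they cancel in the velocities of the old
    directions, while the new direction contributes Ad(\<alpha>(One) q) applied to Y. Velocities are
    taken at \<open>One\<close> because it is interior to the orthant of nonnegative times.\<close>
  let ?\<alpha> = "\<lambda>t. \<alpha> t \<otimes> q \<otimes> flow Y (t \<bullet> b)" and ?v = "v(b := adj (\<alpha> One) (adj q (ev Y)))"
  have OneB: "One \<bullet> c = 1" if "c \<in> Basis" for c :: 'e using that by (rule inner_sum_Basis)
  show ?case
  proof (intro exI[of _ ?\<alpha>] exI[of _ ?v] conjI allI impI ballI)
    show "smooth_into UNIV ?\<alpha>"
      by (intro smooth_into_mult \<alpha>(1) smooth_into_const open_UNIV
          smooth_into_compose[OF flow_smooth[OF Y] open_UNIV smooth_on_linear[OF open_UNIV bounded_linear_inner_left]]) auto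
    show "?\<alpha> t \<in> SW" if "\<forall>b\<in>Basis. 0 \<le> t \<bullet> b" for t
      using that bB(1) by (intro gen_mult \<alpha>(2) qY(1) SW_flow[OF qY(2)]) auto
    show "\<exists>C. \<forall>t. (\<forall>b\<in>Basis. 0 \<le> t \<bullet> b \<and> t \<bullet> b \<le> 2) \<longrightarrow> reach C (?\<alpha> t)"
    proof (intro exI allI impI)
      fix t :: 'e assume t: "\<forall>b\<in>Basis. 0 \<le> t \<bullet> b \<and> t \<bullet> b \<le> 2"
      have "reach (2 * sqrt (h Y Y)) (flow Y (t \<bullet> b))"
        by (rule reach_mono[OF reach_flow[OF Y]]) (use t bB(1) h_nonneg[OF Y] in \<open>auto intro!: mult_right_mono\<close>)
      then show "reach (C + Cq + 2 * sqrt (h Y Y)) (?\<alpha> t)"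
        by (intro reach_mult \<alpha>(3)[OF t] Cq)
    qed
    show "?\<alpha> (t + r *\<^sub>R c) = ?\<alpha> t" if "c \<in> Basis - insert b B" for c t r
      using that bB(1) \<alpha>(4)[of c t r] by (simp add: inner_add_left inner_not_same_Basis)
    show "((\<lambda>r. f (?\<alpha> (One + r *\<^sub>R c) \<otimes> inv (?\<alpha> One))) has_real_derivative lf (?v c) f \<one>) (at 0)"
      if c: "c \<in> insert b B" and f: "sf f" for c f
    proof (cases "c = b")
      case False
      then have cB: "c \<in> B" using c by blast
      have "(\<lambda>r. f (?\<alpha> (One + r *\<^sub>R c) \<otimes> inv (?\<alpha> One))) = (\<lambda>r. f (\<alpha> (One + r *\<^sub>R c) \<otimes> inv (\<alpha> One)))"
      proof
        fix r
        have "(One + r *\<^sub>R c) \<bullet> b = One \<bullet> b"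
          using False cB bB by (auto simp: inner_add_left inner_not_same_Basis)
        then have "?\<alpha> (One + r *\<^sub>R c) \<otimes> inv (?\<alpha> One) = \<alpha> (One + r *\<^sub>R c) \<otimes> (q \<otimes> flow Y (One \<bullet> b)) \<otimes> inv (\<alpha> One \<otimes> (q \<otimes> flow Y (One \<bullet> b)))"
          by (simp add: m_assoc)
        also have "\<dots> = \<alpha> (One + r *\<^sub>R c) \<otimes> inv (\<alpha> One)" by (rule mult_inv_cancel_right)
        finally show "f (?\<alpha> (One + r *\<^sub>R c) \<otimes> inv (?\<alpha> One)) = f (\<alpha> (One + r *\<^sub>R c) \<otimes> inv (\<alpha> One))" by simp
      qed
      then show ?thesis using \<alpha>(5)[OF cB f] False by simp
    next
      case True
      let ?p = "\<alpha> One \<otimes> q"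
      have "(\<lambda>r. f (?\<alpha> (One + r *\<^sub>R c) \<otimes> inv (?\<alpha> One))) = (\<lambda>r. f (?p \<otimes> flow Y r \<otimes> inv ?p))"
      proof
        fix r
        have "(One + r *\<^sub>R c) \<bullet> b = r + 1" "\<alpha> (One + r *\<^sub>R c) = \<alpha> One"
          using True bB \<alpha>(4)[of b One r] OneB[of b] by (auto simp: inner_add_left)
        then have "?\<alpha> (One + r *\<^sub>R c) \<otimes> inv (?\<alpha> One) = ?p \<otimes> (flow Y r \<otimes> flow Y 1) \<otimes> inv (?p \<otimes> flow Y 1)"
          using OneB[OF bB(1)] by (simp add: flow_add[OF Y])
        also have "\<dots> = (?p \<otimes> flow Y r \<otimes> flow Y 1) \<otimes> inv (?p \<otimes> flow Y 1)" by (simp add: m_assoc)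
        also have "\<dots> = ?p \<otimes> flow Y r \<otimes> inv ?p" by (rule mult_inv_cancel_right)
        finally show "f (?\<alpha> (One + r *\<^sub>R c) \<otimes> inv (?\<alpha> One)) = f (?p \<otimes> flow Y r \<otimes> inv ?p)" by simp
      qed
      moreover have "((\<lambda>r. f (?p \<otimes> flow Y r \<otimes> inv ?p)) has_real_derivative lf (ev Y) (\<lambda>x. f (?p \<otimes> x \<otimes> inv ?p)) (flow Y 0)) (at 0)"
        by (rule curve_onD[OF flow(2)[OF Y] sf_conj[OF f] UNIV_I])
      moreover have "lf (ev Y) (\<lambda>x. f (?p \<otimes> x \<otimes> inv ?p)) (flow Y 0) = lf (?v c) f \<one>"
        using True lf_adj[OF f, of ?p "ev Y"] by (simp add: flow(1)[OF Y] adj_mult)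
      ultimately show ?thesis by simp
    qed
    have im: "?v ` insert b B = insert (adj (\<alpha> One) (adj q (ev Y))) (v ` B)" using bB(2) by auto
    show "independent (?v ` insert b B)"
      unfolding im using \<alpha>(6) qY(3) by (simp add: independent_insert)
    show "inj_on ?v (insert b B)"
    proof -
      have nin: "adj (\<alpha> One) (adj q (ev Y)) \<notin> v ` B"
        using contra_subsetD[OF span_superset qY(3)] .
      have "?v ` (B - {b}) = v ` B" using bB(2) by auto
      moreover have "inj_on ?v B" using inj_on_fun_updI[OF \<alpha>(7) nin] .
      ultimately show ?thesis using nin by (simp add: inj_on_insert del: fun_upd_image)
    qed
  qed
qed

text \<open>The velocities span, so the map is open at \<open>One\<close>.\<close>

lemma reachable_interior:
  obtains T P C where "T \<subseteq> SW" "P \<in> interior T" "\<And>x. x \<in> T \<Longrightarrow> reach C x"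
proof -
  obtain \<alpha> v C where \<alpha>: "smooth_into UNIV (\<alpha> :: 'e \<Rightarrow> 'g)" "\<And>t. (\<forall>b\<in>Basis. 0 \<le> t \<bullet> b) \<Longrightarrow> \<alpha> t \<in> SW"
    "\<And>t. (\<forall>b\<in>Basis. 0 \<le> t \<bullet> b \<and> t \<bullet> b \<le> 2) \<Longrightarrow> reach C (\<alpha> t)"
    "\<And>b f. b \<in> Basis \<Longrightarrow> sf f \<Longrightarrow> ((\<lambda>r. f (\<alpha> (One + r *\<^sub>R b) \<otimes> inv (\<alpha> One))) has_real_derivative lf (v b) f \<one>) (at 0)"
    "independent (v ` Basis)" "inj_on v Basis"
    using nested_flows[OF finite_Basis subset_refl] by (elim exE conjE) blast
  let ?P = "\<alpha> One"
  \<comment> \<open>Translated so that \<open>One\<close> goes to \<open>\<one>\<close>, where the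
    distinguished chart applies.\<close>
  define \<beta> where "\<beta> = (\<lambda>t. \<alpha> t \<otimes> inv ?P)"
  have \<beta>: "smooth_into UNIV \<beta>" unfolding \<beta>_def by (intro smooth_into_mult \<alpha>(1) smooth_into_const open_UNIV)
  have b1: "\<beta> One = \<one>" by (simp add: \<beta>_def)
  let ?U = "fst chart1" and ?\<phi> = "snd chart1"
  let ?N = "UNIV \<inter> \<beta> -` ?U" and ?g = "\<lambda>t. ?\<phi> (\<beta> t)"
  note N = smooth_into_chart[OF \<beta> chart1(1)]
  have ON: "One \<in> ?N" using b1 chart1(2) by simp
  let ?D = "frechet_derivative ?g (at One)"
  have D: "(?g has_derivative ?D) (at One)" by (rule smooth_on_has_derivative[OF N(2,1) ON])
  obtain X M where XM: "coord_at_one X M" by (rule coord_exists)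
  then have M: "open M" "\<one> \<in> M" "M \<subseteq> ?U" and X: "\<And>b. sf (X b)"
    and XX: "\<And>b y. b \<in> Basis \<Longrightarrow> y \<in> M \<Longrightarrow> X b y = (?\<phi> y - e1) \<bullet> b"
    by (auto simp: coord_at_one_def)
  have Db: "?D b = v b" if b: "b \<in> Basis" for b
  proof (rule euclidean_eqI)
    fix c :: 'e assume c: "c \<in> Basis"
    have "((\<lambda>r. One + r *\<^sub>R b) has_derivative (\<lambda>r. r *\<^sub>R b)) (at (0::real))"
      by (auto intro!: derivative_eq_intros)
    moreover have "(?g has_derivative ?D) (at (One + 0 *\<^sub>R b))" using D by simp
    ultimately have "((\<lambda>r. ?g (One + r *\<^sub>R b)) has_derivative (\<lambda>r. ?D (r *\<^sub>R b))) (at 0)"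
      by (rule has_derivative_compose)
    then have "((\<lambda>r. (?g (One + r *\<^sub>R b) - e1) \<bullet> c) has_derivative (\<lambda>r. (?D (r *\<^sub>R b) - 0) \<bullet> c)) (at 0)"
      by (intro has_derivative_inner_left has_derivative_diff has_derivative_const)
    then have 1: "((\<lambda>r. X c (\<beta> (One + r *\<^sub>R b))) has_derivative (\<lambda>r. (?D (r *\<^sub>R b) - 0) \<bullet> c)) (at 0)"
    proof (rule has_derivative_transform_within_open)
      have "continuous_on UNIV (\<lambda>r. \<beta> (One + r *\<^sub>R b))"
        by (rule continuous_on_compose2[OF smooth_into_continuous[OF \<beta>]]) (auto intro!: continuous_intros)
      then show "open ((\<lambda>r. \<beta> (One + r *\<^sub>R b)) -` M)" using M(1) by (simp add: open_vimage)
      show "0 \<in> (\<lambda>r. \<beta> (One + r *\<^sub>R b)) -` M" using M(2) b1 by simp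
    qed (use XX c in auto)
    have "((\<lambda>r. X c (\<beta> (One + r *\<^sub>R b))) has_derivative (*) (lf (v b) (X c) \<one>)) (at 0)"
      using \<alpha>(4)[OF b X, of c] by (simp add: \<beta>_def has_field_derivative_def)
    from fun_cong[OF has_derivative_unique[OF 1 this], of 1]
    show "?D b \<bullet> c = v b \<bullet> c" by (simp add: lf_coord[OF XM c])
  qed
  have lD: "linear ?D" using D by (rule has_derivative_linear)
  have "card (v ` Basis) = DIM('e)" using \<alpha>(6) by (simp add: card_image)
  then have "span (v ` Basis) = UNIV"
    using card_ge_dim_independent[of "v ` Basis" UNIV] \<alpha>(5) by auto
  moreover have "v ` Basis = ?D ` Basis" using Db by (intro image_cong) auto
  ultimately have "surj ?D"
    using linear_span_image[OF lD, of Basis] by simp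
  then obtain g' where g': "linear g'" "?D \<circ> g' = id"
    using linear_surjective_right_inverse[OF lD] by blast
  \<comment> \<open>Positive times keep the values in \<open>SW\<close>, the upper bound 2 makes the
    length bound uniform, and \<open>One\<close> is an interior point.\<close>
  define Q where "Q = ?N \<inter> box 0 (2 *\<^sub>R One)"
  have oQ: "open Q" unfolding Q_def using N(1) open_box by (rule open_Int)
  have OQ: "One \<in> Q" unfolding Q_def using ON by (simp add: mem_box)
  have gi: "?g One \<in> interior (?g ` Q)"
  proof (rule sussmann_open_mapping[OF N(1) smooth_on_continuous[OF N(2,1)] ON D])
    show "bounded_linear g'" using g'(1) by (simp add: linear_conv_bounded_linear)
    show "One \<in> interior Q" using OQ oQ by (simp add: interior_open)
  qed (use g'(2) in \<open>auto simp: Q_def\<close>)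
  have gO: "?g One = e1" by (simp add: b1 e1_def)
  have bi: "\<one> \<in> interior (\<beta> ` Q)"
  proof (rule interiorI)
    let ?O = "?U \<inter> ?\<phi> -` interior (?g ` Q)"
    show "open ?O" by (rule continuous_open_preimage[OF chart(3,1)[OF chart1(1)] open_interior])
    show "\<one> \<in> ?O" using chart1(2) gi gO by (simp add: e1_def)
    show "?O \<subseteq> \<beta> ` Q"
    proof
      fix x assume x: "x \<in> ?O"
      then have "?\<phi> x \<in> ?g ` Q" using interior_subset by blast
      then obtain t where t: "t \<in> Q" "?\<phi> x = ?\<phi> (\<beta> t)" by blast
      then have "\<beta> t \<in> ?U" by (simp add: Q_def)
      then have "x = \<beta> t" using x t(2) xi_phi by (metis IntD1)
      then show "x \<in> \<beta> ` Q" using t(1) by blast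
    qed
  qed
  have Pi: "?P \<in> interior (\<alpha> ` Q)"
  proof (rule interiorI)
    let ?O = "(\<lambda>x. x \<otimes> inv ?P) -` interior (\<beta> ` Q)"
    show "open ?O" by (intro open_vimage open_interior continuous_on_mult continuous_on_id continuous_on_const)
    show "?P \<in> ?O" using bi by simp
    show "?O \<subseteq> \<alpha> ` Q"
    proof
      fix x assume "x \<in> ?O"
      then have "x \<otimes> inv ?P \<in> \<beta> ` Q" using interior_subset by blast
      then obtain t where "t \<in> Q" "x \<otimes> inv ?P = \<alpha> t \<otimes> inv ?P" by (auto simp: \<beta>_def)
      then show "x \<in> \<alpha> ` Q" by auto
    qed
  qed
  have box: "0 \<le> t \<bullet> b \<and> t \<bullet> b \<le> 2" if "t \<in> Q" "b \<in> Basis" for t b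
    using that by (auto simp: Q_def mem_box intro: less_imp_le)
  show ?thesis
  proof (rule that[of "\<alpha> ` Q" ?P C])
    show "\<alpha> ` Q \<subseteq> SW" using box by (auto intro!: \<alpha>(2))
    show "reach C x" if "x \<in> \<alpha> ` Q" for x using that box by (auto intro!: \<alpha>(3))
  qed (rule Pi)
qed

lemma interior_SW: "interior SW \<noteq> {}"
  using reachable_interior interior_mono by (metis empty_iff subsetD)

end

section \<open>The Carnot distance\<close>

lemma homotopic_canonI:
  fixes H :: "real \<times> 'a::topological_space \<Rightarrow> 'b::topological_space"
  assumes "continuous_on ({0..1} \<times> S) H" "\<And>t x. t \<in> {0..1} \<Longrightarrow> x \<in> S \<Longrightarrow> H (t, x) \<in> T"
    "\<And>x. H (0, x) = f x" "\<And>x. H (1, x) = g x"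
  shows "homotopic_with_canon (\<lambda>_. True) S T f g"
proof -
  have "continuous_map (top_of_set ({0..1} \<times> S)) (top_of_set T) H"
    using assms(1,2) by auto
  then have "continuous_map (prod_topology (top_of_set {0..1}) (top_of_set S)) (top_of_set T) H"
    by (simp only: prod_topology_subtopology_eu)
  note H = this
  show ?thesis
    unfolding homotopic_with_def by (intro exI[of _ H] conjI H allI ballI TrueI assms(3,4))
qed

text \<open>The constant loops at a and b are homotopic, and the track of the base point is a
  connected set containing both.\<close>

lemma connected_of_simply_connected:
  assumes "simply_connected (UNIV :: 'a::topological_space set)"
  shows "connected (UNIV :: 'a set)"
proof (subst connected_iff_connected_component, intro ballI, subst connected_component_def)
  fix a b :: 'a
  have "homotopic_loops UNIV (\<lambda>_. a) (\<lambda>_. b)"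
    using assms unfolding simply_connected_def
    by (auto simp: path_def pathfinish_def pathstart_def)
  then obtain H where H: "continuous_on ({0..1::real} \<times> {0..1::real}) H" "\<forall>x\<in>{0..1}. H (0, x) = a" "\<forall>x\<in>{0..1}. H (1, x) = b"
    unfolding homotopic_loops by blast
  have "continuous_on {0..1::real} (\<lambda>t. H (t, 0))"
    by (rule continuous_on_compose2[OF H(1)]) (auto intro!: continuous_intros)
  then have "connected ((\<lambda>t. H (t, 0)) ` {0..1::real})"
    by (rule connected_continuous_image) simp
  moreover have "a \<in> (\<lambda>t. H (t, 0)) ` {0..1::real}" "b \<in> (\<lambda>t. H (t, 0)) ` {0..1::real}"
    using H(2,3) by (force intro: image_eqI[of _ _ 0] image_eqI[of _ _ 1])+
  ultimately show "\<exists>T. connected T \<and> T \<subseteq> UNIV \<and> a \<in> T \<and> b \<in> T" by blast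
qed

context half_space begin

lemma gen_V1_inv:
  assumes "x \<in> gen (V 1)" shows "inv x \<in> gen (V 1)"
  using assms subset_refl[of "V 1"]
proof (induction rule: gen_induct)
  case (flow Y)
  have "inv (flow Y 1) = flow ((-1) *\<^sub>R Y) 1"
    using flow_scale[OF flow, of "-1" 1] flow_minus[OF flow, of 1] by simp
  then show ?case using gen_flow[OF V1_scale[OF flow, of "-1"] subset_refl] by simp
next
  case (mult x y)
  then show ?case by (simp add: inv_mult_group gen_mult)
qed

text \<open>The open part of the semigroup is moved back to \<open>\<one>\<close> by
  \<open>inv P\<close>, which is reachable because \<open>V 1\<close> is symmetric, although it need
  not lie in \<open>SW\<close>. Its length is added to the uniform bound.\<close>

lemma reachable_nbhd:
  obtains U C where "open U" "\<one> \<in> U" "U \<subseteq> gen (V 1)" "C > 0" "\<And>x. x \<in> U \<Longrightarrow> reach C x"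
proof -
  obtain T P C where T: "T \<subseteq> SW" "P \<in> interior T" "\<And>x. x \<in> T \<Longrightarrow> reach C x"
    by (rule reachable_interior) blast
  have sub: "SW \<subseteq> gen (V 1)" using W_V1 unfolding generated_semigroup_def by blast
  have TG: "interior T \<subseteq> gen (V 1)" using T(1) sub interior_subset by blast
  then have iP: "inv P \<in> gen (V 1)" using T(2) gen_V1_inv by blast
  then obtain C' where C': "reach C' (inv P)" using reach_gen by blast
  let ?U = "(\<lambda>x. P \<otimes> x) -` interior T"
  have x: "x = inv P \<otimes> (P \<otimes> x)" for x by (simp add: m_assoc[symmetric])
  show ?thesis
  \<comment> \<open>The maximum with 1 makes the bound positive, as a later division by it
    requires.\<close>
  proof (rule that[of ?U "max (C' + C) 1"])
    show "open ?U" by (intro open_vimage open_interior continuous_on_mult continuous_on_const continuous_on_id)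
    show "\<one> \<in> ?U" using T(2) by simp
    show "?U \<subseteq> gen (V 1)"
    proof
      fix x assume "x \<in> ?U"
      then have "P \<otimes> x \<in> gen (V 1)" using TG by auto
      from gen_mult[OF iP this] have "inv P \<otimes> (P \<otimes> x) \<in> gen (V 1)" .
      then show "x \<in> gen (V 1)" using x[of x] by simp
    qed
    fix y assume "y \<in> ?U"
    then have "P \<otimes> y \<in> T" using interior_subset by auto
    from reach_mult[OF C' T(3)[OF this]] have "reach (C' + C) y" using x[of y] by simp
    then show "reach (max (C' + C) 1) y" by (rule reach_mono) simp
  qed simp
qed

text \<open>A subgroup containing a neighbourhood of \<open>\<one>\<close> is both open and closed,
  and the group is connected.\<close>

lemma gen_V1: "gen (V 1) = UNIV"
proof -
  obtain U C where U: "open U" "\<one> \<in> U" "U \<subseteq> gen (V 1)" by (rule reachable_nbhd) blast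
  have opn: "open ((\<lambda>y. inv x \<otimes> y) -` U)" for x
    by (intro open_vimage U(1) continuous_on_mult continuous_on_const continuous_on_id)
  have o1: "open (gen (V 1))"
  proof (subst open_subopen, intro ballI)
    fix x assume x: "x \<in> gen (V 1)"
    have "(\<lambda>y. inv x \<otimes> y) -` U \<subseteq> gen (V 1)"
    proof
      fix y assume "y \<in> (\<lambda>y. inv x \<otimes> y) -` U"
      then have "inv x \<otimes> y \<in> gen (V 1)" using U(3) by auto
      from gen_mult[OF x this] show "y \<in> gen (V 1)" by (simp add: m_assoc[symmetric])
    qed
    then show "\<exists>T. open T \<and> x \<in> T \<and> T \<subseteq> gen (V 1)" using opn[of x] U(2) by (intro exI[of _ "(\<lambda>y. inv x \<otimes> y) -` U"]) auto
  qed
  have o2: "open (- gen (V 1))"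
  proof (subst open_subopen, intro ballI)
    fix x assume x: "x \<in> - gen (V 1)"
    have "(\<lambda>y. inv x \<otimes> y) -` U \<subseteq> - gen (V 1)"
    proof
      fix y assume y: "y \<in> (\<lambda>y. inv x \<otimes> y) -` U"
      have "x \<in> gen (V 1)" if "y \<in> gen (V 1)"
      proof -
        have "inv (inv x \<otimes> y) \<in> gen (V 1)" using y U(3) gen_V1_inv by auto
        from gen_mult[OF that this] show ?thesis by (simp add: inv_mult_group m_assoc[symmetric])
      qed
      then show "y \<in> - gen (V 1)" using x by blast
    qed
    then show "\<exists>T. open T \<and> x \<in> T \<and> T \<subseteq> - gen (V 1)" using opn[of x] U(2) by (intro exI[of _ "(\<lambda>y. inv x \<otimes> y) -` U"]) auto
  qed
  have "connected (UNIV :: 'g set)"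
    using carnot connected_of_simply_connected by (auto simp: carnot_group_def)
  from connectedD[OF this o1 o2] show ?thesis using U(2,3) by auto
qed

lemma V1_induct [case_names flow mult]:
  assumes "\<And>Y. Y \<in> V 1 \<Longrightarrow> P (flow Y 1)" "\<And>x y. P x \<Longrightarrow> P y \<Longrightarrow> P (x \<otimes> y)"
  shows "P x"
proof -
  have "x \<in> gen (V 1)" by (simp add: gen_V1)
  then show ?thesis using subset_refl[of "V 1"]
    by (induction rule: gen_induct) (use assms in auto)
qed

text \<open>Each dilation is prescribed on horizontal flows through its differential, so the
  composition law is checked there and extended over products.\<close>

lemma dil_dil:
  assumes "a > 0" "b > 0" shows "\<delta> a (\<delta> b x) = \<delta> (a * b) x"
proof (induction x rule: V1_induct)
  case (flow Y)
  then show ?case using assms by (simp add: dil_flow mult.assoc)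
next
  case (mult x y)
  then show ?case using assms by (simp add: dil_hom)
qed

lemma dil_1: "\<delta> 1 x = x"
proof (induction x rule: V1_induct)
  case (flow Y)
  then show ?case by (simp add: dil_flow)
next
  case (mult x y)
  then show ?case by (simp add: dil_hom)
qed

lemma dil_inverse: "t > 0 \<Longrightarrow> \<delta> t (\<delta> (1/t) x) = x" "t > 0 \<Longrightarrow> \<delta> (1/t) (\<delta> t x) = x"
  by (simp_all add: dil_dil dil_1)

lemma dil_image: "t > 0 \<Longrightarrow> \<delta> t ` B = \<delta> (1/t) -` B"
proof (intro equalityI subsetI)
  fix x assume t: "t > 0" and "x \<in> \<delta> (1/t) -` B"
  then show "x \<in> \<delta> t ` B" using dil_inverse(1)[OF t, of x] by (intro image_eqI[of _ _ "\<delta> (1/t) x"]) auto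
qed (auto simp: dil_inverse)

lemma dil_open: "t > 0 \<Longrightarrow> open B \<Longrightarrow> open (\<delta> t ` B)"
  unfolding dil_image by (intro open_vimage dil_continuous) auto

text \<open>The value \<open>\<one>\<close> at t = 0 is the limit of the dilations and provides the
  endpoint of the contractions.\<close>

definition dl :: "real \<Rightarrow> 'g \<Rightarrow> 'g" where "dl t x = (if t = 0 then \<one> else \<delta> t x)"

lemma dl_0 [simp]: "dl 0 x = \<one>" and dl_pos: "t > 0 \<Longrightarrow> dl t x = \<delta> t x" and dl_1 [simp]: "dl 1 x = x"
  by (auto simp: dl_def dil_1)

lemma dl_mult: "t \<ge> 0 \<Longrightarrow> dl t (x \<otimes> y) = dl t x \<otimes> dl t y"
  by (auto simp: dl_def dil_hom)

lemma dl_flow: "t \<ge> 0 \<Longrightarrow> Y \<in> V 1 \<Longrightarrow> dl t (flow Y a) = flow Y (t * a)"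
  by (auto simp: dl_def dil_flow flow)

lemma dl_continuous1: "continuous_on {0..} (\<lambda>t. dl t x)"
proof (induction x rule: V1_induct)
  case (flow Y)
  have "continuous_on {0..} (flow Y)"
    using smooth_into_continuous[OF flow_smooth[OF flow]] by (rule continuous_on_subset) simp
  then show ?case by (rule continuous_on_eq) (use flow in \<open>auto simp: dl_flow\<close>)
next
  case (mult x y)
  from continuous_on_mult[OF mult] show ?case by (rule continuous_on_eq) (auto simp: dl_mult)
qed

section \<open>The homogeneous norm and the topology it induces\<close>

definition cc_norm :: "'g \<Rightarrow> real" where "cc_norm x = Inf {l. hc \<one> x l}"

lemma hc_exists: "\<exists>l. hc \<one> x l"
  using reach_gen[of x "V 1"] by (auto simp: gen_V1 reach_def)

lemma hc_bdd: "bdd_below {l. hc x y l}"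
  by (rule bdd_belowI[of _ 0]) (auto simp: hc_nonneg)

lemma cc_norm_nonneg: "cc_norm x \<ge> 0"
  unfolding cc_norm_def by (rule cInf_greatest) (use hc_exists hc_nonneg in auto)

lemma cc_norm_le: "hc \<one> x l \<Longrightarrow> cc_norm x \<le> l"
  unfolding cc_norm_def by (rule cInf_lower) (auto simp: hc_bdd)

lemma cc_norm_less: "cc_norm x < c \<Longrightarrow> \<exists>l<c. hc \<one> x l"
  using cInf_lessD[of "{l. hc \<one> x l}" c] hc_exists[of x] by (auto simp: cc_norm_def)

lemma cc_norm_one: "cc_norm \<one> = 0"
  using cc_norm_le[OF hc_refl] cc_norm_nonneg[of \<one>] by simp

lemma cc_norm_triangle: "cc_norm (x \<otimes> y) \<le> cc_norm x + cc_norm y"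
proof (rule field_le_epsilon)
  fix e :: real assume e: "e > 0"
  obtain a b where ab: "hc \<one> x a" "a < cc_norm x + e/2" "hc \<one> y b" "b < cc_norm y + e/2"
    using cc_norm_less[of x "cc_norm x + e/2"] cc_norm_less[of y "cc_norm y + e/2"] e by auto
  show "cc_norm (x \<otimes> y) \<le> cc_norm x + cc_norm y + e" using cc_norm_le[OF hc_mult[OF ab(1,3)]] ab by simp
qed

lemma cc_norm_dil_le: "t > 0 \<Longrightarrow> cc_norm (\<delta> t x) \<le> t * cc_norm x"
proof (rule field_le_epsilon)
  fix e :: real assume e: "e > 0" and t: "t > 0"
  obtain a where a: "hc \<one> x a" "a < cc_norm x + e / t" using cc_norm_less[of x "cc_norm x + e / t"] e t by auto
  have "hc \<one> (\<delta> t x) (t * a)" using hc_dil[OF t a(1)] by (simp add: dil_one t)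
  then have "cc_norm (\<delta> t x) \<le> t * a" by (rule cc_norm_le)
  also have "\<dots> \<le> t * (cc_norm x + e / t)" using a(2) t by (intro mult_left_mono) auto
  finally show "cc_norm (\<delta> t x) \<le> t * cc_norm x + e" using t by (simp add: algebra_simps)
qed

lemma cc_norm_dil: assumes t: "t > 0" shows "cc_norm (\<delta> t x) = t * cc_norm x"
proof (rule antisym[OF cc_norm_dil_le[OF t]])
  have "cc_norm (\<delta> (1/t) (\<delta> t x)) \<le> (1/t) * cc_norm (\<delta> t x)" by (rule cc_norm_dil_le) (use t in simp)
  then show "t * cc_norm x \<le> cc_norm (\<delta> t x)" using t by (simp add: dil_inverse field_simps)
qed

lemma cc_norm_dl: "t \<ge> 0 \<Longrightarrow> cc_norm (dl t x) = t * cc_norm x"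
  by (auto simp: dl_def cc_norm_one cc_norm_dil)

lemma carnot_distance_cc_norm: "carnot_distance A (V 1) h x y = cc_norm (inv x \<otimes> y)"
proof -
  have "hc x y l \<longleftrightarrow> hc \<one> (inv x \<otimes> y) l" for l
    using hc_translate[of x y l "inv x"] hc_translate[of \<one> "inv x \<otimes> y" l x]
    by (auto simp: m_assoc[symmetric])
  then show ?thesis by (simp add: carnot_distance_hc cc_norm_def)
qed

lemma cc_norm_small_nbhd:
  assumes "open U" "\<one> \<in> U" obtains \<epsilon> where "\<epsilon> > 0" "\<And>x. cc_norm x < \<epsilon> \<Longrightarrow> x \<in> U"
proof -
  obtain \<epsilon> where \<epsilon>: "\<epsilon> > 0" "\<And>x l. hc \<one> x l \<Longrightarrow> l < \<epsilon> \<Longrightarrow> x \<in> U"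
    using short_curves_stay[OF assms] by blast
  show ?thesis
  proof (rule that[OF \<epsilon>(1)])
    fix x assume "cc_norm x < \<epsilon>"
    then obtain l where "l < \<epsilon>" "hc \<one> x l" using cc_norm_less by blast
    then show "x \<in> U" using \<epsilon>(2) by blast
  qed
qed

text \<open>Lengths are uniformly bounded by C on one neighbourhood of \<open>\<one>\<close>;
  homogeneity shrinks the bound below \<epsilon> on a dilate of it.\<close>

lemma nbhd_cc_norm_small:
  assumes "\<epsilon> > 0" obtains U where "open U" "\<one> \<in> U" "\<And>x. x \<in> U \<Longrightarrow> cc_norm x < \<epsilon>"
proof -
  obtain U C where U: "open U" "\<one> \<in> U" "C > 0" "\<And>x. x \<in> U \<Longrightarrow> reach C x" by (rule reachable_nbhd) blast
  define t where "t = \<epsilon> / (2 * C)"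
  have t: "t > 0" "t * C < \<epsilon>" using assms U(3) by (auto simp: t_def)
  have NC: "cc_norm x \<le> C" if "x \<in> U" for x
    using U(4)[OF that] cc_norm_le unfolding reach_def by force
  have "cc_norm x < \<epsilon>" if "x \<in> \<delta> t ` U" for x
  proof -
    obtain y where y: "y \<in> U" "x = \<delta> t y" using \<open>x \<in> \<delta> t ` U\<close> by blast
    have "cc_norm x = t * cc_norm y" using y t by (simp add: cc_norm_dil)
    also have "\<dots> \<le> t * C" using NC[OF y(1)] t by simp
    finally show ?thesis using t by simp
  qed
  then show ?thesis using dil_open[OF t(1) U(1)] dil_one[OF t(1)] U(2)
    by (intro that[of "\<delta> t ` U"]) (auto intro: image_eqI[of _ _ \<one>])
qed

lemma cc_norm_continuous: "continuous_on S cc_norm"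
proof -
  have "continuous_on UNIV cc_norm"
    unfolding continuous_on_def
  proof (intro ballI tendstoI)
    fix x and e :: real assume "e > 0"
    then obtain U where U: "open U" "\<one> \<in> U" "\<And>x. x \<in> U \<Longrightarrow> cc_norm x < e" using nbhd_cc_norm_small by blast
    \<comment> \<open>Increment and inverse increment are both required to be small, since the
      triangle inequality is used in both directions.\<close>
    let ?O = "(\<lambda>y. inv x \<otimes> y) -` U \<inter> (\<lambda>y. inv (inv x \<otimes> y)) -` U"
    have "open ?O"
      by (intro open_Int open_vimage U(1) continuous_on_inv continuous_on_mult continuous_on_const continuous_on_id)
    moreover have "x \<in> ?O" using U(2) by simp
    moreover have "dist (cc_norm y) (cc_norm x) < e" if "y \<in> ?O" for y
    proof -
      let ?z = "inv x \<otimes> y"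
      have 1: "x \<otimes> ?z = y" "y \<otimes> inv ?z = x" by (simp_all add: inv_mult_group m_assoc[symmetric])
      have "cc_norm y \<le> cc_norm x + cc_norm ?z" "cc_norm x \<le> cc_norm y + cc_norm (inv ?z)"
        using cc_norm_triangle[of x ?z] cc_norm_triangle[of y "inv ?z"] by (simp_all add: 1)
      moreover have "cc_norm ?z < e" "cc_norm (inv ?z) < e" using that U(3) by auto
      ultimately show ?thesis by (simp add: dist_real_def abs_less_iff)
    qed
    ultimately show "eventually (\<lambda>y. dist (cc_norm y) (cc_norm x) < e) (at x within UNIV)"
      unfolding eventually_at_topological by blast
  qed
  then show ?thesis by (rule continuous_on_subset) simp
qed

lemma ball_cc_norm_open: "open {x. cc_norm x < r}"
  using open_vimage[OF open_lessThan cc_norm_continuous, of r] by (simp add: vimage_def)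

text \<open>The compact support of a bump function contains some small ball around
  \<open>\<one>\<close>; a dilation inflates both.\<close>

lemma ball_cc_norm_compact: "\<exists>K. compact K \<and> {x. cc_norm x < r} \<subseteq> K"
proof -
  obtain f M where f: "sf f" "\<And>y. 0 \<le> f y" "\<And>y. f y \<le> 1" "open M" "\<one> \<in> M" "\<And>y. y \<in> M \<Longrightarrow> f y = 1"
    "compact (closure {y. f y \<noteq> 0})" "closure {y. f y \<noteq> 0} \<subseteq> UNIV" "\<And>y. y \<notin> UNIV \<Longrightarrow> f y = 0"
    by (rule bump[OF open_UNIV UNIV_I]) (rule that)
  let ?K = "closure {y. f y \<noteq> 0}"
  have MK: "M \<subseteq> ?K" using f(6) closure_subset[of "{y. f y \<noteq> 0}"] by force
  obtain \<epsilon> where \<epsilon>: "\<epsilon> > 0" "\<And>x. cc_norm x < \<epsilon> \<Longrightarrow> x \<in> M" using cc_norm_small_nbhd[OF f(4,5)] by blast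
  define t where "t = max r 1 / \<epsilon>"
  have t: "t > 0" using \<epsilon>(1) by (simp add: t_def)
  have "{x. cc_norm x < r} \<subseteq> \<delta> t ` ?K"
  proof
    fix x assume "x \<in> {x. cc_norm x < r}"
    then have "cc_norm x < t * \<epsilon>" using \<epsilon>(1) by (simp add: t_def)
    then have "cc_norm (\<delta> (1/t) x) < \<epsilon>" using t by (simp add: cc_norm_dil field_simps)
    then have "\<delta> (1/t) x \<in> ?K" using \<epsilon>(2) MK by blast
    then show "x \<in> \<delta> t ` ?K" using dil_inverse(1)[OF t, of x] by (intro image_eqI[of _ _ "\<delta> (1/t) x"]) auto
  qed
  moreover have "compact (\<delta> t ` ?K)" by (intro compact_continuous_image dil_continuous t f(7))
  ultimately show ?thesis by blast
qed

text \<open>Joint continuity comes from continuity in t alone: \<open>dl t x\<close> is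
  \<open>dl t x0\<close> times \<open>dl t (inv x0 \<otimes> x)\<close>, and the norm of the second
  factor is t times that of \<open>inv x0 \<otimes> x\<close>, which tends to 0.\<close>

lemma dl_continuous: "continuous_on ({0..} \<times> UNIV) (\<lambda>(t, x). dl t x)"
  unfolding continuous_on_def
proof (intro ballI)
  fix p :: "real \<times> 'g" assume "p \<in> {0..} \<times> UNIV"
  then obtain t0 x0 where p: "p = (t0, x0)" "t0 \<ge> 0" by auto
  let ?F = "at p within {0..} \<times> UNIV"
  have A: "((\<lambda>q. dl (fst q) x0) \<longlongrightarrow> dl t0 x0) ?F"
  proof -
    have "continuous_on ({0..} \<times> UNIV) (\<lambda>q::real\<times>'g. dl (fst q) x0)"
      by (rule continuous_on_compose2[OF dl_continuous1]) (auto intro!: continuous_intros)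
    then show ?thesis using p by (auto simp: continuous_on_def)
  qed
  have B: "((\<lambda>q. dl (fst q) (inv x0 \<otimes> snd q)) \<longlongrightarrow> \<one>) ?F"
  proof (rule topological_tendstoI)
    fix U :: "'g set" assume U: "open U" "\<one> \<in> U"
    obtain \<epsilon> where \<epsilon>: "\<epsilon> > 0" "\<And>x. cc_norm x < \<epsilon> \<Longrightarrow> x \<in> U" using cc_norm_small_nbhd[OF U] by blast
    have "continuous_on ({0..} \<times> UNIV) (\<lambda>q::real\<times>'g. fst q * cc_norm (inv x0 \<otimes> snd q))"
      by (intro continuous_on_mult' continuous_on_fst continuous_on_id continuous_on_compose2[OF cc_norm_continuous[of UNIV]] continuous_on_mult
          continuous_on_const continuous_on_snd Limits.continuous_on_mult) auto
    then have "((\<lambda>q. fst q * cc_norm (inv x0 \<otimes> snd q)) \<longlongrightarrow> 0) ?F"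
      using p by (auto simp: cc_norm_one continuous_on_def dest!: bspec[where x = t0] spec[where x = x0])
    then have "eventually (\<lambda>q. fst q * cc_norm (inv x0 \<otimes> snd q) < \<epsilon>) ?F"
      by (rule order_tendstoD) (rule \<epsilon>(1))
    moreover have "eventually (\<lambda>q. q \<in> {0..} \<times> UNIV) ?F" by (simp add: eventually_at_filter)
    ultimately show "eventually (\<lambda>q. dl (fst q) (inv x0 \<otimes> snd q) \<in> U) ?F"
      by eventually_elim (use \<epsilon>(2) cc_norm_dl in auto)
  qed
  have "((\<lambda>q. (dl (fst q) x0, dl (fst q) (inv x0 \<otimes> snd q))) \<longlongrightarrow> (dl t0 x0, \<one>)) ?F"
    by (rule tendsto_Pair[OF A B])
  from continuous_on_tendsto_compose[OF mult_continuous this]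
  have "((\<lambda>q. dl (fst q) x0 \<otimes> dl (fst q) (inv x0 \<otimes> snd q)) \<longlongrightarrow> dl t0 x0 \<otimes> \<one>) ?F" by simp
  then have "((\<lambda>q. dl (fst q) x0 \<otimes> dl (fst q) (inv x0 \<otimes> snd q)) \<longlongrightarrow> (\<lambda>(t, x). dl t x) p) ?F"
    by (simp add: p)
  then show "((\<lambda>(t, x). dl t x) \<longlongrightarrow> (\<lambda>(t, x). dl t x) p) ?F"
  proof (rule Lim_transform_eventually)
    have "eventually (\<lambda>q. q \<in> {0..} \<times> UNIV) ?F" by (simp add: eventually_at_filter)
    then show "eventually (\<lambda>q. dl (fst q) x0 \<otimes> dl (fst q) (inv x0 \<otimes> snd q) = (\<lambda>(t, x). dl t x) q) ?F"
    proof eventually_elim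
      case (elim q)
      then have "dl (fst q) x0 \<otimes> dl (fst q) (inv x0 \<otimes> snd q) = dl (fst q) (x0 \<otimes> (inv x0 \<otimes> snd q))"
        by (intro dl_mult[symmetric]) auto
      then show ?case by (simp add: m_assoc[symmetric] case_prod_unfold)
    qed
  qed
qed

lemma continuous_on_dl:
  assumes "continuous_on S f" "continuous_on S g" "\<And>x. x \<in> S \<Longrightarrow> f x \<ge> 0"
  shows "continuous_on S (\<lambda>x. dl (f x) (g x))"
  using continuous_on_compose2[OF dl_continuous continuous_on_Pair[OF assms(1,2)]] assms(3) by auto

section \<open>Contractibility of sets with a cone property\<close>

text \<open>Right multiplication by \<open>\<delta> \<tau> p\<close> with large \<open>\<tau>\<close> moves every point of \<open>F\<close> into the cone \<open>T\<close>,
  inside \<open>F\<close>; then the cone is contracted to its vertex by the dilations.\<close>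

lemma contractible_cone_property:
  assumes one: "\<one> \<in> T" and dT: "\<And>t x. t > 0 \<Longrightarrow> x \<in> T \<Longrightarrow> \<delta> t x \<in> T"
    and p: "p \<in> interior T" and FT: "\<And>x y. x \<in> F \<Longrightarrow> y \<in> T \<Longrightarrow> x \<otimes> y \<in> F"
  shows "contractible F"
proof (cases "F = {}")
  case False
  then obtain a where a: "a \<in> F" by blast
  have aT: "a \<otimes> y \<in> F" if "y \<in> T" for y using FT[OF a that] .
  let ?U = "(\<lambda>z. z \<otimes> p) -` interior T"
  have "open ?U" by (intro open_vimage open_interior continuous_on_mult continuous_on_id continuous_on_const)
  moreover have "\<one> \<in> ?U" using p by simp
  ultimately obtain \<epsilon> where \<epsilon>: "\<epsilon> > 0" "\<And>z. cc_norm z < \<epsilon> \<Longrightarrow> z \<in> ?U" using cc_norm_small_nbhd by blast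
  \<comment> \<open>Chosen so that dilating \<open>inv a \<otimes> x\<close> by 1/\<tau> brings its
    norm below \<epsilon>; then p may be appended inside T, and dilating back gives
    \<open>inv a \<otimes> x \<otimes> \<delta> (\<tau> x) p\<close> in T. The summand 1 keeps
    \<tau> positive.\<close>
  define \<tau> where "\<tau> = (\<lambda>x. (cc_norm (inv a \<otimes> x) + 1) / \<epsilon>)"
  have \<tau>: "\<tau> x > 0" for x using \<epsilon>(1) cc_norm_nonneg[of "inv a \<otimes> x"] by (simp add: \<tau>_def)
  have c\<tau>: "continuous_on S \<tau>" for S
    unfolding \<tau>_def using \<epsilon>(1)
    by (intro continuous_on_divide continuous_on_add continuous_on_const continuous_on_compose2[OF cc_norm_continuous[of UNIV]]
       continuous_on_mult continuous_on_id) auto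
  have dlT: "dl t y \<in> T" if "t \<ge> 0" "y \<in> T" for t y using that one dT by (auto simp: dl_def)
  have pT: "p \<in> T" using p interior_subset by blast
  have inT: "inv a \<otimes> (x \<otimes> \<delta> (\<tau> x) p) \<in> T" for x
  proof -
    let ?z = "\<delta> (1 / \<tau> x) (inv a \<otimes> x)"
    have "cc_norm ?z = cc_norm (inv a \<otimes> x) / \<tau> x" using \<tau>[of x] by (simp add: cc_norm_dil)
    also have "\<dots> < \<epsilon>" using \<tau>[of x] \<epsilon>(1) by (simp add: \<tau>_def field_simps)
    finally have "?z \<otimes> p \<in> T" using \<epsilon>(2) interior_subset by blast
    then have "\<delta> (\<tau> x) (?z \<otimes> p) \<in> T" by (rule dT[OF \<tau>])
    then show ?thesis using \<tau>[of x] by (simp add: dil_hom dil_inverse m_assoc)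
  qed
  have 1: "homotopic_with_canon (\<lambda>_. True) F F id (\<lambda>x. x \<otimes> \<delta> (\<tau> x) p)"
  proof (rule homotopic_canonI[where H = "\<lambda>(s, x). x \<otimes> dl (s * \<tau> x) p"])
    show "continuous_on ({0..1} \<times> F) (\<lambda>(s, x). x \<otimes> dl (s * \<tau> x) p)"
      unfolding case_prod_unfold
      by (intro continuous_on_mult continuous_on_dl Limits.continuous_on_mult continuous_on_compose2[OF c\<tau>[of UNIV]]
          continuous_on_fst continuous_on_snd continuous_on_id continuous_on_const)
        (auto intro!: mult_nonneg_nonneg \<tau>[THEN less_imp_le])
    show "(\<lambda>(s, x). x \<otimes> dl (s * \<tau> x) p) (t, x) \<in> F" if "t \<in> {0..1}" "x \<in> F" for t x
      using that \<tau>[of x] by (auto intro!: FT dlT pT)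
  qed (use \<tau> in \<open>auto simp: dl_pos\<close>)
  have 2: "homotopic_with_canon (\<lambda>_. True) F F (\<lambda>x. x \<otimes> \<delta> (\<tau> x) p) (\<lambda>x. a)"
  proof (rule homotopic_canonI[where H = "\<lambda>(s, x). a \<otimes> dl (1 - s) (inv a \<otimes> (x \<otimes> dl (\<tau> x) p))"])
    show "continuous_on ({0..1} \<times> F) (\<lambda>(s, x). a \<otimes> dl (1 - s) (inv a \<otimes> (x \<otimes> dl (\<tau> x) p)))"
      unfolding case_prod_unfold
      by (intro continuous_on_mult continuous_on_dl continuous_on_diff continuous_on_compose2[OF c\<tau>[of UNIV]]
          continuous_on_fst continuous_on_snd continuous_on_id continuous_on_const) (auto intro: \<tau>[THEN less_imp_le])
    show "(\<lambda>(s, x). a \<otimes> dl (1 - s) (inv a \<otimes> (x \<otimes> dl (\<tau> x) p))) (t, x) \<in> F" if "t \<in> {0..1}" "x \<in> F" for t x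
      using that inT[of x] \<tau>[of x] by (auto intro!: aT dlT simp: dl_pos)
  qed (use \<tau> in \<open>auto simp: dl_pos m_assoc[symmetric]\<close>)
  from homotopic_with_trans[OF 1 2] show ?thesis unfolding contractible_def by blast
qed simp

end

section \<open>Monotonicity along the semigroup\<close>

lemma vimage_borel:
  "continuous_on UNIV f \<Longrightarrow> B \<in> sets borel \<Longrightarrow> f -` B \<in> sets borel"
  using measurable_sets[OF borel_measurable_continuous_onI] by force

context lie_grp begin

lemma compact_bump:
  assumes L: "compact L" "L \<subseteq> U" "open U"
  obtains u where "sf u" "\<And>x. 0 \<le> u x" "\<And>x. u x \<le> 1" "\<And>x. x \<in> L \<Longrightarrow> u x = 1"
    "compact (closure {x. u x \<noteq> 0})" "\<And>x. x \<notin> U \<Longrightarrow> u x = 0"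
proof -
  have "\<forall>x\<in>L. \<exists>f. sf f \<and> (\<forall>y. 0 \<le> f y) \<and> (\<forall>y. f y \<le> 1) \<and> (\<exists>M. open M \<and> x \<in> M \<and> (\<forall>y\<in>M. f y = 1)) \<and>
     compact (closure {y. f y \<noteq> 0}) \<and> (\<forall>y. y \<notin> U \<longrightarrow> f y = 0)"
  proof
    fix x assume "x \<in> L"
    then have x: "x \<in> U" using L(2) by blast
    obtain f M where f: "sf f" "\<And>y. 0 \<le> f y" "\<And>y. f y \<le> 1" "open M" "x \<in> M" "\<And>y. y \<in> M \<Longrightarrow> f y = 1"
      "compact (closure {y. f y \<noteq> 0})" "closure {y. f y \<noteq> 0} \<subseteq> U" "\<And>y. y \<notin> U \<Longrightarrow> f y = 0"
      by (rule bump[OF L(3) x]) (rule that)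
    show "\<exists>f. sf f \<and> (\<forall>y. 0 \<le> f y) \<and> (\<forall>y. f y \<le> 1) \<and> (\<exists>M. open M \<and> x \<in> M \<and> (\<forall>y\<in>M. f y = 1)) \<and>
     compact (closure {y. f y \<noteq> 0}) \<and> (\<forall>y. y \<notin> U \<longrightarrow> f y = 0)"
      by (intro exI[of _ f] conjI exI[of _ M] allI ballI impI f)
  qed
  from bchoice[OF this] obtain F where F: "\<forall>x\<in>L. sf (F x) \<and> (\<forall>y. 0 \<le> F x y) \<and> (\<forall>y. F x y \<le> 1) \<and> (\<exists>M. open M \<and> x \<in> M \<and> (\<forall>y\<in>M. F x y = 1)) \<and>
     compact (closure {y. F x y \<noteq> 0}) \<and> (\<forall>y. y \<notin> U \<longrightarrow> F x y = 0)" ..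
  then have "\<forall>x\<in>L. \<exists>M. open M \<and> x \<in> M \<and> (\<forall>y\<in>M. F x y = 1)" by blast
  from bchoice[OF this] obtain M where M: "\<forall>x\<in>L. open (M x) \<and> x \<in> M x \<and> (\<forall>y\<in>M x. F x y = 1)" ..
  obtain D where D: "D \<subseteq> L" "finite D" "L \<subseteq> (\<Union>x\<in>D. M x)"
    by (rule compactE_image[OF L(1), of L M]) (use M in auto)
  \<comment> \<open>This combination stays in [0, 1] and equals 1 wherever one of the bumps does; a
    sum would not stay below 1.\<close>
  define u where "u = (\<lambda>y. 1 - (\<Prod>x\<in>D. 1 - F x y))"
  have F': "sf (F x)" "0 \<le> F x y" "F x y \<le> 1" "compact (closure {y. F x y \<noteq> 0})" "y \<notin> U \<Longrightarrow> F x y = 0" if "x \<in> D" for x y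
    using F D(1) that by blast+
  have p: "0 \<le> (\<Prod>x\<in>D. 1 - F x y)" "(\<Prod>x\<in>D. 1 - F x y) \<le> 1" for y
    using F' by (auto intro!: prod_nonneg prod_le_1)
  show ?thesis
  proof (rule that[of u])
    show "sf u" unfolding u_def by (intro sf_diff sf_prod sf_const F')
    show "0 \<le> u y" "u y \<le> 1" for y using p[of y] by (auto simp: u_def)
    show "u y = 1" if y: "y \<in> L" for y
    proof -
      obtain x where "x \<in> D" "y \<in> M x" using subsetD[OF D(3) y] by blast
      then have "x \<in> D \<and> 1 - F x y = 0" using M D(1) by auto
      then have "(\<Prod>x\<in>D. 1 - F x y) = 0" using D(2) by (intro prod_zero) auto
      then show ?thesis by (simp add: u_def)
    qed
    have "{y. u y \<noteq> 0} \<subseteq> (\<Union>x\<in>D. closure {y. F x y \<noteq> 0})"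
    proof
      fix y assume "y \<in> {y. u y \<noteq> 0}"
      then have "(\<Prod>x\<in>D. 1 - F x y) \<noteq> 1" by (simp add: u_def)
      then obtain x where "x \<in> D" "F x y \<noteq> 0" by (metis (no_types, lifting) diff_zero prod.neutral)
      then show "y \<in> (\<Union>x\<in>D. closure {y. F x y \<noteq> 0})"
        using closure_subset[of "{y. F x y \<noteq> 0}"] by blast
    qed
    moreover have K: "compact (\<Union>x\<in>D. closure {y. F x y \<noteq> 0})"
      using D(2) F' by (intro compact_UN) auto
    ultimately have "closure {y. u y \<noteq> 0} \<subseteq> (\<Union>x\<in>D. closure {y. F x y \<noteq> 0})"
      by (intro closure_minimal compact_imp_closed)
    from Int_absorb1[OF this] compact_Int_closed[OF K closed_closure, of "{y. u y \<noteq> 0}"]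
    show "compact (closure {y. u y \<noteq> 0})" by simp
    show "u y = 0" if "y \<notin> U" for y
    proof -
      have "(\<Prod>x\<in>D. 1 - F x y) = 1" using F'(5)[OF _ that] by (intro prod.neutral) auto
      then show ?thesis by (simp add: u_def)
    qed
  qed
qed

end

section \<open>Haar measure and the normal condition for a Borel part of the set\<close>

locale const_normal = half_space G A s V \<delta> h W
  for G :: "'g::{second_countable_topology, t2_space} monoid" (structure)
    and A :: "('g, 'e::euclidean_space) atlas"
    and s :: nat and V :: "nat \<Rightarrow> 'g vfield set" and \<delta> :: "real \<Rightarrow> 'g \<Rightarrow> 'g"
    and h :: "'g vfield \<Rightarrow> 'g vfield \<Rightarrow> real" and W :: "'g vfield set" +
  fixes vol :: "'g measure" and E :: "'g set"
  assumes haar: "haar_measure G vol" and E: "E \<in> sets (completion vol)"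
    and cnormal: "constant_normal A (completion vol) W E"
begin

lemma sets_vol: "sets vol = sets borel" using haar by (simp add: haar_measure_def)

lemma space_vol: "space vol = UNIV"
  using sets_eq_imp_space_eq[OF sets_vol] by simp

lemma sets_volI [measurable (raw), simp]: "B \<in> sets borel \<Longrightarrow> B \<in> sets vol" by (simp add: sets_vol)

lemma measurable_vol: "f \<in> borel_measurable borel \<Longrightarrow> f \<in> borel_measurable vol"
  using measurable_cong_sets[OF sets_vol refl] by blast

lemma continuous_mult_left: "continuous_on S (\<lambda>x. g \<otimes> x)"
  and continuous_mult_right: "continuous_on S (\<lambda>x. x \<otimes> g)"
  by (intro continuous_on_mult continuous_on_id continuous_on_const)+

lemma left_image: "(\<lambda>x. g \<otimes> x) ` B = (\<lambda>x. inv g \<otimes> x) -` B"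
proof (intro equalityI subsetI)
  fix x assume "x \<in> (\<lambda>x. inv g \<otimes> x) -` B"
  then show "x \<in> (\<lambda>x. g \<otimes> x) ` B"
    by (intro image_eqI[of _ _ "inv g \<otimes> x"]) (auto simp: m_assoc[symmetric])
qed (auto simp: m_assoc[symmetric])

lemma left_open: "open U \<Longrightarrow> open ((\<lambda>x. g \<otimes> x) ` U)"
  unfolding left_image by (intro open_vimage continuous_mult_left)

lemma vol_left: "B \<in> sets borel \<Longrightarrow> emeasure vol ((\<lambda>x. g \<otimes> x) ` B) = emeasure vol B"
  using haar by (simp add: haar_measure_def)

lemma vol_compact: "compact K \<Longrightarrow> emeasure vol K < \<infinity>"
  using haar by (simp add: haar_measure_def)

lemma vol_subset_compact: "compact K \<Longrightarrow> B \<subseteq> K \<Longrightarrow> emeasure vol B < \<infinity>"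
  using emeasure_mono[of B K vol] vol_compact[of K] borel_closed[OF compact_imp_closed[of K]]
  by (simp add: order_le_less_trans)

text \<open>Fubini needs \<sigma>-finiteness: balls of integer radius exhaust the group and lie in
  compact sets.\<close>

sublocale vol: sigma_finite_measure vol
proof
  show "\<exists>A. countable A \<and> A \<subseteq> sets vol \<and> \<Union>A = space vol \<and> (\<forall>a\<in>A. emeasure vol a \<noteq> \<infinity>)"
  proof (intro exI[of _ "range (\<lambda>n. {x. cc_norm x < real n})"] conjI ballI)
    show "range (\<lambda>n. {x. cc_norm x < real n}) \<subseteq> sets vol" using ball_cc_norm_open by (auto intro!: borel_open)
    show "\<Union> (range (\<lambda>n. {x. cc_norm x < real n})) = space vol" using reals_Archimedean2 by (auto simp: space_vol)
    fix a assume "a \<in> range (\<lambda>n. {x. cc_norm x < real n})"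
    then obtain n where "a = {x. cc_norm x < real n}" by blast
    moreover obtain K where "compact K" "{x. cc_norm x < real n} \<subseteq> K" using ball_cc_norm_compact by blast
    ultimately show "emeasure vol a \<noteq> \<infinity>" using vol_subset_compact[of K a] by (simp add: less_top)
  qed simp
qed

text \<open>Second countability, through the Lindelof property, extracts a countable cover, so being
  null is a local property.\<close>

lemma open_null_cover:
  assumes "\<And>x. x \<in> B \<Longrightarrow> \<exists>U. open U \<and> x \<in> U \<and> emeasure vol (U \<inter> C) = 0" and C: "C \<in> sets borel"
    and B: "B \<in> sets borel"
  shows "emeasure vol (B \<inter> C) = 0"
proof -
  define F where "F = {U. open U \<and> emeasure vol (U \<inter> C) = 0}"
  obtain F' where F': "F' \<subseteq> F" "countable F'" "\<Union>F' = \<Union>F"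
    by (rule Lindelof[of F]) (auto simp: F_def)
  have "U \<inter> C \<in> null_sets vol" if "U \<in> F'" for U
    using that F'(1) C by (auto simp: F_def null_sets_def)
  then have nl: "(\<Union>U\<in>F'. U \<inter> C) \<in> null_sets vol" by (rule null_sets_UN'[OF F'(2)])
  have "B \<inter> C \<subseteq> (\<Union>U\<in>F'. U \<inter> C)"
  proof
    fix x assume x: "x \<in> B \<inter> C"
    then have "x \<in> \<Union>F" using assms(1)[of x] by (auto simp: F_def)
    then show "x \<in> (\<Union>U\<in>F'. U \<inter> C)" using x F'(3) by blast
  qed
  then have "B \<inter> C \<in> null_sets vol" using null_sets_subset[OF nl, of "B \<inter> C"] B C by auto
  then show ?thesis by auto
qed

text \<open>Left translates of a null nonempty open set would cover the group by null open
  sets.\<close>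

lemma vol_open_pos:
  assumes U: "open U" "U \<noteq> {}" shows "emeasure vol U \<noteq> 0"
proof
  assume z: "emeasure vol U = 0"
  obtain u where u: "u \<in> U" using U(2) by blast
  have "emeasure vol (UNIV \<inter> UNIV) = 0"
  proof (rule open_null_cover)
    fix x :: 'g
    have "x = (x \<otimes> inv u) \<otimes> u" by (simp add: m_assoc)
    then have "x \<in> (\<lambda>y. (x \<otimes> inv u) \<otimes> y) ` U" using u by blast
    then show "\<exists>U. open U \<and> x \<in> U \<and> emeasure vol (U \<inter> UNIV) = 0"
      using left_open[OF U(1)] vol_left[of U] z U(1) by (intro exI[of _ "(\<lambda>y. (x \<otimes> inv u) \<otimes> y) ` U"]) auto
  qed auto
  then show False using haar by (simp add: haar_measure_def)
qed

text \<open>A Borel subset of E with negligible remainder; products and translates below stay within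
  the Borel sets.\<close>

definition E0 :: "'g set" where "E0 = main_part vol E"

lemma E0: "E0 \<in> sets borel" and E_null: "\<exists>N'\<in>null_sets vol. E0 \<subseteq> E \<and> E - E0 \<subseteq> N'"
proof -
  show "E0 \<in> sets borel" unfolding E0_def using main_part_sets[OF E] by (simp add: sets_vol)
  have "E0 \<union> null_part vol E = E" unfolding E0_def by (rule main_part_null_part_Un[OF E])
  moreover obtain N' where "N' \<in> null_sets vol" "null_part vol E \<subseteq> N'"
    using null_part[OF E] by blast
  ultimately show "\<exists>N'\<in>null_sets vol. E0 \<subseteq> E \<and> E - E0 \<subseteq> N'" by blast
qed

lemma set_integral_E:
  fixes f :: "'g \<Rightarrow> real"
  assumes f: "f \<in> borel_measurable borel"
  shows "(LINT x:E|completion vol. f x) = (LINT x:E0|vol. f x)"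
proof -
  obtain N' where N': "N' \<in> null_sets vol" "E0 \<subseteq> E" "E - E0 \<subseteq> N'" using E_null by blast
  have "AE x in vol. x \<notin> N'" using N'(1) by (rule AE_not_in)
  then have ae: "AE x in completion vol. x \<notin> N'" by (rule AE_completion)
  have fc: "f \<in> borel_measurable (completion vol)" by (intro measurable_completion measurable_vol f)
  have E0c: "E0 \<in> sets (completion vol)" using E0 by simp
  have "(LINT x:E|completion vol. f x) = (LINT x:E0|completion vol. f x)"
    unfolding set_lebesgue_integral_def
  proof (rule integral_cong_AE)
    show "AE x in completion vol. indicat_real E x *\<^sub>R f x = indicat_real E0 x *\<^sub>R f x"
      using ae by eventually_elim (use N' in \<open>auto split: split_indicator\<close>)
  qed (use fc E E0c in \<open>auto intro!: borel_measurable_scaleR borel_measurable_indicator\<close>)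
  also have "\<dots> = (LINT x:E0|vol. f x)"
    unfolding set_lebesgue_integral_def
    by (rule integral_completion) (intro borel_measurable_scaleR borel_measurable_indicator measurable_vol f sets_volI E0)
  finally show ?thesis .
qed

lemma sf_borel: "sf f \<Longrightarrow> f \<in> borel_measurable borel"
  by (intro borel_measurable_continuous_onI sf_continuous)

lemma normal_E0:
  assumes "Y \<in> W" "sf u" "compact (closure {x. u x \<noteq> 0})" "\<And>x. 0 \<le> u x"
  shows "(LINT x:E0|vol. Y u x) \<le> 0"
proof -
  have "sf (Y u)" using sf_lf[OF assms(2), of "ev Y"] V1_lf[of Y] assms(1) W_V1 by auto
  from set_integral_E[OF sf_borel[OF this]] show ?thesis
    using cnormal assms unfolding constant_normal_def by fastforce
qed

lemma supp_translate:
  fixes u :: "'g \<Rightarrow> real"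
  assumes "compact (closure {x. u x \<noteq> 0})"
  shows "compact (closure {x. u (x \<otimes> p) \<noteq> 0})"
proof -
  let ?K = "(\<lambda>x. x \<otimes> inv p) ` closure {x. u x \<noteq> 0}"
  have K: "compact ?K" by (intro compact_continuous_image continuous_mult_right assms)
  have "{x. u (x \<otimes> p) \<noteq> 0} \<subseteq> ?K"
  proof
    fix x assume "x \<in> {x. u (x \<otimes> p) \<noteq> 0}"
    then have "x \<otimes> p \<in> closure {x. u x \<noteq> 0}" using closure_subset by fastforce
    then show "x \<in> ?K" by (intro image_eqI[of _ _ "x \<otimes> p"]) (auto simp: m_assoc)
  qed
  then have "closure {x. u (x \<otimes> p) \<noteq> 0} \<subseteq> ?K" using K by (intro closure_minimal compact_imp_closed)
  from Int_absorb1[OF this] compact_Int_closed[OF K closed_closure, of "{x. u (x \<otimes> p) \<noteq> 0}"]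
  show ?thesis by simp
qed

text \<open>A left-invariant field commutes with right translation by its own flow, because times
  along one flow add. The translates of u are therefore test functions whose Y-derivative is the
  time derivative along the flow.\<close>

lemma field_flow_commute:
  assumes Y: "Y \<in> V 1" and u: "sf u"
  shows "Y (\<lambda>x. u (x \<otimes> flow Y t)) x = Y u (x \<otimes> flow Y t)"
proof -
  have 1: "((\<lambda>r. u (x \<otimes> flow Y r \<otimes> flow Y t)) has_real_derivative Y (\<lambda>x. u (x \<otimes> flow Y t)) x) (at 0)"
    using flow_derivative[OF Y sf_translate(2)[OF u, of "flow Y t"], of x 0] by (simp add: flow(1)[OF Y])
  have "((\<lambda>r. u (x \<otimes> flow Y (r + t))) has_real_derivative Y u (x \<otimes> flow Y (0 + t)) * 1) (at 0)"
    by (rule DERIV_chain2[where f = "\<lambda>r. u (x \<otimes> flow Y r)", OF flow_derivative[OF Y u]]) (auto intro!: derivative_eq_intros)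
  then have 2: "((\<lambda>r. u (x \<otimes> flow Y r \<otimes> flow Y t)) has_real_derivative Y u (x \<otimes> flow Y t)) (at 0)"
    by (simp add: flow_add[OF Y] m_assoc)
  show ?thesis using DERIV_unique[OF 1 2] .
qed

lemma integrable_compact_support:
  assumes u: "sf u" "compact (closure {x. u x \<noteq> 0})"
  shows "integrable vol (\<lambda>x. indicator E0 x * u x)"
proof -
  have "compact (u ` closure {x. u x \<noteq> 0})"
    by (intro compact_continuous_image sf_continuous u)
  then have "bounded (u ` closure {x. u x \<noteq> 0})" by (rule compact_imp_bounded)
  then obtain B where B: "\<forall>r\<in>u ` closure {x. u x \<noteq> 0}. norm r \<le> B" unfolding bounded_iff ..
  show ?thesis
  proof (rule integrableI_bounded_set[where A = "closure {x. u x \<noteq> 0}" and B = B])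
    show "(\<lambda>x. indicator E0 x * u x) \<in> borel_measurable vol"
      by (intro borel_measurable_times borel_measurable_indicator measurable_vol sf_borel u sets_volI E0)
    have "norm (indicator E0 x * u x) \<le> B" if "x \<in> closure {x. u x \<noteq> 0}" for x
      using B that abs_ge_zero[of "u x"] by (auto simp: abs_mult split: split_indicator intro: order_trans[of 0 "\<bar>u x\<bar>"])
    then show "AE x in vol. x \<in> closure {x. u x \<noteq> 0} \<longrightarrow> norm (indicator E0 x * u x) \<le> B" by simp
    have "indicator E0 x * u x = 0" if "x \<notin> closure {x. u x \<noteq> 0}" for x
      using contra_subsetD[OF closure_subset that] by simp
    then show "AE x in vol. x \<notin> closure {x. u x \<noteq> 0} \<longrightarrow> indicator E0 x * u x = 0" by simp
  qed (use vol_compact[OF u(2)] in auto)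
qed

text \<open>Integrating the normal condition for the translates of \<open>u\<close> along the flow and exchanging
  the integrals.\<close>

lemma flow_monotone:
  assumes Y: "Y \<in> W" and u: "sf u" "compact (closure {x. u x \<noteq> 0})" "\<And>x. 0 \<le> u x"
  shows "(LINT x:E0|vol. u (x \<otimes> flow Y 1)) \<le> (LINT x:E0|vol. u x)"
proof -
  have Y1: "Y \<in> V 1" using Y W_V1 by blast
  have sY: "sf (Y u)" using sf_lf[OF u(1), of "ev Y"] V1_lf[OF Y1] by simp
  define K where "K = closure {x. u x \<noteq> 0}"
  \<comment> \<open>The time interval is built into the integrand, so that both orders of
    integration run over the whole spaces.\<close>
  define g where "g = (\<lambda>x t. indicator E0 x * (Y u (x \<otimes> flow Y t) * indicator {0..1::real} t))"
  have cfl: "continuous_on S (flow Y)" for S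
    using continuous_on_subset[OF smooth_into_continuous[OF flow_smooth[OF Y1]]] by blast
  interpret pair_sigma_finite vol lborel ..
  let ?P = "vol \<Otimes>\<^sub>M (lborel :: real measure)"
  have setsP: "sets ?P = sets (borel :: ('g \<times> real) measure)"
    unfolding borel_prod[symmetric] by (rule sets_pair_measure_cong[OF sets_vol sets_lborel])
  have measP: "f \<in> borel_measurable ?P" if "f \<in> borel_measurable borel" for f :: "'g \<times> real \<Rightarrow> real"
    using measurable_cong_sets[OF setsP refl] that by blast
  have contG: "continuous_on UNIV (\<lambda>q::'g\<times>real. Y u (fst q \<otimes> flow Y (snd q)))"
    by (rule continuous_on_compose2[OF sf_continuous[OF sY]])
      (auto intro!: continuous_on_mult continuous_on_fst continuous_on_snd continuous_on_id continuous_on_compose2[OF cfl])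
  have mg: "case_prod g \<in> borel_measurable ?P"
  proof (rule measP)
    have 1: "E0 \<times> UNIV \<in> sets (borel :: ('g \<times> real) measure)"
      unfolding borel_prod[symmetric] using E0 by (intro pair_measureI) auto
    have 2: "UNIV \<times> {0..1} \<in> sets (borel :: ('g \<times> real) measure)"
      unfolding borel_prod[symmetric] by (intro pair_measureI) auto
    have "(\<lambda>q. indicator (E0 \<times> UNIV) q * (Y u (fst q \<otimes> flow Y (snd q)) * indicator (UNIV \<times> {0..1}) q)) \<in> borel_measurable borel"
      by (intro borel_measurable_times borel_measurable_indicator 1 2 borel_measurable_continuous_onI[OF contG])
    moreover have "(\<lambda>q. indicator (E0 \<times> UNIV) q * (Y u (fst q \<otimes> flow Y (snd q)) * indicator (UNIV \<times> {0..1}) q)) = case_prod g"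
      by (auto simp: g_def fun_eq_iff split: split_indicator)
    ultimately show "case_prod g \<in> borel_measurable borel" by simp
  qed
  have zY: "Y u x = 0" if "x \<notin> K" for x
    using lf_zero_off_support[OF u(1), of x "ev Y"] that V1_lf[OF Y1] by (simp add: K_def)
  \<comment> \<open>All points that the flow can bring into K during [0, 1]; this compact set bounds
    the support of g in x.\<close>
  define L where "L = (\<lambda>q. fst q \<otimes> flow Y (- snd q)) ` (K \<times> {0..1::real})"
  have L: "compact L" unfolding L_def K_def
    by (intro compact_continuous_image compact_Times u(2) compact_Icc continuous_on_mult continuous_on_fst continuous_on_id
        continuous_on_compose2[OF cfl[of UNIV]] continuous_on_minus continuous_on_snd) auto
  have g0: "g x t = 0" if "x \<notin> L \<or> t \<notin> {0..1}" for x t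
  proof (rule ccontr)
    assume "g x t \<noteq> 0"
    then have t: "t \<in> {0..1}" and "Y u (x \<otimes> flow Y t) \<noteq> 0" by (auto simp: g_def split: split_indicator_asm)
    then have "x \<otimes> flow Y t \<in> K" using zY by blast
    moreover have "x = (x \<otimes> flow Y t) \<otimes> flow Y (- t)" by (simp add: m_assoc flow_add[OF Y1, symmetric] flow(1)[OF Y1])
    ultimately have "x \<in> L" unfolding L_def using t by (intro image_eqI[of _ _ "(x \<otimes> flow Y t, t)"]) auto
    then show False using that t by blast
  qed
  obtain C where C: "\<And>x. \<bar>Y u x\<bar> \<le> C"
  proof -
    obtain C where "C > 0" and C: "\<And>v x. \<bar>lf v u x\<bar> \<le> C * norm v" by (rule bounded_lf[OF u(1,2)]) (rule that)
    from C[of "ev Y"] have "\<bar>Y u x\<bar> \<le> C * norm (ev Y)" for x by (simp only: V1_lf[OF Y1])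
    then show ?thesis by (rule that)
  qed
  have C0: "C \<ge> 0" using C[of \<one>] by linarith
  have intg: "integrable ?P (case_prod g)"
  proof (rule integrableI_bounded_set[where A = "L \<times> {0..1}" and B = C])
    have Ls: "L \<in> sets vol" by (intro sets_volI borel_closed compact_imp_closed L)
    show "L \<times> {0..1} \<in> sets ?P" using Ls by (intro pair_measureI) auto
    show "case_prod g \<in> borel_measurable ?P" by (rule mg)
    have "emeasure ?P (L \<times> {0..1}) = emeasure vol L * emeasure lborel {0..1::real}"
      using Ls by (intro lborel.emeasure_pair_measure_Times) auto
    then show "emeasure ?P (L \<times> {0..1}) < \<infinity>" using vol_compact[OF L] by simp
    show "AE q in ?P. q \<in> L \<times> {0..1} \<longrightarrow> norm (case_prod g q) \<le> C"
      using C C0 by (auto simp: g_def abs_mult split: split_indicator)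
    have "case_prod g q = 0" if "q \<notin> L \<times> {0..1}" for q
      using g0[of "fst q" "snd q"] that by (cases q) auto
    then show "AE q in ?P. q \<notin> L \<times> {0..1} \<longrightarrow> case_prod g q = 0" by simp
  qed
  have in1: "(\<integral>t. g x t \<partial>lborel) = indicator E0 x * (u (x \<otimes> flow Y 1) - u x)" for x
  proof -
    have "(\<integral>t. Y u (x \<otimes> flow Y t) * indicator {0..1} t \<partial>lborel) = u (x \<otimes> flow Y 1) - u (x \<otimes> flow Y 0)"
    proof (rule integral_FTC_Icc_real)
      show "DERIV (\<lambda>t. u (x \<otimes> flow Y t)) t :> Y u (x \<otimes> flow Y t)" for t
        by (rule flow_derivative[OF Y1 u(1)])
      have "continuous_on UNIV (\<lambda>t. Y u (x \<otimes> flow Y t))"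
        by (rule continuous_on_compose2[OF sf_continuous[OF sY]]) (auto intro!: continuous_on_mult continuous_on_const cfl)
      then show "isCont (\<lambda>t. Y u (x \<otimes> flow Y t)) t" for t by (simp add: continuous_on_eq_continuous_at)
    qed simp
    then show ?thesis by (simp add: g_def flow(1)[OF Y1])
  qed
  have in2: "(\<integral>x. g x t \<partial>vol) \<le> 0" for t
  proof (cases "t \<in> {0..1}")
    case True
    have "(LINT x:E0|vol. Y (\<lambda>x. u (x \<otimes> flow Y t)) x) \<le> 0"
      by (rule normal_E0[OF Y sf_translate(2)[OF u(1)] supp_translate[OF u(2)] u(3)])
    then show ?thesis using True by (simp add: g_def set_lebesgue_integral_def field_flow_commute[OF Y1 u(1)])
  next
    case False
    then show ?thesis by (simp add: g_def)
  qed
  have i1: "integrable vol (\<lambda>x. indicator E0 x * u (x \<otimes> flow Y 1))"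
    by (rule integrable_compact_support[OF sf_translate(2)[OF u(1)] supp_translate[OF u(2)]])
  have i2: "integrable vol (\<lambda>x. indicator E0 x * u x)" by (rule integrable_compact_support[OF u(1,2)])
  have "(\<integral>x. indicator E0 x * (u (x \<otimes> flow Y 1) - u x) \<partial>vol) = (\<integral>t. (\<integral>x. g x t \<partial>vol) \<partial>lborel)"
    using Fubini_integral[OF intg] by (simp add: in1)
  also have "\<dots> \<le> 0"
  proof -
    have "0 \<le> (\<integral>t. - (\<integral>x. g x t \<partial>vol) \<partial>lborel)"
      using in2 by (intro Bochner_Integration.integral_nonneg) simp
    then show ?thesis by simp
  qed
  finally have "(\<integral>x. indicator E0 x * u (x \<otimes> flow Y 1) \<partial>vol) - (\<integral>x. indicator E0 x * u x \<partial>vol) \<le> 0"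
    using i1 i2 by (simp add: right_diff_distrib)
  then show ?thesis by (simp add: set_lebesgue_integral_def)
qed

text \<open>A product acts as successive right translations, under which the class of test functions
  is stable.\<close>

lemma semigroup_monotone:
  assumes "p \<in> SW" and u: "sf u" "compact (closure {x. u x \<noteq> 0})" "\<And>x. 0 \<le> u x"
  shows "(LINT x:E0|vol. u (x \<otimes> p)) \<le> (LINT x:E0|vol. u x)"
  using assms(1) W_V1 u
proof (induction arbitrary: u rule: gen_induct)
  case (flow Y)
  then show ?case by (intro flow_monotone) auto
next
  case (mult p q)
  have "(LINT x:E0|vol. u (x \<otimes> p \<otimes> q)) \<le> (LINT x:E0|vol. u (x \<otimes> q))"
    by (rule mult.IH(1)[of "\<lambda>x. u (x \<otimes> q)"]) (use mult.prems sf_translate(2) supp_translate in auto)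
  also have "\<dots> \<le> (LINT x:E0|vol. u x)" using mult.IH(2)[of u] mult.prems by blast
  finally show ?case by (simp add: m_assoc)
qed

end

section \<open>Right translates by the semigroup, up to null sets\<close>

context const_normal begin

lemma translate_measurable: "{x \<in> E0. x \<otimes> p \<in> B} \<in> sets borel" if "B \<in> sets borel"
proof -
  have "{x \<in> E0. x \<otimes> p \<in> B} = E0 \<inter> (\<lambda>x. x \<otimes> p) -` B" by auto
  then show ?thesis using E0 vimage_borel[OF continuous_mult_right that] by auto
qed

lemma compact_translate_finite:
  assumes "compact K" shows "emeasure vol {x \<in> E0. x \<otimes> p \<in> K} < \<infinity>"
proof (rule vol_subset_compact)
  show "compact ((\<lambda>x. x \<otimes> inv p) ` K)" by (intro compact_continuous_image continuous_mult_right assms)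
  show "{x \<in> E0. x \<otimes> p \<in> K} \<subseteq> (\<lambda>x. x \<otimes> inv p) ` K"
  proof
    fix x assume "x \<in> {x \<in> E0. x \<otimes> p \<in> K}"
    then show "x \<in> (\<lambda>x. x \<otimes> inv p) ` K" by (intro image_eqI[of _ _ "x \<otimes> p"]) (auto simp: m_assoc)
  qed
qed

text \<open>A test function squeezed between the indicators of L and U turns monotonicity of
  integrals into a comparison of volumes. For L disjoint from \<open>E0\<close>, letting U shrink to
  L will give zero.\<close>

lemma translate_le:
  assumes p: "p \<in> SW" and L: "compact L" "L \<subseteq> U" and U: "open U" "U \<subseteq> C" "compact C"
  shows "emeasure vol {x \<in> E0. x \<otimes> p \<in> L} \<le> emeasure vol (E0 \<inter> U)"
proof -
  obtain u where u: "sf u" "\<And>x. 0 \<le> u x" "\<And>x. u x \<le> 1" "\<And>x. x \<in> L \<Longrightarrow> u x = 1"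
    "compact (closure {x. u x \<noteq> 0})" "\<And>x. x \<notin> U \<Longrightarrow> u x = 0"
    by (rule compact_bump[OF L U(1)]) (rule that)
  let ?D = "{x \<in> E0. x \<otimes> p \<in> L}"
  have Lb: "L \<in> sets borel" by (intro borel_closed compact_imp_closed L)
  have D: "?D \<in> sets vol" using translate_measurable[OF Lb] by simp
  have Df: "emeasure vol ?D < \<infinity>" by (rule compact_translate_finite[OF L(1)])
  have EU: "E0 \<inter> U \<in> sets vol" using E0 U(1) by auto
  have EUf: "emeasure vol (E0 \<inter> U) < \<infinity>" by (rule vol_subset_compact[OF U(3)]) (use U(2) in auto)
  have i1: "integrable vol (\<lambda>x. indicator E0 x * u (x \<otimes> p))"
    by (rule integrable_compact_support[OF sf_translate(2)[OF u(1)] supp_translate[OF u(5)]])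
  have i2: "integrable vol (\<lambda>x. indicator E0 x * u x)" by (rule integrable_compact_support[OF u(1,5)])
  have "measure vol ?D = (\<integral>x. indicator ?D x \<partial>vol)" using D by (simp add: space_vol)
  also have "\<dots> \<le> (\<integral>x. indicator E0 x * u (x \<otimes> p) \<partial>vol)"
  proof (rule integral_mono[OF _ i1])
    show "integrable vol (indicator ?D :: 'g \<Rightarrow> real)" using D Df by (simp add: integrable_indicator_iff)
    show "indicator ?D x \<le> indicator E0 x * u (x \<otimes> p)" for x
      using u(2)[of "x \<otimes> p"] u(4)[of "x \<otimes> p"] by (auto split: split_indicator)
  qed
  also have "\<dots> \<le> (\<integral>x. indicator E0 x * u x \<partial>vol)"
    using semigroup_monotone[OF p u(1,5,2)] by (simp add: set_lebesgue_integral_def)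
  also have "\<dots> \<le> (\<integral>x. indicator (E0 \<inter> U) x \<partial>vol)"
  proof (rule integral_mono[OF i2])
    show "integrable vol (indicator (E0 \<inter> U) :: 'g \<Rightarrow> real)" using EU EUf by (simp add: integrable_indicator_iff)
    show "indicator E0 x * u x \<le> indicator (E0 \<inter> U) x" for x
      using u(3)[of x] u(6)[of x] by (auto split: split_indicator)
  qed
  also have "\<dots> = measure vol (E0 \<inter> U)" using EU by (simp add: space_vol)
  finally have m: "measure vol ?D \<le> measure vol (E0 \<inter> U)" .
  have "emeasure vol ?D = ennreal (measure vol ?D)" by (rule emeasure_eq_ennreal_measure) (use Df in auto)
  also have "\<dots> \<le> ennreal (measure vol (E0 \<inter> U))" by (rule ennreal_leI[OF m])
  also have "\<dots> = emeasure vol (E0 \<inter> U)" by (rule emeasure_eq_ennreal_measure[symmetric]) (use EUf in auto)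
  finally show ?thesis .
qed

text \<open>Inner regularity, transported from the coordinate space by a chart, reduces the claim to
  compact sets.\<close>

lemma translate_null_chart:
  assumes p: "p \<in> SW" and U: "(U, \<phi>) \<in> A" and r: "cball (\<phi> y) r \<subseteq> \<phi> ` U"
  defines "Q \<equiv> U \<inter> \<phi> -` ball (\<phi> y) r"
  shows "emeasure vol {x \<in> E0. x \<otimes> p \<in> Q - E0} = 0"
proof (rule ccontr)
  assume pos: "emeasure vol {x \<in> E0. x \<otimes> p \<in> Q - E0} \<noteq> 0"
  have Q: "open Q" unfolding Q_def by (rule continuous_open_preimage[OF chart(3,1)[OF U] open_ball])
  define C where "C = inv_into U \<phi> ` cball (\<phi> y) r"
  have C: "compact C" unfolding C_def
    by (intro compact_continuous_image continuous_on_subset[OF chart(4)[OF U] r] compact_cball)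
  have QC: "Q \<subseteq> C"
  proof
    fix x assume "x \<in> Q"
    then show "x \<in> C" unfolding C_def Q_def by (intro image_eqI[of _ _ "\<phi> x"]) (auto simp: chart(5)[OF U])
  qed
  \<comment> \<open>The chart extended by 0 outside its domain, to have a Borel map on the whole
    group.\<close>
  define \<psi> where "\<psi> = (\<lambda>x. indicator U x *\<^sub>R \<phi> x)"
  have \<psi>: "\<psi> \<in> borel_measurable borel" unfolding \<psi>_def
    using chart(1,3)[OF U] by (intro borel_measurable_continuous_on_indicator) auto
  let ?D = "{x \<in> E0. x \<otimes> p \<in> Q}"
  have D: "?D \<in> sets vol" using translate_measurable[of Q p] Q by auto
  \<comment> \<open>A finite Borel measure on the coordinate space, where inner regularity by
    compact sets is available.\<close>
  define m where "m = distr (density vol (indicator ?D)) borel (\<lambda>x. \<psi> (x \<otimes> p))"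
  have \<psi>p: "(\<lambda>x. \<psi> (x \<otimes> p)) \<in> borel_measurable borel"
    by (rule measurable_compose[OF borel_measurable_continuous_onI[OF continuous_mult_right] \<psi>])
  have m: "emeasure m B = emeasure vol {x \<in> E0. x \<otimes> p \<in> Q \<and> \<phi> (x \<otimes> p) \<in> B}" if B: "B \<in> sets borel" for B
  proof -
    have pre: "(\<lambda>x. \<psi> (x \<otimes> p)) -` B \<in> sets vol"
      using measurable_sets[OF \<psi>p B] by simp
    have "emeasure m B = emeasure (density vol (indicator ?D)) ((\<lambda>x. \<psi> (x \<otimes> p)) -` B)"
      unfolding m_def using emeasure_distr[of "\<lambda>x. \<psi> (x \<otimes> p)" "density vol (indicator ?D)" borel B] B \<psi>p measurable_vol[OF \<psi>p]
      by (simp add: space_vol)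
    also have "\<dots> = (\<integral>\<^sup>+x. indicator ?D x * indicator ((\<lambda>x. \<psi> (x \<otimes> p)) -` B) x \<partial>vol)"
      using D pre by (intro emeasure_density) auto
    also have "\<dots> = (\<integral>\<^sup>+x. indicator {x \<in> E0. x \<otimes> p \<in> Q \<and> \<phi> (x \<otimes> p) \<in> B} x \<partial>vol)"
      by (intro nn_integral_cong) (auto simp: \<psi>_def Q_def split: split_indicator)
    also have "\<dots> = emeasure vol {x \<in> E0. x \<otimes> p \<in> Q \<and> \<phi> (x \<otimes> p) \<in> B}"
    proof (rule nn_integral_indicator)
      have "{x \<in> E0. x \<otimes> p \<in> Q \<and> \<phi> (x \<otimes> p) \<in> B} = ?D \<inter> (\<lambda>x. \<psi> (x \<otimes> p)) -` B"
        by (auto simp: \<psi>_def Q_def)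
      then show "{x \<in> E0. x \<otimes> p \<in> Q \<and> \<phi> (x \<otimes> p) \<in> B} \<in> sets vol" using D pre by auto
    qed
    finally show ?thesis .
  qed
  let ?B = "\<phi> ` (Q - E0)"
  have QU: "Q \<subseteq> U" by (auto simp: Q_def)
  have B: "?B \<in> sets borel"
  proof -
    have "inv_into U \<phi> \<in> borel_measurable (restrict_space borel (\<phi> ` U))"
      by (rule borel_measurable_continuous_on_restrict[OF chart(4)[OF U]])
    moreover have "Q - E0 \<in> sets borel" using Q E0 by auto
    ultimately have "inv_into U \<phi> -` (Q - E0) \<inter> space (restrict_space borel (\<phi> ` U)) \<in> sets (restrict_space borel (\<phi> ` U))"
      by (rule measurable_sets)
    moreover have "inv_into U \<phi> -` (Q - E0) \<inter> space (restrict_space borel (\<phi> ` U)) = ?B"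
    proof (intro equalityI subsetI)
      fix z assume "z \<in> inv_into U \<phi> -` (Q - E0) \<inter> space (restrict_space borel (\<phi> ` U))"
      then have "inv_into U \<phi> z \<in> Q - E0" "z \<in> \<phi> ` U" by (auto simp: space_restrict_space)
      then show "z \<in> ?B" using chart(6)[OF U] by (intro image_eqI[of _ _ "inv_into U \<phi> z"]) auto
    next
      fix z assume "z \<in> ?B"
      then show "z \<in> inv_into U \<phi> -` (Q - E0) \<inter> space (restrict_space borel (\<phi> ` U))"
        using QU chart(5)[OF U] by (auto simp: space_restrict_space)
    qed
    ultimately show ?thesis using chart(2)[OF U] by (simp add: sets_restrict_space_iff)
  qed
  have inj: "x \<in> Z" if "\<phi> x \<in> \<phi> ` Z" "x \<in> U" "Z \<subseteq> U" for x Z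
    using that chart(5)[OF U] by (metis (no_types, lifting) imageE subsetD)
  have "{x \<in> E0. x \<otimes> p \<in> Q \<and> \<phi> (x \<otimes> p) \<in> ?B} = {x \<in> E0. x \<otimes> p \<in> Q - E0}"
    using inj[of _ "Q - E0"] QU by blast
  then have mB: "emeasure m ?B \<noteq> 0" using m[OF B] pos by simp
  have sm: "sets m = sets borel" by (simp add: m_def)
  have "emeasure m UNIV = emeasure vol ?D" using m[of UNIV] by simp
  also have "\<dots> \<le> emeasure vol {x \<in> E0. x \<otimes> p \<in> C}"
    using QC translate_measurable[OF borel_closed[OF compact_imp_closed[OF C]], of p] by (intro emeasure_mono) auto
  also have "\<dots> < \<infinity>" by (rule compact_translate_finite[OF C])
  finally have fin: "emeasure m (space m) \<noteq> \<infinity>" using sets_eq_imp_space_eq[OF sm] by simp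
  obtain K where K: "K \<subseteq> ?B" "compact K" "emeasure m K \<noteq> 0"
  proof (rule ccontr)
    assume "\<not> thesis"
    then have "\<And>K. K \<in> {K. K \<subseteq> ?B \<and> compact K} \<Longrightarrow> emeasure m K = 0" using that by blast
    then have "(SUP K\<in>{K. K \<subseteq> ?B \<and> compact K}. emeasure m K) = 0"
      by (auto simp: SUP_eq_iff bot_ennreal intro!: antisym SUP_least)
    then show False using inner_regular[OF sm fin B] mB by simp
  qed
  have Kn: "K \<noteq> {}" using K(3) by auto
  have KU: "K \<subseteq> \<phi> ` U" using K(1) QU by auto
  define L where "L = inv_into U \<phi> ` K"
  have L: "compact L" unfolding L_def by (intro compact_continuous_image continuous_on_subset[OF chart(4)[OF U] KU] K(2))
  have LQ: "L \<subseteq> Q - E0"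
  proof
    fix x assume "x \<in> L"
    then obtain z where "z \<in> K" "x = inv_into U \<phi> z" by (auto simp: L_def)
    moreover from this obtain w where "w \<in> Q - E0" "z = \<phi> w" using K(1) by blast
    ultimately show "x \<in> Q - E0" using chart(5)[OF U, of w] QU by auto
  qed
  have phL: "\<phi> x \<in> K \<longleftrightarrow> x \<in> L" if "x \<in> Q" for x
  proof
    show "x \<in> L" if "\<phi> x \<in> K" unfolding L_def
      using that \<open>x \<in> Q\<close> QU chart(5)[OF U, of x] by (intro image_eqI[of _ _ "\<phi> x"]) auto
    show "\<phi> x \<in> K" if "x \<in> L" using that KU chart(6)[OF U] by (auto simp: L_def)
  qed
  have KL: "emeasure m K = emeasure vol {x \<in> E0. x \<otimes> p \<in> L}"
  proof -
    have "{x \<in> E0. x \<otimes> p \<in> Q \<and> \<phi> (x \<otimes> p) \<in> K} = {x \<in> E0. x \<otimes> p \<in> L}" using phL LQ by blast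
    then show ?thesis using m[of K] K(2) by (simp add: borel_closed compact_imp_closed)
  qed
  \<comment> \<open>Coordinate neighbourhoods of L of width 1/(n+1), open in the group. They shrink
    to L, so their intersections with \<open>E0\<close> decrease to the empty set.\<close>
  define Qn where "Qn = (\<lambda>n. Q \<inter> (U \<inter> \<phi> -` {z. infdist z K < 1 / real (Suc n)}))"
  have oQn: "open (Qn n)" for n
  proof -
    have "open {z. infdist z K < 1 / real (Suc n)}"
      by (rule open_Collect_less) (intro continuous_intros)+
    then show ?thesis unfolding Qn_def by (intro open_Int Q continuous_open_preimage[OF chart(3,1)[OF U]])
  qed
  have LQn: "L \<subseteq> Qn n" for n
  proof
    fix x assume x: "x \<in> L"
    then have "x \<in> Q" "\<phi> x \<in> K" using LQ phL by auto
    then show "x \<in> Qn n" using QU by (auto simp: Qn_def)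
  qed
  have QnC: "Qn n \<subseteq> C" for n using QC by (auto simp: Qn_def)
  have "(\<lambda>n. emeasure vol (E0 \<inter> Qn n)) \<longlonglongrightarrow> emeasure vol (\<Inter>n. E0 \<inter> Qn n)"
  proof (rule Lim_emeasure_decseq)
    show "range (\<lambda>n. E0 \<inter> Qn n) \<subseteq> sets vol" using E0 oQn by auto
    show "decseq (\<lambda>n. E0 \<inter> Qn n)"
    proof (rule decseq_SucI)
      fix n
      have "1 / real (Suc (Suc n)) \<le> 1 / real (Suc n)" by (simp add: field_simps)
      then show "E0 \<inter> Qn (Suc n) \<subseteq> E0 \<inter> Qn n" by (auto simp: Qn_def simp del: of_nat_Suc)
    qed
    show "emeasure vol (E0 \<inter> Qn n) \<noteq> \<infinity>" for n
    proof -
      have "E0 \<inter> Qn n \<subseteq> C" using QnC[of n] by blast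
      from vol_subset_compact[OF C this] show ?thesis by simp
    qed
  qed
  moreover have "(\<Inter>n. E0 \<inter> Qn n) = {}"
  proof (rule equals0I)
    fix x assume x: "x \<in> (\<Inter>n. E0 \<inter> Qn n)"
    then have xx: "x \<in> E0" "x \<in> Q" "\<And>n. infdist (\<phi> x) K < 1 / real (Suc n)" by (auto simp: Qn_def)
    have "infdist (\<phi> x) K \<le> 0"
    proof (rule ccontr)
      assume "\<not> infdist (\<phi> x) K \<le> 0"
      then have "0 < infdist (\<phi> x) K" by simp
      then obtain n where "inverse (real (Suc n)) < infdist (\<phi> x) K" by (blast dest: reals_Archimedean)
      then show False using xx(3)[of n] by (simp add: inverse_eq_divide)
    qed
    then have "infdist (\<phi> x) K = 0" using infdist_nonneg[of "\<phi> x" K] by simp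
    then have "\<phi> x \<in> K" using in_closed_iff_infdist_zero[OF compact_imp_closed[OF K(2)] Kn] by simp
    then show False using phL[OF xx(2)] LQ xx(1) by auto
  qed
  ultimately have lim: "(\<lambda>n. emeasure vol (E0 \<inter> Qn n)) \<longlonglongrightarrow> 0" by simp
  have "emeasure vol {x \<in> E0. x \<otimes> p \<in> L} \<le> 0"
    by (rule LIMSEQ_le_const[OF lim]) (use translate_le[OF p L LQn oQn QnC C] in auto)
  then show False using K(3) KL by simp
qed

text \<open>The chart balls of \<open>translate_null_chart\<close>, pulled back by right
  translation, give neighbourhoods to which \<open>open_null_cover\<close> applies.\<close>

lemma translate_null:
  assumes p: "p \<in> SW"
  shows "emeasure vol {x \<in> E0. x \<otimes> p \<notin> E0} = 0"
proof -
  have mD: "{x \<in> E0. x \<otimes> p \<notin> E0} \<in> sets borel"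
    using translate_measurable[of "- E0" p] E0 by auto
  have "emeasure vol (UNIV \<inter> {x \<in> E0. x \<otimes> p \<notin> E0}) = 0"
  proof (rule open_null_cover[OF _ mD])
    fix x :: 'g
    obtain U \<phi> where U: "(U, \<phi>) \<in> A" "x \<otimes> p \<in> U" by (rule chart_exists)
    obtain r where r: "r > 0" "cball (\<phi> (x \<otimes> p)) r \<subseteq> \<phi> ` (U \<inter> UNIV)"
      using chart_ball[OF U open_UNIV UNIV_I] by blast
    let ?Q = "U \<inter> \<phi> -` ball (\<phi> (x \<otimes> p)) r"
    have Q: "open ?Q" by (rule continuous_open_preimage[OF chart(3,1)[OF U(1)] open_ball])
    have "(\<lambda>x. x \<otimes> p) -` ?Q \<inter> {x \<in> E0. x \<otimes> p \<notin> E0} = {x \<in> E0. x \<otimes> p \<in> ?Q - E0}" by auto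
    then have "emeasure vol ((\<lambda>x. x \<otimes> p) -` ?Q \<inter> {x \<in> E0. x \<otimes> p \<notin> E0}) = 0"
      using translate_null_chart[OF p U(1), of "x \<otimes> p" r] r(2) by simp
    moreover have "open ((\<lambda>x. x \<otimes> p) -` ?Q)" by (intro open_vimage Q continuous_mult_right)
    moreover have "x \<in> (\<lambda>x. x \<otimes> p) -` ?Q" using U(2) r(1) by simp
    ultimately show "\<exists>U. open U \<and> x \<in> U \<and> emeasure vol (U \<inter> {x \<in> E0. x \<otimes> p \<notin> E0}) = 0" by blast
  qed simp
  then show ?thesis by simp
qed

definition I :: "'g set" where "I = interior SW"

lemma I: "open I" "I \<subseteq> SW" "I \<noteq> {}"
  using interior_SW interior_subset by (auto simp: I_def)

text \<open>The exceptional null set of \<open>translate_null\<close> depends on p, and uncountably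
  many p occur. Fubini exchanges the roles: for almost every x the bad p form a null set, which left
  invariance carries to the bad points of x I.\<close>

lemma almost_every_translate:
  "AE x in vol. x \<in> E0 \<longrightarrow> emeasure vol ((\<lambda>y. x \<otimes> y) ` I - E0) = 0"
proof -
  interpret pair_sigma_finite vol vol ..
  let ?P = "vol \<Otimes>\<^sub>M vol"
  have setsP: "sets ?P = sets (borel :: ('g \<times> 'g) measure)"
    unfolding borel_prod[symmetric] by (rule sets_pair_measure_cong[OF sets_vol sets_vol])
  define Z where "Z = {q. fst q \<in> E0 \<and> snd q \<in> I \<and> fst q \<otimes> snd q \<notin> E0}"
  have "E0 \<times> I \<in> sets (borel :: ('g \<times> 'g) measure)"
    unfolding borel_prod[symmetric] using E0 I(1) by (intro pair_measureI) auto
  moreover have "(\<lambda>q. fst q \<otimes> snd q) -` (- E0) \<in> sets (borel :: ('g \<times> 'g) measure)"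
    by (rule vimage_borel) (use E0 in \<open>auto intro!: continuous_on_mult continuous_on_fst continuous_on_snd continuous_on_id\<close>)
  moreover have "Z = (E0 \<times> I) \<inter> (\<lambda>q. fst q \<otimes> snd q) -` (- E0)" by (auto simp: Z_def)
  ultimately have Z: "Z \<in> sets ?P" unfolding setsP by auto
  have "emeasure ?P Z = (\<integral>\<^sup>+p. emeasure vol ((\<lambda>x. (x, p)) -` Z) \<partial>vol)"
    by (rule emeasure_pair_measure_alt2[OF Z])
  also have "\<dots> = (\<integral>\<^sup>+p. 0 \<partial>vol)"
  proof (rule nn_integral_cong)
    fix p
    show "emeasure vol ((\<lambda>x. (x, p)) -` Z) = 0"
    proof (cases "p \<in> I")
      case True
      then have "(\<lambda>x. (x, p)) -` Z = {x \<in> E0. x \<otimes> p \<notin> E0}" by (auto simp: Z_def)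
      then show ?thesis using translate_null[of p] True I(2) by auto
    next
      case False
      then have "(\<lambda>x. (x, p)) -` Z = {}" by (auto simp: Z_def)
      then show ?thesis by simp
    qed
  qed
  finally have "(\<integral>\<^sup>+x. emeasure vol (Pair x -` Z) \<partial>vol) = 0"
    using vol.emeasure_pair_measure_alt[OF Z] by simp
  then have "AE x in vol. emeasure vol (Pair x -` Z) = 0"
    using vol.measurable_emeasure_Pair[OF Z] by (simp add: nn_integral_0_iff_AE)
  then show ?thesis
  proof eventually_elim
    case (elim x)
    show ?case
    proof
      assume x: "x \<in> E0"
      have "(\<lambda>y. x \<otimes> y) ` (Pair x -` Z) = (\<lambda>y. x \<otimes> y) ` I - E0" using x by (auto simp: Z_def)
      moreover have "Pair x -` Z \<in> sets borel" using sets_Pair1[OF Z] by (simp add: sets_vol)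
      ultimately show "emeasure vol ((\<lambda>y. x \<otimes> y) ` I - E0) = 0" using vol_left[of "Pair x -` Z" x] elim by simp
    qed
  qed
qed

section \<open>The open representative\<close>

definition ess_interior :: "'g set" where
  "ess_interior = {z. \<exists>U. open U \<and> z \<in> U \<and> emeasure vol (U - E0) = 0}"

definition ess_support :: "'g set" where
  "ess_support = {y. \<forall>U. open U \<longrightarrow> y \<in> U \<longrightarrow> emeasure vol (U \<inter> E0) \<noteq> 0}"

text \<open>The x with \<open>y \<otimes> p\<close> in x I form an open neighbourhood of y. It meets
  \<open>E0\<close> in positive measure, so it contains some x for which x I lies in
  \<open>E0\<close> up to a null set, and this x I is the neighbourhood sought.\<close>

lemma support_I:
  assumes y: "y \<in> ess_support" and p: "p \<in> I"
  shows "y \<otimes> p \<in> ess_interior"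
proof -
  let ?U = "(\<lambda>x. inv x \<otimes> (y \<otimes> p)) -` I"
  have U: "open ?U" by (intro open_vimage I(1) continuous_on_mult continuous_on_inv continuous_on_id continuous_on_const)
  have "y \<in> ?U" using p by (simp add: m_assoc[symmetric])
  then have nz: "emeasure vol (?U \<inter> E0) \<noteq> 0" using y U by (auto simp: ess_support_def)
  have "\<exists>x\<in>?U \<inter> E0. emeasure vol ((\<lambda>y. x \<otimes> y) ` I - E0) = 0"
  proof (rule ccontr)
    assume "\<not> ?thesis"
    with almost_every_translate have "AE x in vol. x \<notin> ?U \<inter> E0" by (auto elim!: eventually_mono)
    then have "?U \<inter> E0 \<in> null_sets vol"
      using U E0 by (subst AE_iff_null_sets) auto
    then show False using nz by auto
  qed
  then obtain x where x: "x \<in> ?U" "emeasure vol ((\<lambda>y. x \<otimes> y) ` I - E0) = 0" by blast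
  have "y \<otimes> p = x \<otimes> (inv x \<otimes> (y \<otimes> p))" by (simp add: m_assoc[symmetric])
  then have "y \<otimes> p \<in> (\<lambda>y. x \<otimes> y) ` I" using x(1) by blast
  then show ?thesis using x(2) left_open[OF I(1), of x] unfolding ess_interior_def by blast
qed

lemma ess_interior_open: "open ess_interior"
  unfolding ess_interior_def by (subst open_subopen) blast

lemma ess_interior_support: "ess_interior \<subseteq> ess_support"
proof
  fix z assume "z \<in> ess_interior"
  then obtain U where U: "open U" "z \<in> U" "emeasure vol (U - E0) = 0" by (auto simp: ess_interior_def)
  have "emeasure vol (U' \<inter> E0) \<noteq> 0" if U': "open U'" "z \<in> U'" for U'
  proof
    assume 0: "emeasure vol (U' \<inter> E0) = 0"
    have "emeasure vol (U \<inter> U') \<le> emeasure vol ((U' \<inter> E0) \<union> (U - E0))"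
      using U U' E0 by (intro emeasure_mono) auto
    also have "\<dots> \<le> emeasure vol (U' \<inter> E0) + emeasure vol (U - E0)"
      using U U' E0 by (intro emeasure_subadditive) auto
    also have "\<dots> = 0" using 0 U(3) by simp
    finally show False using vol_open_pos[of "U \<inter> U'"] U U' by auto
  qed
  then show "z \<in> ess_support" by (auto simp: ess_support_def)
qed

lemma ess_support_closed: "closed ess_support"
proof -
  have "- ess_support = \<Union>{U. open U \<and> emeasure vol (U \<inter> E0) = 0}" by (auto simp: ess_support_def)
  then have "open (- ess_support)" by (simp add: open_Union)
  then show ?thesis by (simp add: closed_def)
qed

lemma dil_SW: "t > 0 \<Longrightarrow> \<delta> t ` SW = SW"
  by (rule dil_gen[OF W_V1]) (auto intro: W_scale)

lemma dil_I: "t > 0 \<Longrightarrow> x \<in> I \<Longrightarrow> \<delta> t x \<in> I"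
proof -
  assume t: "t > 0" and x: "x \<in> I"
  have "\<delta> t ` I \<subseteq> \<delta> t ` SW" using I(2) by blast
  then have "\<delta> t ` I \<subseteq> I" unfolding I_def dil_SW[OF t]
    by (intro interior_maximal) (use dil_open[OF t I(1)] in \<open>simp_all add: I_def\<close>)
  then show "\<delta> t x \<in> I" using x by blast
qed

text \<open>Dilations push an interior point of the semigroup towards \<open>\<one>\<close> without
  leaving the interior.\<close>

lemma small_I:
  assumes "open U" "\<one> \<in> U" obtains p where "p \<in> I" "p \<in> U"
proof -
  obtain q where q: "q \<in> I" using I(3) by blast
  obtain \<epsilon> where \<epsilon>: "\<epsilon> > 0" "\<And>x. cc_norm x < \<epsilon> \<Longrightarrow> x \<in> U" using cc_norm_small_nbhd[OF assms] by blast
  define t where "t = \<epsilon> / (cc_norm q + 1)"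
  have t: "t > 0" using \<epsilon>(1) cc_norm_nonneg[of q] by (simp add: t_def)
  have "cc_norm (\<delta> t q) = t * cc_norm q" by (rule cc_norm_dil[OF t])
  also have "\<dots> < \<epsilon>" using \<epsilon>(1) cc_norm_nonneg[of q] by (simp add: t_def field_simps)
  finally show ?thesis using that[OF dil_I[OF t q]] \<epsilon>(2) by blast
qed

text \<open>Used to write x as \<open>(x \<otimes> inv p) \<otimes> p\<close> with the first factor
  still in a given open set, so that \<open>support_I\<close> can be applied to it.\<close>

lemma shrink_into_open:
  assumes "open U" "x \<in> U" obtains p where "p \<in> I" "x \<otimes> inv p \<in> U"
proof -
  have "open ((\<lambda>p. x \<otimes> inv p) -` U)"
    by (intro open_vimage assms continuous_on_mult continuous_on_inv continuous_on_id continuous_on_const)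
  then show ?thesis using small_I[of "(\<lambda>p. x \<otimes> inv p) -` U"] assms(2) that by auto
qed

text \<open>Right translation by w in \<open>SW\<close> maps \<open>I\<close> to an open subset of
  the semigroup, hence into \<open>I\<close>. A limit point p is approximated by w so closely that
  \<open>q \<otimes> p \<otimes> inv w\<close> is still in \<open>I\<close>.\<close>

lemma I_closure:
  assumes q: "q \<in> I" and p: "p \<in> closure SW" shows "q \<otimes> p \<in> I"
proof -
  have 1: "x \<otimes> w \<in> I" if "x \<in> I" "w \<in> SW" for x w
  proof -
    let ?O = "(\<lambda>y. y \<otimes> inv w) -` I"
    have "?O \<subseteq> SW"
    proof
      fix y assume "y \<in> ?O"
      then have "y \<otimes> inv w \<in> SW" using I(2) by auto
      from gen_mult[OF this that(2)] show "y \<in> SW" by (simp add: m_assoc)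
    qed
    then have "?O \<subseteq> I" unfolding I_def by (rule interior_maximal) (intro open_vimage open_interior continuous_mult_right)
    moreover have "x \<otimes> w \<in> ?O" using that(1) by (simp add: m_assoc)
    ultimately show ?thesis by blast
  qed
  let ?U = "(\<lambda>w. q \<otimes> p \<otimes> inv w) -` I"
  have "open ?U" by (intro open_vimage I(1) continuous_on_mult continuous_on_inv continuous_on_id continuous_on_const)
  moreover have "p \<in> ?U" using q by (simp add: m_assoc)
  ultimately obtain w where w: "w \<in> SW" "w \<in> ?U" using p closure_iff_nhds_not_empty[of p SW] by blast
  then have "q \<otimes> p \<otimes> inv w \<in> I" by simp
  from 1[OF this w(1)] show ?thesis by (simp add: m_assoc)
qed

text \<open>A small q in \<open>I\<close> is inserted: x p = (x q^-1)(q p), where x q^-1 is still in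
  the open set and q p lies in \<open>I\<close> even for p in the closure.\<close>

lemma ess_interior_cone:
  assumes x: "x \<in> ess_interior" and p: "p \<in> closure SW" shows "x \<otimes> p \<in> ess_interior"
proof -
  obtain q where q: "q \<in> I" "x \<otimes> inv q \<in> ess_interior" using shrink_into_open[OF ess_interior_open x] .
  then have "(x \<otimes> inv q) \<otimes> (q \<otimes> p) \<in> ess_interior"
    using support_I[OF _ I_closure[OF q(1) p]] ess_interior_support by blast
  moreover have "(x \<otimes> inv q) \<otimes> (q \<otimes> p) = ((x \<otimes> inv q) \<otimes> q) \<otimes> p" by (rule m_assoc[symmetric]) auto
  moreover have "(x \<otimes> inv q) \<otimes> q = x" by (simp add: m_assoc)
  ultimately show ?thesis by simp
qed

text \<open>The closure lies in the closed set \<open>ess_support\<close>; a point interior to it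
  can be moved back slightly by \<open>inv p\<close> and is recovered by
  \<open>support_I\<close>.\<close>

lemma ess_interior_regularly_open: "regularly_open ess_interior"
  unfolding regularly_open_def
proof
  show "ess_interior \<subseteq> interior (closure ess_interior)"
    using ess_interior_open closure_subset by (rule interior_maximal[rotated])
  show "interior (closure ess_interior) \<subseteq> ess_interior"
  proof
    fix x assume "x \<in> interior (closure ess_interior)"
    then obtain p where p: "p \<in> I" "x \<otimes> inv p \<in> interior (closure ess_interior)"
      using shrink_into_open[OF open_interior] by blast
    have "closure ess_interior \<subseteq> ess_support" by (rule closure_minimal[OF ess_interior_support ess_support_closed])
    then have "x \<otimes> inv p \<in> ess_support" using p(2) interior_subset by blast
    then have "(x \<otimes> inv p) \<otimes> p \<in> ess_interior" using p(1) by (rule support_I)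
    then show "x \<in> ess_interior" by (simp add: m_assoc)
  qed
qed

lemma contractible_ess_interior: "contractible ess_interior"
proof -
  obtain p where p: "p \<in> I" using I(3) by blast
  show ?thesis
  proof (rule contractible_cone_property[of SW p])
    show "\<one> \<in> SW" by (rule SW_one)
    show "\<delta> t x \<in> SW" if "t > 0" "x \<in> SW" for t x using dil_SW[OF that(1)] that(2) by blast
    show "p \<in> interior SW" using p by (simp add: I_def)
    show "x \<otimes> y \<in> ess_interior" if "x \<in> ess_interior" "y \<in> SW" for x y
      using ess_interior_cone that closure_subset by blast
  qed
qed

text \<open>The cone property read backwards: if x is outside and inv y lies in \<open>SW\<close>,
  then x y is outside, since multiplying by inv y would otherwise bring x inside.\<close>

lemma contractible_complement: "contractible (- ess_interior)"
proof -
  obtain p where p: "p \<in> I" using I(3) by blast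
  let ?T = "(\<lambda>x. inv x) -` SW"
  show ?thesis
  proof (rule contractible_cone_property[of ?T "inv p"])
    show "\<one> \<in> ?T" by (simp add: SW_one)
    show "\<delta> t x \<in> ?T" if "t > 0" "x \<in> ?T" for t x
    proof -
      have "\<delta> t (inv x) \<in> \<delta> t ` SW" using that(2) by (intro imageI) simp
      then show ?thesis by (simp add: dil_SW[OF that(1)] dil_inv[OF that(1)])
    qed
    have "(\<lambda>x. inv x) -` I \<subseteq> interior ?T"
      by (rule interior_maximal) (use I in \<open>auto intro!: open_vimage continuous_on_inv continuous_on_id\<close>)
    then show "inv p \<in> interior ?T" using p by auto
    show "x \<otimes> y \<in> - ess_interior" if "x \<in> - ess_interior" "y \<in> ?T" for x y
    proof
      assume "x \<otimes> y \<in> ess_interior"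
      moreover have "inv y \<in> closure SW" using that(2) closure_subset[of SW] by auto
      ultimately have "(x \<otimes> y) \<otimes> inv y \<in> ess_interior" by (rule ess_interior_cone)
      then show False using that(1) by (simp add: m_assoc)
    qed
  qed
qed

section \<open>The Carnot-Lebesgue representative\<close>

definition Bs :: "real \<Rightarrow> 'g set" where "Bs r = {z. cc_norm z < r}"

lemma Bs_open: "open (Bs r)" unfolding Bs_def by (rule ball_cc_norm_open)

lemma Bs_one: "r > 0 \<Longrightarrow> \<one> \<in> Bs r" by (simp add: Bs_def cc_norm_one)

lemma carnot_ball: "{y. carnot_distance A (V 1) h x y < r} = (\<lambda>z. x \<otimes> z) ` Bs r"
  unfolding left_image by (auto simp: Bs_def carnot_distance_cc_norm)

lemma vol_translate_Bs: "emeasure vol ((\<lambda>z. x \<otimes> z) ` Bs r) = emeasure vol (Bs r)"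
  by (rule vol_left) (use Bs_open in auto)

lemma Bs_finite: "emeasure vol (Bs r) < \<infinity>"
  using ball_cc_norm_compact[of r] vol_subset_compact unfolding Bs_def by blast

lemma Bs_measure_pos: "r > 0 \<Longrightarrow> measure vol (Bs r) > 0"
  using vol_open_pos[OF Bs_open, of r] Bs_one[of r] emeasure_eq_ennreal_measure[of vol "Bs r"] Bs_finite[of r]
  by (metis empty_iff ennreal_0 less_irrefl measure_nonneg not_less_iff_gr_or_eq order_le_less infinity_ennreal_def)

lemma measure_Int_E:
  assumes B: "B \<in> sets borel"
  shows "measure (completion vol) (B \<inter> E) = measure vol (B \<inter> E0)"
proof -
  obtain N' where N': "N' \<in> null_sets vol" "E0 \<subseteq> E" "E - E0 \<subseteq> N'" using E_null by blast
  have "AE x in vol. x \<notin> N'" using N'(1) by (rule AE_not_in)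
  then have ae: "AE x in completion vol. x \<notin> N'" by (rule AE_completion)
  have "measure (completion vol) (B \<inter> E) = measure (completion vol) (B \<inter> E0)"
  proof (rule measure_eq_AE)
    show "AE x in completion vol. x \<in> B \<inter> E \<longleftrightarrow> x \<in> B \<inter> E0"
      using ae by eventually_elim (use N' in auto)
    show "B \<inter> E \<in> sets (completion vol)" using B E by (intro sets.Int) auto
    show "B \<inter> E0 \<in> sets (completion vol)" using B E0 by (intro sets_completionI_sets sets_volI) auto
  qed
  then show ?thesis using B E0 by simp
qed

lemma dil_Bs: "r > 0 \<Longrightarrow> z \<in> Bs (c * r) \<longleftrightarrow> \<delta> (1/r) z \<in> Bs c"
  by (simp add: Bs_def cc_norm_dil field_simps)

text \<open>The doubling property follows from compactness, because the dilations are automorphisms.\<close>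

lemma Bs_doubling:
  assumes \<epsilon>: "\<epsilon> > 0"
  obtains n :: real where "n > 0" "\<And>r. r > 0 \<Longrightarrow> measure vol (Bs r) \<le> n * measure vol (Bs (\<epsilon> * r))"
proof -
  obtain K where K: "compact K" "Bs 1 \<subseteq> K" using ball_cc_norm_compact[of 1] unfolding Bs_def by blast
  obtain D where D: "D \<subseteq> K" "finite D" "K \<subseteq> (\<Union>d\<in>D. (\<lambda>z. d \<otimes> z) ` Bs \<epsilon>)"
  proof (rule compactE_image[OF K(1), of K "\<lambda>d. (\<lambda>z. d \<otimes> z) ` Bs \<epsilon>"])
    show "open ((\<lambda>z. d \<otimes> z) ` Bs \<epsilon>)" for d by (rule left_open[OF Bs_open])
    have "d \<in> (\<lambda>z. d \<otimes> z) ` Bs \<epsilon>" for d using Bs_one[OF \<epsilon>] by (intro image_eqI[of _ _ \<one>]) auto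
    then show "K \<subseteq> (\<Union>d\<in>K. (\<lambda>z. d \<otimes> z) ` Bs \<epsilon>)" by blast
  qed (rule that)
  \<comment> \<open>Dilating by r turns the finite cover of \<open>Bs 1\<close> into a cover of
    \<open>Bs r\<close> with the same number of translates. The extra 1 makes the constant
    positive.\<close>
  have "measure vol (Bs r) \<le> (real (card D) + 1) * measure vol (Bs (\<epsilon> * r))" if r: "r > 0" for r
  proof -
    have "Bs r \<subseteq> (\<Union>d\<in>D. (\<lambda>z. \<delta> r d \<otimes> z) ` Bs (\<epsilon> * r))"
    proof
      fix x assume "x \<in> Bs r"
      then have "\<delta> (1/r) x \<in> Bs 1" using dil_Bs[OF r, of x 1] by simp
      then obtain d z where dz: "d \<in> D" "z \<in> Bs \<epsilon>" "\<delta> (1/r) x = d \<otimes> z" using K(2) D(3) by blast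
      have "x = \<delta> r (d \<otimes> z)" using dil_inverse(1)[OF r, of x] dz(3) by simp
      also have "\<dots> = \<delta> r d \<otimes> \<delta> r z" by (rule dil_hom[OF r])
      finally have x: "x = \<delta> r d \<otimes> \<delta> r z" .
      have "\<delta> r z \<in> Bs (\<epsilon> * r)" using dz(2) by (simp add: dil_Bs[OF r] dil_inverse(2)[OF r])
      then show "x \<in> (\<Union>d\<in>D. (\<lambda>z. \<delta> r d \<otimes> z) ` Bs (\<epsilon> * r))" using dz(1) x by blast
    qed
    then have "emeasure vol (Bs r) \<le> emeasure vol (\<Union>d\<in>D. (\<lambda>z. \<delta> r d \<otimes> z) ` Bs (\<epsilon> * r))"
      by (rule emeasure_mono) (use D(2) left_open[OF Bs_open] in \<open>auto intro!: sets.finite_UN\<close>)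
    also have "\<dots> \<le> (\<Sum>d\<in>D. emeasure vol ((\<lambda>z. \<delta> r d \<otimes> z) ` Bs (\<epsilon> * r)))"
      by (rule emeasure_subadditive_finite[OF D(2)]) (use left_open[OF Bs_open] in auto)
    also have "\<dots> = of_nat (card D) * emeasure vol (Bs (\<epsilon> * r))" by (simp add: vol_translate_Bs)
    also have "\<dots> \<le> of_nat (card D + 1) * emeasure vol (Bs (\<epsilon> * r))"
      by (intro mult_right_mono) auto
    also have "\<dots> = ennreal ((real (card D) + 1) * measure vol (Bs (\<epsilon> * r)))"
      using emeasure_eq_ennreal_measure[of vol "Bs (\<epsilon> * r)"] Bs_finite[of "\<epsilon> * r"]
      by (simp add: ennreal_mult' ennreal_of_nat_eq_real_of_nat del: of_nat_add of_nat_Suc) (simp add: add.commute)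
    finally have "ennreal (measure vol (Bs r)) \<le> ennreal ((real (card D) + 1) * measure vol (Bs (\<epsilon> * r)))"
      using emeasure_eq_ennreal_measure[of vol "Bs r"] Bs_finite[of r] by simp
    then show ?thesis by (subst (asm) ennreal_le_iff) auto
  qed
  then show ?thesis by (intro that[of "real (card D) + 1"]) auto
qed

lemma representative_eq:
  "lebesgue_representative (carnot_distance A (V 1) h) (completion vol) E = ess_interior"
proof -
  define q where "q = (\<lambda>x r. measure vol ((\<lambda>z. x \<otimes> z) ` Bs r \<inter> E0) / measure vol (Bs r))"
  have Bb: "(\<lambda>z. x \<otimes> z) ` Bs r \<in> sets borel" for x r using left_open[OF Bs_open] by (rule borel_open)
  have mB: "measure vol ((\<lambda>z. x \<otimes> z) ` Bs r) = measure vol (Bs r)" for x r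
    by (simp add: measure_def vol_translate_Bs)
  have rep: "lebesgue_representative (carnot_distance A (V 1) h) (completion vol) E = {x. (q x \<longlongrightarrow> 1) (at_right 0)}"
    unfolding lebesgue_representative_def carnot_ball q_def
    using Bb by (simp add: measure_Int_E mB)
  show ?thesis unfolding rep
  proof (intro equalityI subsetI CollectI)
    fix z assume "z \<in> ess_interior"
    then obtain U where U: "open U" "z \<in> U" "emeasure vol (U - E0) = 0" by (auto simp: ess_interior_def)
    have "open ((\<lambda>w. z \<otimes> w) -` U)" by (intro open_vimage U continuous_mult_left)
    moreover have "\<one> \<in> (\<lambda>w. z \<otimes> w) -` U" using U(2) by simp
    ultimately obtain \<epsilon> where \<epsilon>: "\<epsilon> > 0" "\<And>x. cc_norm x < \<epsilon> \<Longrightarrow> x \<in> (\<lambda>w. z \<otimes> w) -` U" using cc_norm_small_nbhd by blast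
    have "q z r = 1" if r: "0 < r" "r < \<epsilon>" for r
    proof -
      let ?B = "(\<lambda>w. z \<otimes> w) ` Bs r"
      have "?B \<subseteq> U" using \<epsilon>(2) r by (auto simp: Bs_def)
      then have "emeasure vol (?B - E0) \<le> emeasure vol (U - E0)"
        using U(1) E0 by (intro emeasure_mono) auto
      then have n: "?B - E0 \<in> null_sets vol" using U(3) Bb[of z r] E0 by auto
      have "measure vol ((?B \<inter> E0) \<union> (?B - E0)) = measure vol (?B \<inter> E0)"
        by (rule measure_Un_null_set) (use Bb E0 n in auto)
      then have "measure vol (?B \<inter> E0) = measure vol (Bs r)" by (simp add: Int_Diff_Un mB)
      then show ?thesis using Bs_measure_pos[OF r(1)] by (simp add: q_def)
    qed
    then have "eventually (\<lambda>r. q z r = 1) (at_right 0)"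
      unfolding eventually_at_right_field using \<epsilon>(1) by blast
    then show "(q z \<longlongrightarrow> 1) (at_right 0)" by (rule tendsto_eventually)
  next
    fix x assume "x \<in> {x. (q x \<longlongrightarrow> 1) (at_right 0)}"
    then have lim: "(q x \<longlongrightarrow> 1) (at_right 0)" by simp
    show "x \<in> ess_interior"
    proof (rule ccontr)
      assume nx: "x \<notin> ess_interior"
      \<comment> \<open>This is x I^-1. Its points avoid \<open>ess_support\<close>, for otherwise
        \<open>support_I\<close> would put x into \<open>ess_interior\<close>.\<close>
      let ?J = "(\<lambda>y. inv y \<otimes> x) -` I"
      have J: "open ?J" by (intro open_vimage I(1) continuous_on_mult continuous_on_inv continuous_on_id continuous_on_const)
      have J0: "emeasure vol (?J \<inter> E0) = 0"
      proof (rule open_null_cover)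
        fix y assume y: "y \<in> ?J"
        have "y \<otimes> (inv y \<otimes> x) = x" by (simp add: m_assoc[symmetric])
        then have "y \<notin> ess_support" using support_I[of y "inv y \<otimes> x"] y nx by auto
        then show "\<exists>U. open U \<and> y \<in> U \<and> emeasure vol (U \<inter> E0) = 0" by (auto simp: ess_support_def)
      qed (use J E0 in auto)
      have "open {p. cc_norm (inv p) < 1}"
        by (intro open_Collect_less continuous_on_const continuous_on_compose2[OF cc_norm_continuous[of UNIV]] continuous_on_inv continuous_on_id) auto
      then obtain p where p: "p \<in> I" "cc_norm (inv p) < 1" using small_I[of "{p. cc_norm (inv p) < 1}"] by (auto simp: cc_norm_one)
      let ?z = "inv p"
      let ?O = "{w. cc_norm (?z \<otimes> w) < 1} \<inter> (\<lambda>w. inv (?z \<otimes> w)) -` I"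
      have "open ?O"
        by (intro open_Int open_Collect_less open_vimage I(1) continuous_on_const continuous_on_compose2[OF cc_norm_continuous[of UNIV]]
            continuous_on_mult continuous_on_inv continuous_on_id) auto
      moreover have "\<one> \<in> ?O" using p by simp
      ultimately obtain \<epsilon> where \<epsilon>: "\<epsilon> > 0" "\<And>w. cc_norm w < \<epsilon> \<Longrightarrow> w \<in> ?O" using cc_norm_small_nbhd by blast
      obtain n :: real where n: "n > 0" "\<And>r. r > 0 \<Longrightarrow> measure vol (Bs r) \<le> n * measure vol (Bs (\<epsilon> * r))"
        by (rule Bs_doubling[OF \<epsilon>(1)]) (rule that)
      \<comment> \<open>Since \<open>I\<close> is a cone, the picture at scale 1 repeats inside x
        I^-1 at every scale r, so by doubling a fraction of at least 1/n of each ball misses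
        \<open>E0\<close>.\<close>
      have "q x r \<le> 1 - 1 / n" if r: "r > 0" for r
      proof -
        let ?B = "(\<lambda>w. x \<otimes> w) ` Bs r" and ?T = "(\<lambda>w. (x \<otimes> \<delta> r ?z) \<otimes> w) ` Bs (\<epsilon> * r)"
        have T: "?T \<subseteq> ?B \<inter> ?J"
        proof
          fix y assume "y \<in> ?T"
          then obtain w where w: "w \<in> Bs (\<epsilon> * r)" "y = (x \<otimes> \<delta> r ?z) \<otimes> w" by blast
          let ?w = "\<delta> (1/r) w"
          have "?w \<in> Bs \<epsilon>" using w(1) dil_Bs[OF r] by simp
          then have O: "cc_norm (?z \<otimes> ?w) < 1" "inv (?z \<otimes> ?w) \<in> I" using \<epsilon>(2)[of ?w] by (auto simp: Bs_def)
          have y: "y = x \<otimes> \<delta> r (?z \<otimes> ?w)"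
            using w(2) by (simp add: dil_hom[OF r] dil_inverse(1)[OF r] m_assoc)
          have "\<delta> r (?z \<otimes> ?w) \<in> Bs r" using O(1) r by (simp add: Bs_def cc_norm_dil[OF r])
          moreover have "inv y \<otimes> x = \<delta> r (inv (?z \<otimes> ?w))"
            unfolding y dil_inv[OF r] by (simp add: inv_mult_group[of x] m_assoc)
          ultimately show "y \<in> ?B \<inter> ?J" using y dil_I[OF r O(2)] by auto
        qed
        have Tm: "measure vol ?T = measure vol (Bs (\<epsilon> * r))" by (rule mB)
        have Bf: "emeasure vol ?B < \<infinity>" using Bs_finite[of r] by (simp add: vol_translate_Bs)
        have nJ: "?J \<inter> E0 \<in> null_sets vol" using J0 J E0 by auto
        have "measure vol (?B \<inter> E0) \<le> measure vol ((?B - ?T) \<union> (?J \<inter> E0))"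
        proof (rule measure_mono_fmeasurable)
          show "?B \<inter> E0 \<subseteq> (?B - ?T) \<union> (?J \<inter> E0)" using T by blast
          show "?B \<inter> E0 \<in> sets vol" using Bb E0 by auto
          have "emeasure vol ((?B - ?T) \<union> (?J \<inter> E0)) = emeasure vol (?B - ?T)"
            by (rule emeasure_Un_null_set) (use Bb nJ in auto)
          also have "\<dots> \<le> emeasure vol ?B" using Bb by (intro emeasure_mono) auto
          finally show "(?B - ?T) \<union> (?J \<inter> E0) \<in> fmeasurable vol"
            using Bf Bb E0 J by (intro fmeasurableI) auto
        qed
        also have "\<dots> = measure vol (?B - ?T)" by (rule measure_Un_null_set) (use Bb nJ in auto)
        also have "\<dots> = measure vol ?B - measure vol ?T" by (rule measure_Diff) (use Bf Bb T in auto)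
        also have "\<dots> = measure vol (Bs r) - measure vol (Bs (\<epsilon> * r))" unfolding Tm mB ..
        finally have 1: "measure vol (?B \<inter> E0) \<le> measure vol (Bs r) - measure vol (Bs (\<epsilon> * r))" .
        have "measure vol (Bs r) / n \<le> measure vol (Bs (\<epsilon> * r))"
          using n(2)[OF r] n(1) by (simp add: field_simps)
        with 1 have "measure vol (?B \<inter> E0) \<le> (1 - 1 / n) * measure vol (Bs r)" by (simp add: algebra_simps)
        then show ?thesis using Bs_measure_pos[OF r] by (simp add: q_def field_simps)
      qed
      then have "eventually (\<lambda>r. q x r \<le> 1 - 1 / n) (at_right 0)"
        unfolding eventually_at_right_field by (intro exI[of _ 1]) auto
      from tendsto_upperbound[OF lim this] have "1 \<le> 1 - 1 / n" by simp
      then show False using n(1) by simp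
    qed
  qed
qed

end

theorem theorem2p37:
  fixes G :: "'g::{second_countable_topology, t2_space} monoid"
    and A :: "('g, 'e::euclidean_space) atlas"
    and s :: nat
    and V :: "nat \<Rightarrow> 'g vfield set"
    and \<delta> :: "real \<Rightarrow> 'g \<Rightarrow> 'g"
    and vol :: "'g measure"
    and h :: "'g vfield \<Rightarrow> 'g vfield \<Rightarrow> real"
    and W :: "'g vfield set"
    and E :: "'g set"
  assumes "carnot_group G A s V"
    and "dilations G A (V 1) \<delta>"
    and "haar_measure G vol"
    and "scalar_product_on (V 1) h"
    and "horizontal_half_space (V 1) W"
    and "E \<in> sets (completion vol)"
    and "constant_normal A (completion vol) W E"
  defines "S \<equiv> generated_semigroup G A W"
    and "E' \<equiv> lebesgue_representative (carnot_distance A (V 1) h) (completion vol) E"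
  shows "is_subsemigroup G S \<and> is_cone \<delta> S \<and> interior S \<noteq> {} \<and>
    has_cone_property G (closure S) E' \<and> regularly_open E' \<and>
    contractible E' \<and> contractible (- E')"
proof -
  have "lie_group G A" using assms(1) by (simp add: carnot_group_def)
  then interpret const_normal G A s V \<delta> h W vol E
    using assms(1-7) by unfold_locales
  have E': "E' = ess_interior" unfolding E'_def by (rule representative_eq)
  have "is_subsemigroup G S"
    unfolding is_subsemigroup_def S_def using gen_mult by blast
  moreover have "is_cone \<delta> S"
    unfolding is_cone_def S_def using SW_one dil_SW by blast
  moreover have "interior S \<noteq> {}" unfolding S_def by (rule interior_SW)
  moreover have "has_cone_property G (closure S) E'"
    unfolding has_cone_property_def set_mult_def E' S_def using ess_interior_cone by blast
  ultimately show ?thesis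
    unfolding E' using ess_interior_regularly_open contractible_ess_interior contractible_complement by blast
qed

end
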